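(* Let $(r_t)_{t\ge0}$ be a stochastic interest rate process, $(V_t)_{t\ge0}$ a stochastic process, $\sigma$ a deterministic function, and let $S$ and $X$ be positive continuous processes, with deterministic initial values $S_0=X_0>0$, such that $$\frac{dS_t}{S_t}=r_t\,dt+\sqrt{V_t}\,dW_t,\qquad \frac{dX_t}{X_t}=r_t\,dt+\sigma(t,X_t)\,dW_t .$$ Set $F^{(1)}_t=S_te^{-\int_0^t r_sds}$ and $F^{(2)}_t=X_te^{-\int_0^t r_sds}$, and assume that for every $t\ge0$ the random variables $F^{(1)}_t$ and $F^{(2)}_t$ have the same law. Then $$\mathbb{E}\big[V_t\,\big|\,S_t=x e^{\int_0^t r_sds}\big]=\mathbb{E}\big[\sigma^2\big(t,xe^{\int_0^t r_sds}\big)\,\big|\,X_t=xe^{\int_0^t r_sds}\big]$$ for almost every $t\ge 0$ and almost every $x$ with respect to the common law of $F^{(1)}_t$ and $F^{(2)}_t$.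
   Context: $W$ is a Brownian motion on a filtered probability space and $r$ and $V$ are adapted, with $\int_0^t|r_s|ds<\infty$ a.s. Conditioning on $S_t=xe^{\int_0^t r_sds}$ means conditioning on $F^{(1)}_t=x$, and conditioning on $X_t=xe^{\int_0^t r_sds}$ means conditioning on $F^{(2)}_t=x$. Standing assumptions (boundedness and ellipticity): $\sigma$ is measurable, and $V$ and $\sigma^2$ are bounded above and bounded below by strictly positive constants. *)

theory Defs
  imports "HOL-Probability.Probability"
begin

text \<open>A process is a function \<open>Y :: real \<Rightarrow> 'a \<Rightarrow> real\<close> of which only the times \<open>t \<ge> 0\<close> matter.
  No usual conditions are imposed on filtrations.\<close>

definition filtered_prob_space :: "'a measure \<Rightarrow> (real \<Rightarrow> 'a measure) \<Rightarrow> bool" where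
  "filtered_prob_space M F \<longleftrightarrow>
     prob_space M \<and> filtration (space M) F \<and> (\<forall>t. sets (F t) \<subseteq> sets M)"

definition adapted :: "(real \<Rightarrow> 'a measure) \<Rightarrow> (real \<Rightarrow> 'a \<Rightarrow> real) \<Rightarrow> bool" where
  "adapted F Y \<longleftrightarrow> (\<forall>t\<ge>0. Y t \<in> borel_measurable (F t))"

definition measurable_process :: "'a measure \<Rightarrow> (real \<Rightarrow> 'a \<Rightarrow> real) \<Rightarrow> bool" where
  "measurable_process M Y \<longleftrightarrow>
     (\<lambda>(t, \<omega>). Y t \<omega>) \<in> borel_measurable (restrict_space borel {0..} \<Otimes>\<^sub>M M)"

definition continuous_process :: "'a measure \<Rightarrow> (real \<Rightarrow> 'a \<Rightarrow> real) \<Rightarrow> bool" where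
  "continuous_process M Y \<longleftrightarrow> (\<forall>\<omega>\<in>space M. continuous_on {0..} (\<lambda>t. Y t \<omega>))"

definition brownian_motion ::
    "'a measure \<Rightarrow> (real \<Rightarrow> 'a measure) \<Rightarrow> (real \<Rightarrow> 'a \<Rightarrow> real) \<Rightarrow> bool" where
  "brownian_motion M F W \<longleftrightarrow>
     adapted F W \<and> continuous_process M W \<and> (AE \<omega> in M. W 0 \<omega> = 0) \<and>
     (\<forall>s t. 0 \<le> s \<and> s < t \<longrightarrow>
        distributed M lborel (\<lambda>\<omega>. W t \<omega> - W s \<omega>) (normal_density 0 (sqrt (t - s))) \<and>
        prob_space.indep_set M (sets (F s))
          (sets (vimage_algebra (space M) (\<lambda>\<omega>. W t \<omega> - W s \<omega>) borel)))"


subsection \<open>Stochastic integral\<close>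

definition simple_integrand ::
    "'a measure \<Rightarrow> (real \<Rightarrow> 'a measure) \<Rightarrow> nat \<Rightarrow> (nat \<Rightarrow> real) \<Rightarrow> (nat \<Rightarrow> 'a \<Rightarrow> real) \<Rightarrow> bool" where
  "simple_integrand M F n \<tau> \<xi> \<longleftrightarrow>
     0 \<le> \<tau> 0 \<and> (\<forall>i<n. \<tau> i \<le> \<tau> (Suc i)) \<and>
     (\<forall>i<n. \<xi> i \<in> borel_measurable (F (\<tau> i)) \<and> (\<exists>K. \<forall>\<omega>\<in>space M. \<bar>\<xi> i \<omega>\<bar> \<le> K))"

definition simple_process ::
    "nat \<Rightarrow> (nat \<Rightarrow> real) \<Rightarrow> (nat \<Rightarrow> 'a \<Rightarrow> real) \<Rightarrow> real \<Rightarrow> 'a \<Rightarrow> real" where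
  "simple_process n \<tau> \<xi> s \<omega> = (\<Sum>i<n. \<xi> i \<omega> * indicator {\<tau> i<..\<tau> (Suc i)} s)"

definition simple_integral ::
    "nat \<Rightarrow> (nat \<Rightarrow> real) \<Rightarrow> (nat \<Rightarrow> 'a \<Rightarrow> real) \<Rightarrow> (real \<Rightarrow> 'a \<Rightarrow> real) \<Rightarrow> real \<Rightarrow> 'a \<Rightarrow> real" where
  "simple_integral n \<tau> \<xi> W t \<omega> =
     (\<Sum>i<n. \<xi> i \<omega> * (W (min t (\<tau> (Suc i))) \<omega> - W (min t (\<tau> i)) \<omega>))"

definition converges_in_prob :: "'a measure \<Rightarrow> (nat \<Rightarrow> 'a \<Rightarrow> real) \<Rightarrow> ('a \<Rightarrow> real) \<Rightarrow> bool" where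
  "converges_in_prob M Y Z \<longleftrightarrow>
     (\<forall>\<epsilon>>0. (\<lambda>n. measure M {\<omega>\<in>space M. \<bar>Y n \<omega> - Z \<omega>\<bar> > \<epsilon>}) \<longlonglongrightarrow> 0)"

text \<open>\<open>ito_integral M F W H I\<close>: \<open>I\<close> is a continuous version of the process
  \<open>t \<mapsto> \<integral>\<^sub>0\<^sup>t H\<^sub>s dW\<^sub>s\<close>. It is defined for adapted \<open>H\<close> with \<open>\<integral>\<^sub>0\<^sup>t H\<^sub>s\<^sup>2 ds < \<infinity>\<close> almost surely, as the
  limit in probability of integrals of simple processes, and is unique up to
  indistinguishability. \<open>I t\<close> is only required to be \<open>M\<close>-measurable, as for an incomplete
  filtration it need be adapted only up to null sets.\<close>

definition ito_integral ::
    "'a measure \<Rightarrow> (real \<Rightarrow> 'a measure) \<Rightarrow> (real \<Rightarrow> 'a \<Rightarrow> real) \<Rightarrow>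
     (real \<Rightarrow> 'a \<Rightarrow> real) \<Rightarrow> (real \<Rightarrow> 'a \<Rightarrow> real) \<Rightarrow> bool" where
  "ito_integral M F W H I \<longleftrightarrow>
     adapted F H \<and> measurable_process M H \<and>
     (AE \<omega> in M. \<forall>t\<ge>0. set_integrable lborel {0..t} (\<lambda>s. (H s \<omega>)\<^sup>2)) \<and>
     (\<forall>t\<ge>0. I t \<in> borel_measurable M) \<and> continuous_process M I \<and>
     (\<exists>n \<tau> \<xi>. (\<forall>k. simple_integrand M F (n k) (\<tau> k) (\<xi> k)) \<and>
        (\<forall>t\<ge>0.
           converges_in_prob M
             (\<lambda>k \<omega>. LBINT s:{0..t}. (simple_process (n k) (\<tau> k) (\<xi> k) s \<omega> - H s \<omega>)\<^sup>2) (\<lambda>_. 0) \<and>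
           converges_in_prob M (\<lambda>k. simple_integral (n k) (\<tau> k) (\<xi> k) W t) (I t)))"

text \<open>The equation \<open>dY\<^sub>t / Y\<^sub>t = r\<^sub>t dt + a\<^sub>t dW\<^sub>t\<close>, that is, \<open>dY\<^sub>t = r\<^sub>t Y\<^sub>t dt + a\<^sub>t Y\<^sub>t dW\<^sub>t\<close>.\<close>

definition proportional_sde ::
    "'a measure \<Rightarrow> (real \<Rightarrow> 'a measure) \<Rightarrow> (real \<Rightarrow> 'a \<Rightarrow> real) \<Rightarrow>
     (real \<Rightarrow> 'a \<Rightarrow> real) \<Rightarrow> (real \<Rightarrow> 'a \<Rightarrow> real) \<Rightarrow> (real \<Rightarrow> 'a \<Rightarrow> real) \<Rightarrow> bool" where
  "proportional_sde M F W r a Y \<longleftrightarrow>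
     (\<exists>I. ito_integral M F W (\<lambda>s \<omega>. a s \<omega> * Y s \<omega>) I \<and>
        (AE \<omega> in M. \<forall>t\<ge>0. Y t \<omega> = Y 0 \<omega> + (LBINT s:{0..t}. r s \<omega> * Y s \<omega>) + I t \<omega>))"


definition integrated_rate :: "(real \<Rightarrow> 'a \<Rightarrow> real) \<Rightarrow> real \<Rightarrow> 'a \<Rightarrow> real" where
  "integrated_rate r t \<omega> = (LBINT s:{0..t}. r s \<omega>)"

definition discounted ::
    "(real \<Rightarrow> 'a \<Rightarrow> real) \<Rightarrow> (real \<Rightarrow> 'a \<Rightarrow> real) \<Rightarrow> real \<Rightarrow> 'a \<Rightarrow> real" where
  "discounted r Y t \<omega> = Y t \<omega> * exp (- integrated_rate r t \<omega>)"


subsection \<open>Conditioning on the value of a random variable\<close>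

text \<open>\<open>cond_exp_at M Z \<phi> x\<close> is \<open>E[\<phi>(x, \<cdot>) | Z = x]\<close>. Since a single \<open>x\<close> may be null for the law of
  \<open>Z\<close>, the versions of these conditional expectations have to be chosen jointly in \<open>x\<close>:
  \<open>x \<mapsto> E[\<phi>(x, \<cdot>) | Z = x]\<close> is a Borel function \<open>g\<close> with \<open>E[\<phi>(Z, \<cdot>) | \<sigma>(Z)] = g(Z)\<close> almost
  surely. If \<open>\<phi>\<close> does not depend on \<open>x\<close>, this is the usual regression function. Lemma
  \<open>cond_exp_at_regular\<close> below shows that \<open>E[\<phi>(x, Y) | Z = x]\<close> is the integral of \<open>\<phi>(x, \<cdot>)\<close>,
  with \<open>x\<close> frozen, under the conditional law of \<open>Y\<close> given \<open>Z = x\<close>.\<close>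

definition cond_exp_version ::
    "'a measure \<Rightarrow> ('a \<Rightarrow> real) \<Rightarrow> (real \<Rightarrow> 'a \<Rightarrow> real) \<Rightarrow> (real \<Rightarrow> real) \<Rightarrow> bool" where
  "cond_exp_version M Z \<phi> g \<longleftrightarrow>
     g \<in> borel_measurable borel \<and>
     (AE \<omega> in M. real_cond_exp M (vimage_algebra (space M) Z borel) (\<lambda>\<omega>'. \<phi> (Z \<omega>') \<omega>') \<omega> = g (Z \<omega>))"

definition cond_exp_at ::
    "'a measure \<Rightarrow> ('a \<Rightarrow> real) \<Rightarrow> (real \<Rightarrow> 'a \<Rightarrow> real) \<Rightarrow> real \<Rightarrow> real" where
  "cond_exp_at M Z \<phi> = (SOME g. cond_exp_version M Z \<phi> g)"

lemma factor_through_nn: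
  fixes f :: "'a \<Rightarrow> ennreal" and Z :: "'a \<Rightarrow> real"
  assumes "f \<in> borel_measurable (vimage_algebra \<Omega> Z borel)"
  shows "\<exists>g\<in>borel_measurable borel. \<forall>\<omega>\<in>\<Omega>. f \<omega> = g (Z \<omega>)"
  using assms
proof (induction rule: borel_measurable_induct)
  case (cong f g)
  then show ?case by simp
next
  case (set A)
  then obtain B where B: "B \<in> sets borel" "A = Z -` B \<inter> \<Omega>"
    by (auto simp: sets_vimage_algebra2)
  show ?case
    by (rule bexI[of _ "indicator B"]) (use B in \<open>auto split: split_indicator\<close>)
next
  case (mult u c)
  then obtain g where [measurable]: "g \<in> borel_measurable borel" and "\<forall>\<omega>\<in>\<Omega>. u \<omega> = g (Z \<omega>)"
    by blast
  then show ?case by (intro bexI[of _ "\<lambda>x. c * g x"]) auto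
next
  case (add u v)
  then obtain g h where [measurable]: "g \<in> borel_measurable borel" "h \<in> borel_measurable borel"
    and "\<forall>\<omega>\<in>\<Omega>. u \<omega> = g (Z \<omega>)" "\<forall>\<omega>\<in>\<Omega>. v \<omega> = h (Z \<omega>)"
    by blast
  then show ?case by (intro bexI[of _ "\<lambda>x. h x + g x"]) auto
next
  case (seq U)
  then have "\<forall>i. \<exists>g. g \<in> borel_measurable borel \<and> (\<forall>\<omega>\<in>\<Omega>. U i \<omega> = g (Z \<omega>))"
    by blast
  then obtain G where G: "\<And>i. G i \<in> borel_measurable borel" "\<And>i. \<forall>\<omega>\<in>\<Omega>. U i \<omega> = G i (Z \<omega>)"
    by metis
  show ?case
  proof (rule bexI[of _ "\<lambda>x. SUP i. G i x"])
    show "\<forall>\<omega>\<in>\<Omega>. (SUP i. U i) \<omega> = (SUP i. G i (Z \<omega>))"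
    proof
      fix \<omega> assume "\<omega> \<in> \<Omega>"
      then have "\<And>i. U i \<omega> = G i (Z \<omega>)" using G(2) by blast
      then show "(SUP i. U i) \<omega> = (SUP i. G i (Z \<omega>))" unfolding SUP_apply by simp
    qed
    show "(\<lambda>x. SUP i. G i x) \<in> borel_measurable borel"
      by (rule borel_measurable_SUP) (simp_all add: G(1))
  qed
qed

lemma cond_exp_version_exists: "\<exists>g. cond_exp_version M Z \<phi> g"
proof -
  let ?S = "vimage_algebra (space M) Z borel"
  let ?f = "\<lambda>\<omega>. \<phi> (Z \<omega>) \<omega>"
  obtain g where g: "g \<in> borel_measurable borel"
    "\<forall>\<omega>\<in>space M. nn_cond_exp M ?S (\<lambda>\<omega>. ennreal (?f \<omega>)) \<omega> = g (Z \<omega>)"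
    using factor_through_nn[of "nn_cond_exp M ?S (\<lambda>\<omega>. ennreal (?f \<omega>))" "space M" Z] by auto
  obtain h where h: "h \<in> borel_measurable borel"
    "\<forall>\<omega>\<in>space M. nn_cond_exp M ?S (\<lambda>\<omega>. ennreal (- ?f \<omega>)) \<omega> = h (Z \<omega>)"
    using factor_through_nn[of "nn_cond_exp M ?S (\<lambda>\<omega>. ennreal (- ?f \<omega>))" "space M" Z] by auto
  note g(1)[measurable] h(1)[measurable]
  have "cond_exp_version M Z \<phi> (\<lambda>x. enn2real (g x) - enn2real (h x))"
    unfolding cond_exp_version_def real_cond_exp_def using g(2) h(2) by auto
  then show ?thesis by blast
qed

lemma cond_exp_version_cond_exp_at: "cond_exp_version M Z \<phi> (cond_exp_at M Z \<phi>)"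
  unfolding cond_exp_at_def using cond_exp_version_exists by (rule someI_ex)

lemma cond_exp_at_unique:
  assumes [measurable]: "Z \<in> borel_measurable M" and g: "cond_exp_version M Z \<phi> g"
  shows "AE x in distr M borel Z. cond_exp_at M Z \<phi> x = g x"
proof -
  have [measurable]: "g \<in> borel_measurable borel" "cond_exp_at M Z \<phi> \<in> borel_measurable borel"
    using g cond_exp_version_cond_exp_at[of M Z \<phi>] by (auto simp: cond_exp_version_def)
  have "AE \<omega> in M. cond_exp_at M Z \<phi> (Z \<omega>) = g (Z \<omega>)"
    using g cond_exp_version_cond_exp_at[of M Z \<phi>] unfolding cond_exp_version_def by auto
  then show ?thesis by (subst AE_distr_iff) auto
qed

text \<open>\<open>\<kappa>\<close> is a regular conditional distribution of \<open>Y\<close> given \<open>Z\<close>.\<close>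

definition regular_cond_distr ::
    "'a measure \<Rightarrow> ('a \<Rightarrow> real) \<Rightarrow> ('a \<Rightarrow> real) \<Rightarrow> (real \<Rightarrow> real measure) \<Rightarrow> bool" where
  "regular_cond_distr M Z Y \<kappa> \<longleftrightarrow>
     \<kappa> \<in> borel \<rightarrow>\<^sub>M prob_algebra borel \<and>
     (\<forall>A\<in>sets borel. \<forall>B\<in>sets borel.
        emeasure M {\<omega>\<in>space M. Z \<omega> \<in> A \<and> Y \<omega> \<in> B} =
          (\<integral>\<^sup>+x. indicator A x * emeasure (\<kappa> x) B \<partial>distr M borel Z))"

lemma cond_exp_at_regular:
  assumes "prob_space M" and [measurable]: "Z \<in> borel_measurable M" "Y \<in> borel_measurable M"
    and \<kappa>: "regular_cond_distr M Z Y \<kappa>"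
    and [measurable]: "(\<lambda>(x, y). f x y) \<in> borel_measurable (borel \<Otimes>\<^sub>M borel)"
    and bounded: "\<And>x y. \<bar>f x y\<bar> \<le> (C::real)"
  shows "AE x in distr M borel Z. cond_exp_at M Z (\<lambda>x \<omega>. f x (Y \<omega>)) x = (\<integral>y. f x y \<partial>\<kappa> x)"
proof (rule cond_exp_at_unique)
  interpret prob_space M by fact
  have k[measurable]: "\<kappa> \<in> borel \<rightarrow>\<^sub>M prob_algebra borel"
    using \<kappa> by (simp add: regular_cond_distr_def)
  have ks[measurable]: "\<kappa> \<in> borel \<rightarrow>\<^sub>M subprob_algebra borel"
    using k by (rule measurable_prob_algebraD)
  have kp: "prob_space (\<kappa> x)" and kset: "sets (\<kappa> x) = sets borel" for x
    using measurable_space[OF k, of x] by (auto simp: space_prob_algebra)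
  let ?D = "distr M borel Z"
  let ?P = "distr M (borel \<Otimes>\<^sub>M borel) (\<lambda>\<omega>. (Z \<omega>, Y \<omega>))"
  let ?K = "\<lambda>x. distr (\<kappa> x) (borel \<Otimes>\<^sub>M borel) (Pair x)"
  interpret D: prob_space ?D by (rule prob_space_distr) simp
  have K[measurable]: "?K \<in> borel \<rightarrow>\<^sub>M subprob_algebra (borel \<Otimes>\<^sub>M borel)"
    by (rule measurable_distr2[OF _ ks]) (simp add: split_beta')
  have KD: "?K \<in> ?D \<rightarrow>\<^sub>M subprob_algebra (borel \<Otimes>\<^sub>M borel)" by simp
  have em: "emeasure (?D \<bind> ?K) (A \<times> B) = (\<integral>\<^sup>+x. indicator A x * emeasure (\<kappa> x) B \<partial>?D)"
    if [measurable]: "A \<in> sets borel" "B \<in> sets borel" for A B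
  proof -
    have "emeasure (?D \<bind> ?K) (A \<times> B) = (\<integral>\<^sup>+x. emeasure (?K x) (A \<times> B) \<partial>?D)"
      by (rule emeasure_bind[OF _ KD]) auto
    also have "\<dots> = (\<integral>\<^sup>+x. indicator A x * emeasure (\<kappa> x) B \<partial>?D)"
    proof (rule nn_integral_cong)
      fix x
      have "emeasure (?K x) (A \<times> B) = emeasure (\<kappa> x) (Pair x -` (A \<times> B) \<inter> space (\<kappa> x))"
        by (rule emeasure_distr) (auto simp: measurable_cong_sets[OF kset refl])
      also have "Pair x -` (A \<times> B) \<inter> space (\<kappa> x) = (if x \<in> A then B else {})"
        using sets_eq_imp_space_eq[OF kset] by auto
      finally show "emeasure (?K x) (A \<times> B) = indicator A x * emeasure (\<kappa> x) B" by auto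
    qed
    finally show ?thesis .
  qed
  have sB: "sets (?D \<bind> ?K) = sets (borel \<Otimes>\<^sub>M borel)"
    by (rule sets_bind) (rule sets_distr, simp)
  have sP: "sets (borel \<Otimes>\<^sub>M borel) =
      sigma_sets UNIV {A \<times> B | A B. A \<in> sets (borel::real measure) \<and> B \<in> sets (borel::real measure)}"
    by (simp add: sets_pair_measure)
  have PK: "?P = ?D \<bind> ?K"
  proof (rule measure_eqI_generator_eq[where E="{A \<times> B | A B. A \<in> sets borel \<and> B \<in> sets borel}"
        and \<Omega>="UNIV" and A="\<lambda>_. UNIV"])
    show "Int_stable {A \<times> B | A B. A \<in> sets (borel::real measure) \<and> B \<in> sets (borel::real measure)}"
      by (rule Int_stable_pair_measure_generator)
    fix X assume "X \<in> {A \<times> B | A B. A \<in> sets (borel::real measure) \<and> B \<in> sets (borel::real measure)}"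
    then obtain A B where X: "X = A \<times> B" and [measurable]: "A \<in> sets borel" "B \<in> sets borel" by auto
    have "emeasure ?P X = emeasure M {\<omega>\<in>space M. Z \<omega> \<in> A \<and> Y \<omega> \<in> B}"
      unfolding X by (subst emeasure_distr) (auto intro!: arg_cong[where f="emeasure M"])
    also have "\<dots> = emeasure (?D \<bind> ?K) X"
      unfolding X em[OF \<open>A \<in> _\<close> \<open>B \<in> _\<close>] using \<kappa> \<open>A \<in> _\<close> \<open>B \<in> _\<close> by (auto simp: regular_cond_distr_def)
    finally show "emeasure ?P X = emeasure (?D \<bind> ?K) X" .
  next
    show "sets ?P = sigma_sets UNIV {A \<times> B | A B. A \<in> sets borel \<and> B \<in> sets borel}"
      unfolding sets_distr by (rule sP)
    show "sets (?D \<bind> ?K) = sigma_sets UNIV {A \<times> B | A B. A \<in> sets borel \<and> B \<in> sets borel}"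
      unfolding sB by (rule sP)
    show "range (\<lambda>_. UNIV) \<subseteq> {A \<times> B | A B. A \<in> sets (borel::real measure) \<and> B \<in> sets (borel::real measure)}"
      by (auto intro!: exI[of _ UNIV])
    show "emeasure ?P UNIV \<noteq> \<infinity>"
      using finite_measure.emeasure_finite[OF
          finite_measure_distr[of "\<lambda>\<omega>. (Z \<omega>, Y \<omega>)" "borel \<Otimes>\<^sub>M borel"]] by simp
    show "{A \<times> B | A B. A \<in> sets (borel::real measure) \<and> B \<in> sets (borel::real measure)} \<subseteq> Pow UNIV"
      by (rule subset_Pow_Union[THEN order_trans]) (rule Pow_mono, rule subset_UNIV)
    show "(\<Union>i::nat. UNIV) = (UNIV :: (real \<times> real) set)"
      by simp
  qed
  define g where "g = (\<lambda>x. \<integral>y. f x y \<partial>\<kappa> x)"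
  have g[measurable]: "g \<in> borel_measurable borel"
  proof -
    have "(\<lambda>x. \<integral>p. (\<lambda>(x, y). f x y) p \<partial>?K x) \<in> borel_measurable borel"
      by (rule measurable_compose[OF K integral_measurable_subprob_algebra]) fact
    also have "(\<lambda>x. \<integral>p. (\<lambda>(x, y). f x y) p \<partial>?K x) = g"
      unfolding g_def by (rule ext, subst integral_distr) (auto simp: measurable_cong_sets[OF kset refl])
    finally show ?thesis .
  qed
  have fb: "\<bar>g x\<bar> \<le> C" for x
  proof -
    interpret k: prob_space "\<kappa> x" by (rule kp)
    have [measurable]: "f x \<in> borel_measurable (\<kappa> x)"
      by (auto simp: measurable_cong_sets[OF kset refl])
    have "\<bar>g x\<bar> \<le> (\<integral>y. C \<partial>\<kappa> x)" unfolding g_def real_norm_def[symmetric]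
      by (rule Bochner_Integration.integral_norm_bound_integral)
        (use bounded in \<open>auto intro!: k.integrable_const_bound[where B=C]\<close>)
    then show ?thesis by (simp add: k.prob_space)
  qed
  have key: "(\<integral>\<omega>. indicator A (Z \<omega>) * f (Z \<omega>) (Y \<omega>) \<partial>M) = (\<integral>\<omega>. indicator A (Z \<omega>) * g (Z \<omega>) \<partial>M)"
    if [measurable]: "A \<in> sets borel" for A
  proof -
    have "(\<integral>\<omega>. indicator A (Z \<omega>) * f (Z \<omega>) (Y \<omega>) \<partial>M) = (\<integral>p. indicator A (fst p) * f (fst p) (snd p) \<partial>?P)"
      by (subst integral_distr) (auto simp: split_beta')
    also have "\<dots> = (\<integral>x. \<integral>p. indicator A (fst p) * f (fst p) (snd p) \<partial>?K x \<partial>?D)"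
      unfolding PK
    proof (rule integral_bind[OF _ _ KD D.finite_measure_axioms])
      show "(\<lambda>p. indicator A (fst p) * f (fst p) (snd p)) \<in> borel_measurable (borel \<Otimes>\<^sub>M borel)"
        by simp
      show "\<bar>indicator A (fst p) * f (fst p) (snd p)\<bar> \<le> C" for p
        using bounded[of "fst p" "snd p"] by (auto simp: indicator_def)
      have "emeasure (?K x) (space (?K x)) \<le> ennreal 1" for x
      proof -
        interpret K: prob_space "?K x"
          by (rule prob_space.prob_space_distr[OF kp]) (auto simp: measurable_cong_sets[OF kset refl])
        show ?thesis using K.emeasure_space_1 by simp
      qed
      then show "AE x in ?D. emeasure (?K x) (space (?K x)) \<le> ennreal 1"
        by (rule AE_I2)
    qed
    also have "\<dots> = (\<integral>x. indicator A x * g x \<partial>?D)"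
      by (intro Bochner_Integration.integral_cong refl, subst integral_distr)
        (auto simp: g_def measurable_cong_sets[OF kset refl])
    also have "\<dots> = (\<integral>\<omega>. indicator A (Z \<omega>) * g (Z \<omega>) \<partial>M)"
      by (subst integral_distr) auto
    finally show ?thesis .
  qed
  let ?S = "vimage_algebra (space M) Z borel"
  have sub: "subalgebra M ?S"
    by (auto simp: subalgebra_def sets_vimage_algebra2)
  interpret S: finite_measure_subalgebra M ?S
    by unfold_locales (rule sub)
  have "AE \<omega> in M. real_cond_exp M ?S (\<lambda>\<omega>. f (Z \<omega>) (Y \<omega>)) \<omega> = g (Z \<omega>)"
  proof (rule S.real_cond_exp_charact)
    fix X assume "X \<in> sets ?S"
    then obtain A where A[measurable]: "A \<in> sets borel" and X: "X = Z -` A \<inter> space M"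
      by (auto simp: sets_vimage_algebra2)
    have "set_lebesgue_integral M X h = (\<integral>\<omega>. indicator A (Z \<omega>) * h \<omega> \<partial>M)" for h :: "'a \<Rightarrow> real"
      unfolding set_lebesgue_integral_def X
      by (rule Bochner_Integration.integral_cong) (auto simp: indicator_def)
    then show "(\<integral>\<omega>\<in>X. f (Z \<omega>) (Y \<omega>) \<partial>M) = (\<integral>\<omega>\<in>X. g (Z \<omega>) \<partial>M)"
      using key[OF A] by simp
  next
    show "integrable M (\<lambda>\<omega>. f (Z \<omega>) (Y \<omega>))"
      by (rule integrable_const_bound[where B=C]) (use bounded in auto)
    show "integrable M (\<lambda>\<omega>. g (Z \<omega>))"
      by (rule integrable_const_bound[where B=C]) (use fb in auto)
    show "(\<lambda>\<omega>. g (Z \<omega>)) \<in> borel_measurable ?S"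
      by (rule measurable_compose[OF measurable_vimage_algebra1 g]) auto
  qed
  with g show "cond_exp_version M Z (\<lambda>x \<omega>. f x (Y \<omega>)) (\<lambda>x. \<integral>y. f x y \<partial>\<kappa> x)"
    by (simp add: cond_exp_version_def g_def)
qed fact

end

theory Submission
  imports Defs
begin

text \<open>Put \<open>L\<^sub>t = ln F\<^sub>t - ln F\<^sub>0\<close> for \<open>F\<close> either of the two discounted prices and write \<open>a\<close> for its
  volatility. Since \<open>L\<close> has the bounded coefficients \<open>a\<close> and \<open>- a\<^sup>2 / 2\<close>, every \<open>u\<close> satisfies
  \<open>E[exp (i u L\<^sub>T)] = 1 - (u\<^sup>2 + i u) / 2 * \<integral>\<^sub>0\<^sup>T E[exp (i u L\<^sub>s) a\<^sub>s\<^sup>2] ds\<close>. The left-hand sides agree for the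
  two prices, so for almost every \<open>s\<close> the functions \<open>u \<mapsto> E[exp (i u L\<^sub>s) a\<^sub>s\<^sup>2]\<close> agree, first at rational
  \<open>u \<noteq> 0\<close> and then everywhere by continuity. They are the Fourier transforms of the laws of \<open>L\<^sub>s\<close> weighted by
  \<open>a\<^sub>s\<^sup>2\<close>, which therefore coincide, and conditioning on \<open>F\<^sub>s\<close> only sees these weighted laws.

  The formula is exact when \<open>a\<close> is a simple process: on each cell \<open>a\<close> is frozen and the increment of \<open>W\<close> is
  an independent Gaussian. In general, \<open>ln F\<close> is expanded to second order along a grid. A simple
  process \<open>\<xi>\<close> close to the integrand \<open>a Y\<close> is divided by the value of \<open>Y\<close> at the left end of each cell, which gives
  a simple process close to \<open>a\<close>. Neither stopping times nor a maximal inequality are needed: integrals are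
  compared in probability, and a simple integrand is truncated along its own accumulated energy.\<close>

subsection \<open>Brownian increments and simple integrands\<close>

text \<open>The logarithm is used because its coefficients are bounded, whereas the diffusion
  coefficient \<open>a * F\<close> of the price is not. For real u the factor (u^2 + i u) / 2
  vanishes only at u = 0; there the formula merely says 1 = 1, while the transform at 0 is the total
  mass of the weighted law, which therefore has to come from nearby frequencies. Ellipticity makes
  this mass positive, so that the weighted laws can be normalised and compared by Levy's uniqueness
  theorem.

  The obstacle is the logarithm itself. The integral of \<open>a * Y\<close> is known only as a
  limit in probability at each fixed time, and passing to an integral of \<open>a\<close> means
  dividing by \<open>Y\<close>, which is bounded away from 0 along every path but not uniformly in
  the path. Estimates that involve \<open>Y\<close> are therefore pathwise, and expectations enter
  only after truncating the coefficients or the quantity itself. Once the coefficients are clamped,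
  the isometry and the exact Gaussian computation apply to them.\<close>

lemma integrable_bounded_mult:
  fixes f g :: "'a \<Rightarrow> real"
  assumes "integrable M g" "f \<in> borel_measurable M" "\<And>x. \<bar>f x\<bar> \<le> K"
  shows "integrable M (\<lambda>x. f x * g x)"
proof (rule Bochner_Integration.integrable_bound[where f="\<lambda>x. K * g x"])
  show "AE x in M. norm (f x * g x) \<le> norm (K * g x)"
  proof (rule AE_I2)
    fix x show "norm (f x * g x) \<le> norm (K * g x)"
      using assms(3)[of x] by (auto simp: abs_mult intro!: mult_right_mono)
  qed
qed (use assms in auto)

locale bm_filtration = prob_space M for M :: "'a measure" +
  fixes F :: "real \<Rightarrow> 'a measure" and W :: "real \<Rightarrow> 'a \<Rightarrow> real"
  assumes filtration: "filtration (space M) F"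
    and sets_F: "sets (F t) \<subseteq> sets M"
    and bm: "brownian_motion M F W"
begin

lemma space_F: "space (F t) = space M"
  using filtration by (simp add: filtration_def)

lemma measurable_F_M: "Z \<in> F t \<rightarrow>\<^sub>M N \<Longrightarrow> Z \<in> M \<rightarrow>\<^sub>M N"
  using sets_F[of t] space_F[of t] by (auto simp: measurable_def)

lemma measurable_F_mono:
  assumes "Z \<in> F s \<rightarrow>\<^sub>M N" "s \<le> t" shows "Z \<in> F t \<rightarrow>\<^sub>M N"
proof -
  have "sets (F s) \<subseteq> sets (F t)"
    using filtration assms(2) by (auto simp: filtration_def)
  then show ?thesis
    using assms(1) space_F[of s] space_F[of t] by (auto simp: measurable_def)
qed

lemma W_measurable_F: "0 \<le> t \<Longrightarrow> W t \<in> borel_measurable (F t)"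
  using bm by (auto simp: brownian_motion_def adapted_def)

lemma W_measurable: "0 \<le> t \<Longrightarrow> W t \<in> borel_measurable M"
  using W_measurable_F measurable_F_M by blast

lemma W_measurable_F': "0 \<le> s \<Longrightarrow> s \<le> t \<Longrightarrow> W s \<in> borel_measurable (F t)"
  using W_measurable_F measurable_F_mono by blast

text \<open>Independence is inherited by sub-sigma-algebras: the one generated by \<open>Z\<close>
  lies in \<open>F s\<close>, the one generated by \<open>h\<close> of the increment lies in that of
  the increment. The free target spaces of \<open>Z\<close> and \<open>h\<close> allow the
  pair-valued version in \<open>W_increment_freeze\<close>.\<close>

lemma W_increment_indep:
  assumes "0 \<le> s" "s < t" and Z: "Z \<in> F s \<rightarrow>\<^sub>M N" and h[measurable]: "h \<in> borel \<rightarrow>\<^sub>M N'"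
  shows "indep_var N Z N' (\<lambda>\<omega>. h (W t \<omega> - W s \<omega>))"
  unfolding indep_var_eq
proof (intro conjI)
  let ?U = "\<lambda>\<omega>. W t \<omega> - W s \<omega>"
  have [measurable]: "W t \<in> borel_measurable M" "W s \<in> borel_measurable M"
    using assms by (auto intro!: W_measurable)
  show "Z \<in> M \<rightarrow>\<^sub>M N" by (rule measurable_F_M[OF Z])
  show "(\<lambda>\<omega>. h (?U \<omega>)) \<in> M \<rightarrow>\<^sub>M N'" by simp
  have ind: "indep_set (sets (F s)) (sets (vimage_algebra (space M) ?U borel))"
    using bm assms by (auto simp: brownian_motion_def)
  have 1: "sigma_sets (space M) {Z -` A \<inter> space M |A. A \<in> sets N} \<subseteq> sets (F s)"
    unfolding space_F[of s, symmetric]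
    by (rule sets.sigma_sets_subset) (use Z in \<open>auto simp: measurable_def\<close>)
  have "?U \<in> vimage_algebra (space M) ?U borel \<rightarrow>\<^sub>M borel"
    by (rule measurable_vimage_algebra1) simp
  then have hU: "(\<lambda>\<omega>. h (?U \<omega>)) \<in> vimage_algebra (space M) ?U borel \<rightarrow>\<^sub>M N'"
    by (rule measurable_compose[OF _ h])
  have "sigma_sets (space (vimage_algebra (space M) ?U borel)) {(\<lambda>\<omega>. h (?U \<omega>)) -` A \<inter> space (vimage_algebra (space M) ?U borel) |A. A \<in> sets N'}
      \<subseteq> sets (vimage_algebra (space M) ?U borel)"
    by (rule sets.sigma_sets_subset) (use hU in \<open>auto simp: measurable_def\<close>)
  then have 2: "sigma_sets (space M) {(\<lambda>\<omega>. h (?U \<omega>)) -` A \<inter> space M |A. A \<in> sets N'}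
      \<subseteq> sets (vimage_algebra (space M) ?U borel)" by simp
  show "indep_set (sigma_sets (space M) {Z -` A \<inter> space M |A. A \<in> sets N})
     (sigma_sets (space M) {(\<lambda>\<omega>. h (?U \<omega>)) -` A \<inter> space M |A. A \<in> sets N'})"
    using ind 1 2 unfolding indep_sets2_eq by blast
qed

lemma W_increment_distr:
  assumes "0 \<le> s" "s < t"
  shows "distributed M lborel (\<lambda>\<omega>. W t \<omega> - W s \<omega>) (normal_density 0 (sqrt (t - s)))"
  using bm assms by (auto simp: brownian_motion_def)

text \<open>The case \<open>s = t\<close> is included because a grid stopped at a time has
  degenerate cells beyond it. The last value is the fourth Gaussian moment 3 (t - s)^2 minus (t -
  s)^2.\<close>

lemma W_increment_moments:
  assumes "0 \<le> s" "s \<le> t"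
  shows "integrable M (\<lambda>\<omega>. (W t \<omega> - W s \<omega>) ^ k)"
    and "(\<integral>\<omega>. W t \<omega> - W s \<omega> \<partial>M) = 0"
    and "(\<integral>\<omega>. (W t \<omega> - W s \<omega>)\<^sup>2 \<partial>M) = t - s"
    and "(\<integral>\<omega>. ((W t \<omega> - W s \<omega>)\<^sup>2 - (t - s))\<^sup>2 \<partial>M) = 2 * (t - s)\<^sup>2"
proof -
  have "integrable M (\<lambda>\<omega>. (W t \<omega> - W s \<omega>) ^ k) \<and> (\<integral>\<omega>. W t \<omega> - W s \<omega> \<partial>M) = 0
    \<and> (\<integral>\<omega>. (W t \<omega> - W s \<omega>)\<^sup>2 \<partial>M) = t - s \<and> (\<integral>\<omega>. ((W t \<omega> - W s \<omega>)\<^sup>2 - (t - s))\<^sup>2 \<partial>M) = 2 * (t - s)\<^sup>2"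
  proof (cases "s = t")
    case True
    then show ?thesis by (cases k) auto
  next
    case False
    then have st: "s < t" "0 < sqrt (t - s)" using assms by auto
    note D = W_increment_distr[OF assms(1) st(1)]
    have int: "integrable M (\<lambda>\<omega>. (W t \<omega> - W s \<omega>) ^ k)" for k
      using distributed_integrable[OF D, of "\<lambda>x. x ^ k"] integrable_normal_moment[OF st(2), of 0 k]
      by simp
    have ev: "(\<integral>\<omega>. (W t \<omega> - W s \<omega>) ^ k \<partial>M) = (\<integral>x. normal_density 0 (sqrt (t - s)) x * x ^ k \<partial>lborel)" for k
      using distributed_integral[OF D, of "\<lambda>x. x ^ k"] by simp
    have 1: "(\<integral>\<omega>. W t \<omega> - W s \<omega> \<partial>M) = 0"
      using ev[of 1] integral_normal_moment_odd[OF st(2), of 0 0] by simp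
    have 2: "(\<integral>\<omega>. (W t \<omega> - W s \<omega>)\<^sup>2 \<partial>M) = t - s"
      using ev[of 2] integral_normal_moment_even[OF st(2), of 0 1] st by simp
    have 4: "(\<integral>\<omega>. (W t \<omega> - W s \<omega>)^4 \<partial>M) = 3 * (t - s)^2"
      using ev[of 4] integral_normal_moment_even[OF st(2), of 0 2] st
      by (simp add: fact_numeral power2_eq_square field_simps)
    have eq: "((W t \<omega> - W s \<omega>)\<^sup>2 - (t - s))\<^sup>2 =
        (W t \<omega> - W s \<omega>)^4 - 2 * (t - s) * (W t \<omega> - W s \<omega>)\<^sup>2 + (t - s)\<^sup>2" for \<omega>
    proof -
      have "(x\<^sup>2 - c)\<^sup>2 = x^4 - 2 * c * x\<^sup>2 + c\<^sup>2" for x c :: real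
        by (simp add: power2_eq_square power4_eq_xxxx algebra_simps)
      then show ?thesis .
    qed
    have "(\<integral>\<omega>. ((W t \<omega> - W s \<omega>)\<^sup>2 - (t - s))\<^sup>2 \<partial>M) = 3 * (t - s)^2 - 2 * (t - s) * (t - s) + (t - s)\<^sup>2"
      unfolding eq using int 2 4 by (simp add: prob_space)
    then show ?thesis using int 1 2 by (simp add: power2_eq_square)
  qed
  then show "integrable M (\<lambda>\<omega>. (W t \<omega> - W s \<omega>) ^ k)"
    and "(\<integral>\<omega>. W t \<omega> - W s \<omega> \<partial>M) = 0"
    and "(\<integral>\<omega>. (W t \<omega> - W s \<omega>)\<^sup>2 \<partial>M) = t - s"
    and "(\<integral>\<omega>. ((W t \<omega> - W s \<omega>)\<^sup>2 - (t - s))\<^sup>2 \<partial>M) = 2 * (t - s)\<^sup>2" by auto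
qed

text \<open>Independence of the increment from \<open>F s\<close> factorises the expectation. With a
  centred \<open>g\<close> this gives the orthogonality of martingale differences on which both
  isometry arguments rest.\<close>

lemma W_increment_mult:
  fixes Z :: "'a \<Rightarrow> real"
  assumes "0 \<le> s" "s \<le> t" and Z: "Z \<in> borel_measurable (F s)" "integrable M Z"
    and g[measurable]: "g \<in> borel_measurable borel" and int: "integrable M (\<lambda>\<omega>. g (W t \<omega> - W s \<omega>))"
  shows "integrable M (\<lambda>\<omega>. Z \<omega> * g (W t \<omega> - W s \<omega>))"
    and "(\<integral>\<omega>. Z \<omega> * g (W t \<omega> - W s \<omega>) \<partial>M) = (\<integral>\<omega>. Z \<omega> \<partial>M) * (\<integral>\<omega>. g (W t \<omega> - W s \<omega>) \<partial>M)"
proof -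
  have "integrable M (\<lambda>\<omega>. Z \<omega> * g (W t \<omega> - W s \<omega>)) \<and> 
     (\<integral>\<omega>. Z \<omega> * g (W t \<omega> - W s \<omega>) \<partial>M) = (\<integral>\<omega>. Z \<omega> \<partial>M) * (\<integral>\<omega>. g (W t \<omega> - W s \<omega>) \<partial>M)"
  proof (cases "s = t")
    case True then show ?thesis using Z by (auto simp: prob_space)
  next
    case False
    then have "s < t" using assms by auto
    have i: "indep_var borel Z borel (\<lambda>\<omega>. g (W t \<omega> - W s \<omega>))"
      by (rule W_increment_indep[OF assms(1) \<open>s < t\<close> Z(1) g])
    show ?thesis
      using indep_var_integrable[OF i Z(2) int] indep_var_lebesgue_integral[OF i Z(2) int] by simp
  qed
  then show "integrable M (\<lambda>\<omega>. Z \<omega> * g (W t \<omega> - W s \<omega>))"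
    and "(\<integral>\<omega>. Z \<omega> * g (W t \<omega> - W s \<omega>) \<partial>M) = (\<integral>\<omega>. Z \<omega> \<partial>M) * (\<integral>\<omega>. g (W t \<omega> - W s \<omega>) \<partial>M)" by auto
qed

text \<open>A coefficient is replaced by \<open>0\<close> when the energy up to and including its own interval exceeds
  \<open>\<delta>\<close>. This keeps it measurable at the left end of the interval, bounds the energy by \<open>\<delta>\<close>, and changes
  nothing where the total energy is at most \<open>\<delta>\<close>; so the isometry applies to arbitrary coefficients.\<close>

lemma simple_sum_bound:
  fixes l u :: "'q \<Rightarrow> real" and \<xi> :: "'q \<Rightarrow> 'a \<Rightarrow> real" and c :: "'q \<Rightarrow> 'b"
  assumes fin: "finite J" "finite B" and l0: "\<And>q. q \<in> J \<Longrightarrow> 0 \<le> l q" and lu: "\<And>q. q \<in> J \<Longrightarrow> l q < u q"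
    and disj: "\<And>q q'. q \<in> J \<Longrightarrow> q' \<in> J \<Longrightarrow> q \<noteq> q' \<Longrightarrow> u q \<le> l q' \<or> u q' \<le> l q"
    and \<xi>: "\<And>q. q \<in> J \<Longrightarrow> \<xi> q \<in> borel_measurable (F (l q))" and \<delta>: "0 < \<delta>"
  shows "(\<integral>\<omega>. min 1 (\<Sum>b\<in>B. (\<Sum>q\<in>{q\<in>J. c q = b}. \<xi> q \<omega> * (W (u q) \<omega> - W (l q) \<omega>))\<^sup>2) \<partial>M)
     \<le> \<delta> + (\<integral>\<omega>. min 1 ((\<Sum>q\<in>J. (\<xi> q \<omega>)\<^sup>2 * (u q - l q)) / \<delta>) \<partial>M)"
proof -
  define R where "R q \<omega> = (\<Sum>q'\<in>{q'\<in>J. u q' \<le> l q}. (\<xi> q' \<omega>)\<^sup>2 * (u q' - l q')) + (\<xi> q \<omega>)\<^sup>2 * (u q - l q)" for q \<omega>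
  define Z where "Z q \<omega> = (if R q \<omega> \<le> \<delta> then \<xi> q \<omega> else 0)" for q \<omega>
  define \<Delta> where "\<Delta> q \<omega> = W (u q) \<omega> - W (l q) \<omega>" for q \<omega>
  have h: "0 < u q - l q" if "q \<in> J" for q using lu[OF that] by simp
  have \<xi>M[measurable]: "\<xi> q \<in> borel_measurable M" if "q \<in> J" for q
    using \<xi>[OF that] by (rule measurable_F_M)
  have \<Delta>M: "\<Delta> q \<in> borel_measurable M" if "q \<in> J" for q
    unfolding \<Delta>_def using W_measurable[of "u q"] W_measurable[of "l q"] l0[OF that] lu[OF that] by auto
  have \<xi>F: "\<xi> q \<in> borel_measurable (F t)" if "q \<in> J" "l q \<le> t" for q t
    using \<xi>[OF that(1)] that(2) by (rule measurable_F_mono)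
  have R_meas: "R q \<in> borel_measurable (F (l q))" if "q \<in> J" for q
    unfolding R_def
  proof (intro borel_measurable_add borel_measurable_sum borel_measurable_times borel_measurable_power borel_measurable_const)
    show "\<xi> q \<in> borel_measurable (F (l q))" using \<xi>[OF that] .
    fix q' assume "q' \<in> {q'\<in>J. u q' \<le> l q}"
    then show "\<xi> q' \<in> borel_measurable (F (l q))" using lu[of q'] by (intro \<xi>F) auto
  qed
  have Z_meas: "Z q \<in> borel_measurable (F (l q))" if "q \<in> J" for q
    unfolding Z_def using R_meas[OF that] \<xi>[OF that] by measurable
  have ZM: "Z q \<in> borel_measurable M" if "q \<in> J" for q
    using Z_meas[OF that] by (rule measurable_F_M)
  have part: "(\<xi> q \<omega>)\<^sup>2 * (u q - l q) \<le> R q \<omega>" if "q \<in> J" for q \<omega>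
    unfolding R_def by (auto intro!: sum_nonneg mult_nonneg_nonneg simp: less_imp_le[OF lu])
  have Zb: "\<bar>Z q \<omega>\<bar> \<le> sqrt (\<delta> / (u q - l q))" if "q \<in> J" for q \<omega>
  proof (cases "R q \<omega> \<le> \<delta>")
    case True
    then have "(\<xi> q \<omega>)\<^sup>2 * (u q - l q) \<le> \<delta>" using part[OF that, of \<omega>] by simp
    then have "(\<xi> q \<omega>)\<^sup>2 \<le> \<delta> / (u q - l q)" using h[OF that] by (simp add: field_simps)
    then show ?thesis using True by (simp add: Z_def real_le_rsqrt)
  next
    case False then show ?thesis using \<delta> h[OF that] by (simp add: Z_def)
  qed
  have Zsum: "(\<Sum>q\<in>J. (Z q \<omega>)\<^sup>2 * (u q - l q)) \<le> \<delta>" for \<omega>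
  proof (cases "\<exists>q\<in>J. R q \<omega> \<le> \<delta>")
    case False
    then have "(\<Sum>q\<in>J. (Z q \<omega>)\<^sup>2 * (u q - l q)) = 0" by (intro sum.neutral) (auto simp: Z_def)
    then show ?thesis using \<delta> by simp
  next
    case True
    \<comment> \<open>Let m be the retained interval with the largest left end. By disjointness all
      other retained intervals end before it starts, so the whole retained energy is part of
      \<open>R m\<close>, which is at most \<delta>.\<close>
    define P where "P = {q\<in>J. R q \<omega> \<le> \<delta>}"
    have P: "finite P" "P \<noteq> {}" "P \<subseteq> J" using True fin by (auto simp: P_def)
    obtain m where m: "m \<in> P" "\<And>q. q \<in> P \<Longrightarrow> l q \<le> l m"
    proof -
      have "Max (l ` P) \<in> l ` P" using P by (intro Max_in) auto
      then obtain m where "m \<in> P" "l m = Max (l ` P)" by auto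
      then show ?thesis using P(1) by (intro that[of m]) auto
    qed
    have mJ: "m \<in> J" using m(1) P(3) by blast
    have before: "u q \<le> l m" if "q \<in> P" "q \<noteq> m" for q
    proof -
      have qJ: "q \<in> J" using that P by auto
      have "\<not> u m \<le> l q" using lu[OF mJ] m(2)[OF that(1)] by simp
      then show ?thesis using disj[OF qJ mJ that(2)] by blast
    qed
    have "(\<Sum>q\<in>J. (Z q \<omega>)\<^sup>2 * (u q - l q)) = (\<Sum>q\<in>P. (\<xi> q \<omega>)\<^sup>2 * (u q - l q))"
      using fin P by (intro sum.mono_neutral_cong_right) (auto simp: P_def Z_def)
    also have "\<dots> = (\<Sum>q\<in>P - {m}. (\<xi> q \<omega>)\<^sup>2 * (u q - l q)) + (\<xi> m \<omega>)\<^sup>2 * (u m - l m)"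
      using P m by (subst sum.remove[of P m]) auto
    also have "\<dots> \<le> R m \<omega>"
      unfolding R_def using before fin P(3) h
      by (intro add_right_mono sum_mono2) (auto intro!: mult_nonneg_nonneg simp: less_imp_le[OF lu])
    also have "\<dots> \<le> \<delta>" using m(1) by (simp add: P_def)
    finally show ?thesis .
  qed
  have ZF: "Z q \<in> borel_measurable (F t)" if "q \<in> J" "l q \<le> t" for q t
    using Z_meas[OF that(1)] that(2) by (rule measurable_F_mono)
  have \<Delta>int: "integrable M (\<Delta> q)" "integrable M (\<lambda>\<omega>. (\<Delta> q \<omega>)\<^sup>2)" "(\<integral>\<omega>. \<Delta> q \<omega> \<partial>M) = 0"
     "(\<integral>\<omega>. (\<Delta> q \<omega>)\<^sup>2 \<partial>M) = u q - l q" if "q \<in> J" for q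
    using W_increment_moments[OF l0[OF that] less_imp_le[OF lu[OF that]]]
      W_increment_moments(1)[OF l0[OF that] less_imp_le[OF lu[OF that]], of 1]
    unfolding \<Delta>_def by auto
  have Zint: "integrable M (Z q)" "integrable M (\<lambda>\<omega>. (Z q \<omega>)\<^sup>2)" if "q \<in> J" for q
  proof -
    show "integrable M (Z q)"
      using Zb[OF that] ZM[OF that] by (intro integrable_const_bound[where B="sqrt (\<delta> / (u q - l q))"]) auto
    have "\<bar>Z q \<omega>\<bar>\<^sup>2 \<le> (sqrt (\<delta> / (u q - l q)))\<^sup>2" for \<omega>
      using Zb[OF that] by (rule power_mono) simp
    then show "integrable M (\<lambda>\<omega>. (Z q \<omega>)\<^sup>2)"
      using ZM[OF that] by (intro integrable_const_bound[where B="(sqrt (\<delta> / (u q - l q)))\<^sup>2"]) auto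
  qed
  define Y where "Y q \<omega> = Z q \<omega> * \<Delta> q \<omega>" for q \<omega>
  have diag: "integrable M (\<lambda>\<omega>. Y q \<omega> * Y q \<omega>)" "(\<integral>\<omega>. Y q \<omega> * Y q \<omega> \<partial>M) = (\<integral>\<omega>. (Z q \<omega>)\<^sup>2 * (u q - l q) \<partial>M)"
    if "q \<in> J" for q
  proof -
    have e: "(\<lambda>\<omega>. Y q \<omega> * Y q \<omega>) = (\<lambda>\<omega>. (Z q \<omega>)\<^sup>2 * (\<Delta> q \<omega>)\<^sup>2)"
      by (auto simp: Y_def power2_eq_square)
    have Z2: "(\<lambda>\<omega>. (Z q \<omega>)\<^sup>2) \<in> borel_measurable (F (l q))" using Z_meas[OF that] by simp
    show "integrable M (\<lambda>\<omega>. Y q \<omega> * Y q \<omega>)" "(\<integral>\<omega>. Y q \<omega> * Y q \<omega> \<partial>M) = (\<integral>\<omega>. (Z q \<omega>)\<^sup>2 * (u q - l q) \<partial>M)"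
      unfolding e
      using W_increment_mult[OF l0[OF that] less_imp_le[OF lu[OF that]] Z2 Zint(2)[OF that], of "\<lambda>x. x\<^sup>2"]
        \<Delta>int[OF that] unfolding \<Delta>_def by auto
  qed
  \<comment> \<open>On the later interval the coefficient and the whole product from the earlier
    interval are known at its left end, so the centred increment there makes the expectation
    vanish.\<close>
  have off': "integrable M (\<lambda>\<omega>. Y q \<omega> * Y q' \<omega>) \<and> (\<integral>\<omega>. Y q \<omega> * Y q' \<omega> \<partial>M) = 0"
    if "q \<in> J" "q' \<in> J" "u q \<le> l q'" for q q'
  proof -
    let ?f = "\<lambda>\<omega>. Z q' \<omega> * (Z q \<omega> * \<Delta> q \<omega>)"
    have "?f \<in> borel_measurable (F (l q'))"
      unfolding \<Delta>_def
      using ZF[OF that(2) order_refl] ZF[OF that(1), of "l q'"] W_measurable_F'[of "u q" "l q'"] W_measurable_F'[of "l q" "l q'"]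
        that lu[OF that(1)] l0[OF that(1)] by auto
    moreover have "integrable M ?f"
      by (rule integrable_bounded_mult[OF integrable_bounded_mult[OF \<Delta>int(1)[OF that(1)] ZM[OF that(1)] Zb[OF that(1)]] ZM[OF that(2)] Zb[OF that(2)]])
    ultimately have "integrable M (\<lambda>\<omega>. ?f \<omega> * \<Delta> q' \<omega>)" "(\<integral>\<omega>. ?f \<omega> * \<Delta> q' \<omega> \<partial>M) = 0"
      using W_increment_mult[OF l0[OF that(2)] less_imp_le[OF lu[OF that(2)]], of ?f "\<lambda>x. x"]
        \<Delta>int[OF that(2)] unfolding \<Delta>_def by auto
    moreover have "(\<lambda>\<omega>. ?f \<omega> * \<Delta> q' \<omega>) = (\<lambda>\<omega>. Y q \<omega> * Y q' \<omega>)" by (auto simp: Y_def)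
    ultimately show ?thesis by simp
  qed
  have off: "integrable M (\<lambda>\<omega>. Y q \<omega> * Y q' \<omega>)" "(\<integral>\<omega>. Y q \<omega> * Y q' \<omega> \<partial>M) = 0"
    if "q \<in> J" "q' \<in> J" "q \<noteq> q'" for q q'
  proof -
    have "integrable M (\<lambda>\<omega>. Y q \<omega> * Y q' \<omega>) \<and> (\<integral>\<omega>. Y q \<omega> * Y q' \<omega> \<partial>M) = 0"
      using disj[OF that] off'[OF that(1,2)] off'[OF that(2,1)] by (auto simp: mult.commute)
    then show "integrable M (\<lambda>\<omega>. Y q \<omega> * Y q' \<omega>)" "(\<integral>\<omega>. Y q \<omega> * Y q' \<omega> \<partial>M) = 0" by auto
  qed
  have allint: "integrable M (\<lambda>\<omega>. Y q \<omega> * Y q' \<omega>)" if "q \<in> J" "q' \<in> J" for q q'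
    using off(1)[OF that] diag(1)[OF that(1)] by (cases "q = q'") auto
  define Q where "Q \<omega> = (\<Sum>b\<in>B. (\<Sum>q\<in>{q\<in>J. c q = b}. Y q \<omega>)\<^sup>2)" for \<omega>
  have Qeq: "Q = (\<lambda>\<omega>. \<Sum>b\<in>B. \<Sum>q\<in>{q\<in>J. c q = b}. \<Sum>q'\<in>{q\<in>J. c q = b}. Y q \<omega> * Y q' \<omega>)"
    unfolding Q_def power2_eq_square sum_product ..
  have Qint: "integrable M Q" unfolding Qeq using allint by (intro Bochner_Integration.integrable_sum) auto
  have "(\<integral>\<omega>. Q \<omega> \<partial>M) = (\<Sum>b\<in>B. \<Sum>q\<in>{q\<in>J. c q = b}. \<Sum>q'\<in>{q\<in>J. c q = b}. \<integral>\<omega>. Y q \<omega> * Y q' \<omega> \<partial>M)"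
    unfolding Qeq
    by (intro has_bochner_integral_integral_eq has_bochner_integral_sum has_bochner_integral_integrable allint) auto
  also have "\<dots> = (\<Sum>b\<in>B. \<Sum>q\<in>{q\<in>J. c q = b}. \<integral>\<omega>. (Z q \<omega>)\<^sup>2 * (u q - l q) \<partial>M)"
  proof (intro sum.cong refl)
    fix b q assume q: "q \<in> {q\<in>J. c q = b}"
    have "(\<Sum>q'\<in>{q\<in>J. c q = b}. \<integral>\<omega>. Y q \<omega> * Y q' \<omega> \<partial>M) = (\<Sum>q'\<in>{q}. \<integral>\<omega>. Y q \<omega> * Y q' \<omega> \<partial>M)"
      using q fin off(2) by (intro sum.mono_neutral_right) auto
    then show "(\<Sum>q'\<in>{q\<in>J. c q = b}. \<integral>\<omega>. Y q \<omega> * Y q' \<omega> \<partial>M) = (\<integral>\<omega>. (Z q \<omega>)\<^sup>2 * (u q - l q) \<partial>M)"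
      using q diag by simp
  qed
  also have "\<dots> = (\<Sum>q\<in>{q\<in>J. c q \<in> B}. \<integral>\<omega>. (Z q \<omega>)\<^sup>2 * (u q - l q) \<partial>M)"
  proof -
    have "{x \<in> {q\<in>J. c q \<in> B}. c x = b} = {q\<in>J. c q = b}" if "b \<in> B" for b
      using that by auto
    then show ?thesis
      using fin sum.group[of "{q\<in>J. c q \<in> B}" B c "\<lambda>q. \<integral>\<omega>. (Z q \<omega>)\<^sup>2 * (u q - l q) \<partial>M"]
      by (simp add: image_subset_iff cong: sum.cong)
  qed
  also have "\<dots> \<le> (\<Sum>q\<in>J. \<integral>\<omega>. (Z q \<omega>)\<^sup>2 * (u q - l q) \<partial>M)"
    using fin lu by (intro sum_mono2) (auto intro!: integral_nonneg_AE simp: less_imp_le)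
  also have "\<dots> = (\<integral>\<omega>. (\<Sum>q\<in>J. (Z q \<omega>)\<^sup>2 * (u q - l q)) \<partial>M)"
    using Zint by (subst Bochner_Integration.integral_sum) auto
  also have "\<dots> \<le> (\<integral>\<omega>. \<delta> \<partial>M)"
    using Zsum Zint by (intro integral_mono Bochner_Integration.integrable_sum) auto
  finally have EQ: "(\<integral>\<omega>. Q \<omega> \<partial>M) \<le> \<delta>" by (simp add: prob_space)
  define S where "S \<omega> = (\<Sum>q\<in>J. (\<xi> q \<omega>)\<^sup>2 * (u q - l q))" for \<omega>
  have SM: "S \<in> borel_measurable M" unfolding S_def by measurable
  have S0: "0 \<le> S \<omega>" for \<omega> unfolding S_def using lu by (auto intro!: sum_nonneg simp: less_imp_le)
  have Sint: "integrable M (\<lambda>\<omega>. min 1 (S \<omega> / \<delta>))"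
    using SM S0 \<delta> by (intro integrable_const_bound[where B=1]) auto
  define V where "V \<omega> = (\<Sum>b\<in>B. (\<Sum>q\<in>{q\<in>J. c q = b}. \<xi> q \<omega> * \<Delta> q \<omega>)\<^sup>2)" for \<omega>
  have Q0: "0 \<le> Q \<omega>" for \<omega> unfolding Q_def by (auto intro!: sum_nonneg)
  have V0: "0 \<le> V \<omega>" for \<omega> unfolding V_def by (auto intro!: sum_nonneg)
  have VM: "V \<in> borel_measurable M" unfolding V_def using \<Delta>M by measurable
  \<comment> \<open>Where the total energy is at most \<delta>, no coefficient has been truncated
    and both sums of squares agree; elsewhere the second term on the right already equals 1.\<close>
  have pt: "min 1 (V \<omega>) \<le> Q \<omega> + min 1 (S \<omega> / \<delta>)" for \<omega>
  proof (cases "S \<omega> \<le> \<delta>")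
    case True
    have "R q \<omega> \<le> \<delta>" if q: "q \<in> J" for q
    proof -
      have "R q \<omega> = (\<Sum>q'\<in>insert q {q'\<in>J. u q' \<le> l q}. (\<xi> q' \<omega>)\<^sup>2 * (u q' - l q'))"
        unfolding R_def using fin lu[OF q] by (subst sum.insert) auto
      also have "\<dots> \<le> S \<omega>" unfolding S_def
        using fin q lu by (intro sum_mono2) (auto simp: less_imp_le)
      finally show ?thesis using True by simp
    qed
    then have "V \<omega> = Q \<omega>" unfolding V_def Q_def Y_def Z_def
      by (intro sum.cong refl arg_cong[where f="\<lambda>x. x\<^sup>2"]) auto
    moreover have "0 \<le> S \<omega> / \<delta>" using S0[of \<omega>] \<delta> by simp
    ultimately show ?thesis using Q0[of \<omega>] by (auto simp: min_def)
  next
    case False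
    then have "1 \<le> S \<omega> / \<delta>" using \<delta> by simp
    then show ?thesis using Q0[of \<omega>] by simp
  qed
  have "(\<integral>\<omega>. min 1 (V \<omega>) \<partial>M) \<le> (\<integral>\<omega>. Q \<omega> + min 1 (S \<omega> / \<delta>) \<partial>M)"
    using pt Qint Sint VM V0 by (intro integral_mono) (auto intro!: integrable_const_bound[where B=1])
  also have "\<dots> \<le> \<delta> + (\<integral>\<omega>. min 1 (S \<omega> / \<delta>) \<partial>M)"
    using Qint Sint EQ by simp
  finally show ?thesis unfolding V_def S_def \<Delta>_def .
qed

end

subsection \<open>Grids\<close>

lemma grid_cell_exists:
  fixes \<tau> :: "nat \<Rightarrow> real"
  assumes "\<tau> 0 < s" "s \<le> \<tau> n"
  obtains j where "j < n" "\<tau> j < s" "s \<le> \<tau> (Suc j)"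
proof -
  define j where "j = (LEAST k. s \<le> \<tau> k)"
  have j: "s \<le> \<tau> j" "j \<le> n" unfolding j_def using assms(2) by (auto intro: LeastI Least_le)
  then have "j \<noteq> 0" using assms(1) by (cases j) auto
  then obtain i where i: "j = Suc i" by (cases j) auto
  have "\<not> s \<le> \<tau> i" using not_less_Least[of i "\<lambda>k. s \<le> \<tau> k"] i unfolding j_def by simp
  then show ?thesis using that[of i] i j by auto
qed

lemma grid_mono:
  fixes \<tau> :: "nat \<Rightarrow> real"
  assumes "\<And>i. i < n \<Longrightarrow> \<tau> i \<le> \<tau> (Suc i)" "i \<le> j" "j \<le> n"
  shows "\<tau> i \<le> \<tau> j"
  using assms(2,3)
proof (induction j)
  case (Suc j)
  then show ?case using assms(1)[of j] by (cases "i = Suc j") (auto intro: order_trans)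
qed simp

lemma grid_cell_unique:
  fixes \<tau> :: "nat \<Rightarrow> real"
  assumes mono: "\<And>i. i < n \<Longrightarrow> \<tau> i \<le> \<tau> (Suc i)"
    and "i < n" "\<tau> i < s" "s \<le> \<tau> (Suc i)" "j < n" "\<tau> j < s" "s \<le> \<tau> (Suc j)"
  shows "i = j"
proof (rule ccontr)
  assume "i \<noteq> j"
  then consider "Suc i \<le> j" | "Suc j \<le> i" by linarith
  then show False
  proof cases
    case 1 then show False using grid_mono[of n \<tau> "Suc i" j] assms by auto
  next
    case 2 then show False using grid_mono[of n \<tau> "Suc j" i] assms by auto
  qed
qed

lemma sum_cell:
  fixes \<tau> :: "nat \<Rightarrow> real" and f :: "nat \<Rightarrow> real"
  assumes mono: "\<And>i. i < n \<Longrightarrow> \<tau> i \<le> \<tau> (Suc i)" and "j < n" "\<tau> j < s" "s \<le> \<tau> (Suc j)"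
  shows "(\<Sum>i<n. f i * indicator {\<tau> i<..\<tau> (Suc i)} s) = f j"
proof -
  have "(\<Sum>i<n. f i * indicator {\<tau> i<..\<tau> (Suc i)} s) = (\<Sum>i\<in>{j}. f i * indicator {\<tau> i<..\<tau> (Suc i)} s)"
  proof (rule sum.mono_neutral_right)
    show "\<forall>i\<in>{..<n} - {j}. f i * indicator {\<tau> i<..\<tau> (Suc i)} s = 0"
    proof
      fix i assume i: "i \<in> {..<n} - {j}"
      then have "\<not> (\<tau> i < s \<and> s \<le> \<tau> (Suc i))"
        using grid_cell_unique[of n \<tau> i s j, OF mono] assms(2-4) by blast
      then show "f i * indicator {\<tau> i<..\<tau> (Suc i)} s = 0" by (simp add: indicator_def)
    qed
  qed (use assms(2) in auto)
  then show ?thesis using assms by simp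
qed

lemma simple_process_cell:
  assumes "\<And>i. i < n \<Longrightarrow> \<tau> i \<le> \<tau> (Suc i)" and "j < n" "\<tau> j < s" "s \<le> \<tau> (Suc j)"
  shows "simple_process n \<tau> \<xi> s \<omega> = \<xi> j \<omega>"
  unfolding simple_process_def using assms by (rule sum_cell)

text \<open>Approximating processes come with arbitrary grids, while the expansion of the logarithm
  needs grids that run exactly from 0 to T, have no empty cells and a mesh tending to zero. Sorting
  the finite set of the old nodes cut off at T together with equidistant ones gives such a grid;
  since no old node below T lies inside a new cell, process and integral are unchanged up to
  T.\<close>

lemma simple_integrand_refine:
  assumes si: "simple_integrand M F n \<tau> \<xi>" and filt: "filtration (space M) F" and T: "0 < T" and m: "0 < m"
  obtains n' \<tau>' \<xi>' where "simple_integrand M F n' \<tau>' \<xi>'" "\<tau>' 0 = 0" "\<tau>' n' = T"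
    "\<And>i. i < n' \<Longrightarrow> \<tau>' i < \<tau>' (Suc i)" "\<And>i. i < n' \<Longrightarrow> \<tau>' (Suc i) - \<tau>' i \<le> T / real m"
    "\<And>s \<omega>. 0 < s \<Longrightarrow> s \<le> T \<Longrightarrow> simple_process n' \<tau>' \<xi>' s \<omega> = simple_process n \<tau> \<xi> s \<omega>"
    "\<And>t W \<omega>. 0 \<le> t \<Longrightarrow> t \<le> T \<Longrightarrow> simple_integral n' \<tau>' \<xi>' W t \<omega> = simple_integral n \<tau> \<xi> W t \<omega>"
proof -
  have \<tau>0: "0 \<le> \<tau> 0" and mono: "\<And>i. i < n \<Longrightarrow> \<tau> i \<le> \<tau> (Suc i)"
    and meas: "\<And>i. i < n \<Longrightarrow> \<xi> i \<in> borel_measurable (F (\<tau> i))"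
    and bdd: "\<And>i. i < n \<Longrightarrow> \<exists>K. \<forall>\<omega>\<in>space M. \<bar>\<xi> i \<omega>\<bar> \<le> K"
    using si by (auto simp: simple_integrand_def)
  have \<tau>nn: "0 \<le> \<tau> i" if "i \<le> n" for i using grid_mono[of n \<tau> 0 i, OF mono] \<tau>0 that by simp
  define P where "P = {0, T} \<union> (\<lambda>j. T * real j / real m) ` {..m} \<union> (\<lambda>i. min T (\<tau> i)) ` {..n}"
  have finP: "finite P" unfolding P_def by auto
  have P0: "0 \<in> P" "T \<in> P" unfolding P_def by auto
  have Pb: "0 \<le> p \<and> p \<le> T" if "p \<in> P" for p
    using that T m \<tau>nn unfolding P_def by (auto simp: field_simps)
  define xs where "xs = sorted_list_of_set P"
  have xs: "set xs = P" "sorted_wrt (<) xs" using finP by (auto simp: xs_def)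
  define n' where "n' = length xs - 1"
  define \<tau>' where "\<tau>' j = xs ! j" for j
  have "xs \<noteq> []" using xs P0 by auto
  then have len: "length xs = Suc n'" by (simp add: n'_def)
  have less: "\<tau>' i < \<tau>' j" if "i < j" "j \<le> n'" for i j
    unfolding \<tau>'_def using xs(2) that len by (auto simp: sorted_wrt_iff_nth_less)
  have le: "\<tau>' i \<le> \<tau>' j" if "i \<le> j" "j \<le> n'" for i j
    using less[of i j] that by (cases "i = j") auto
  have inP: "\<tau>' i \<in> P" if "i \<le> n'" for i
    using that len xs(1) nth_mem[of i xs] unfolding \<tau>'_def by auto
  have ex: "\<exists>i\<le>n'. p = \<tau>' i" if "p \<in> P" for p
    using that xs(1) len unfolding \<tau>'_def by (auto simp: in_set_conv_nth less_Suc_eq_le)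
  have sep: "p \<le> \<tau>' j \<or> \<tau>' (Suc j) \<le> p" if "p \<in> P" "j < n'" for p j
  proof -
    from ex[OF that(1)] obtain i where "i \<le> n'" "p = \<tau>' i" by auto
    then show ?thesis using le[of i j] le[of "Suc j" i] that(2) by (cases "i \<le> j") auto
  qed
  have z: "\<tau>' 0 = 0"
  proof -
    obtain i where "i \<le> n'" "0 = \<tau>' i" using ex[OF P0(1)] by auto
    then show ?thesis using le[of 0 i] Pb[OF inP[of 0]] by simp
  qed
  have zT: "\<tau>' n' = T"
  proof -
    obtain i where "i \<le> n'" "T = \<tau>' i" using ex[OF P0(2)] by auto
    then show ?thesis using le[of i n'] Pb[OF inP[of n']] by simp
  qed
  have st: "\<tau>' i < \<tau>' (Suc i)" if "i < n'" for i using less[of i "Suc i"] that by simp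
  have mesh: "\<tau>' (Suc i) - \<tau>' i \<le> T / real m" if i: "i < n'" for i
  proof (rule ccontr)
    assume *: "\<not> \<tau>' (Suc i) - \<tau>' i \<le> T / real m"
    define a where "a = \<tau>' i * real m / T"
    have a0: "0 \<le> a" unfolding a_def using Pb[OF inP[of i]] i T by simp
    \<comment> \<open>\<open>T * real j / real m\<close> is the first equidistant node strictly to
      the right of \<open>\<tau>' i\<close>. If the cell were longer than \<open>T / real m\<close>,
      this node would lie in its interior.\<close>
    define j where "j = Suc (nat \<lfloor>a\<rfloor>)"
    have j: "a < real j" "real j \<le> a + 1" using a0 unfolding j_def by linarith+
    have aT: "a * T / real m = \<tau>' i" using T m by (simp add: a_def)
    have 1: "\<tau>' i < T * real j / real m"
      using j(1) T m unfolding aT[symmetric] by (simp add: field_simps)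
    have "T * real j / real m \<le> T * (a + 1) / real m"
      using j(2) T m by (intro divide_right_mono mult_left_mono) auto
    also have "\<dots> = \<tau>' i + T / real m" using aT by (simp add: field_simps add_divide_distrib)
    also have "\<dots> < \<tau>' (Suc i)" using * by simp
    finally have 2: "T * real j / real m < \<tau>' (Suc i)" .
    also have "\<dots> \<le> T" using Pb[OF inP[of "Suc i"]] i by simp
    finally have "j \<le> m" using T m by (simp add: field_simps)
    then have "T * real j / real m \<in> P" unfolding P_def by blast
    then show False using sep[OF _ i] 1 2 by force
  qed
  have sepI: "\<tau> i < s \<longleftrightarrow> \<tau> i \<le> \<tau>' j" if "i \<le> n" "j < n'" "\<tau>' j < s" "s \<le> \<tau>' (Suc j)" for i j s
  proof -
    have "min T (\<tau> i) \<in> P" using that(1) unfolding P_def by auto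
    from sep[OF this that(2)] Pb[OF inP[of "Suc j"]] Pb[OF inP[of "j"]] that show ?thesis
      by (auto simp: min_def split: if_splits)
  qed
  \<comment> \<open>Cells are open on the left, so the value at the right end is the value on the
    whole cell. It is nevertheless known at the left end: an old node strictly before the right end
    is at most the left end.\<close>
  define \<xi>' where "\<xi>' j = simple_process n \<tau> \<xi> (\<tau>' (Suc j))" for j
  have ind: "indicator {\<tau> i<..\<tau> (Suc i)} s = (indicator {\<tau> i<..\<tau> (Suc i)} (\<tau>' (Suc j)) :: real)"
    if "i < n" "j < n'" "\<tau>' j < s" "s \<le> \<tau>' (Suc j)" for i j s
  proof -
    have "\<tau> i < s \<longleftrightarrow> \<tau> i < \<tau>' (Suc j)"
      using sepI[of i j s] sepI[of i j "\<tau>' (Suc j)"] st[OF that(2)] that by simp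
    moreover have "\<tau> (Suc i) < s \<longleftrightarrow> \<tau> (Suc i) < \<tau>' (Suc j)"
      using sepI[of "Suc i" j s] sepI[of "Suc i" j "\<tau>' (Suc j)"] st[OF that(2)] that by simp
    ultimately show ?thesis unfolding indicator_def greaterThanAtMost_iff linorder_not_less[symmetric] by (simp only:)
  qed
  have proc: "simple_process n' \<tau>' \<xi>' s \<omega> = simple_process n \<tau> \<xi> s \<omega>" if s: "0 < s" "s \<le> T" for s \<omega>
  proof -
    obtain j where j: "j < n'" "\<tau>' j < s" "s \<le> \<tau>' (Suc j)"
      using grid_cell_exists[of \<tau>' s n'] s z zT by auto
    have "simple_process n' \<tau>' \<xi>' s \<omega> = \<xi>' j \<omega>"
      by (rule simple_process_cell[of n' \<tau>' j s, OF less_imp_le[OF st] j])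
    also have "\<dots> = simple_process n \<tau> \<xi> s \<omega>"
      unfolding \<xi>'_def simple_process_def by (intro sum.cong refl) (simp add: ind[OF _ j])
    finally show ?thesis .
  qed
  have si': "simple_integrand M F n' \<tau>' \<xi>'"
    unfolding simple_integrand_def
  proof (intro conjI allI impI)
    fix j assume j: "j < n'"
    show "\<tau>' j \<le> \<tau>' (Suc j)" using st[OF j] by simp
    show "\<xi>' j \<in> borel_measurable (F (\<tau>' j))"
      unfolding \<xi>'_def simple_process_def
    proof (rule borel_measurable_sum)
      fix i assume "i \<in> {..<n}"
      then have i: "i < n" by simp
      show "(\<lambda>\<omega>. \<xi> i \<omega> * indicator {\<tau> i<..\<tau> (Suc i)} (\<tau>' (Suc j))) \<in> borel_measurable (F (\<tau>' j))"
      proof (cases "\<tau> i < \<tau>' (Suc j)")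
        case True
        then have "\<tau> i \<le> \<tau>' j" using sepI[of i j "\<tau>' (Suc j)"] i j st[OF j] by simp
        then have "sets (F (\<tau> i)) \<subseteq> sets (F (\<tau>' j))" "space (F (\<tau> i)) = space (F (\<tau>' j))"
          using filt by (auto simp: filtration_def)
        then have "\<xi> i \<in> borel_measurable (F (\<tau>' j))" using meas[OF i] by (auto simp: measurable_def)
        then show ?thesis by simp
      next
        case False then show ?thesis by (simp add: indicator_def)
      qed
    qed
    from bdd obtain K where K: "\<And>i \<omega>. i < n \<Longrightarrow> \<omega> \<in> space M \<Longrightarrow> \<bar>\<xi> i \<omega>\<bar> \<le> K i" by metis
    show "\<exists>K. \<forall>\<omega>\<in>space M. \<bar>\<xi>' j \<omega>\<bar> \<le> K"
    proof (intro exI ballI)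
      fix \<omega> assume \<omega>: "\<omega> \<in> space M"
      have "\<bar>\<xi>' j \<omega>\<bar> \<le> (\<Sum>i<n. \<bar>\<xi> i \<omega> * indicator {\<tau> i<..\<tau> (Suc i)} (\<tau>' (Suc j))\<bar>)"
        unfolding \<xi>'_def simple_process_def by (rule sum_abs)
      also have "\<dots> \<le> (\<Sum>i<n. \<bar>K i\<bar>)"
      proof (rule sum_mono)
        fix i assume "i \<in> {..<n}"
        then show "\<bar>\<xi> i \<omega> * indicator {\<tau> i<..\<tau> (Suc i)} (\<tau>' (Suc j))\<bar> \<le> \<bar>K i\<bar>"
          using K[of i \<omega>] \<omega> by (auto simp: indicator_def)
      qed
      finally show "\<bar>\<xi>' j \<omega>\<bar> \<le> (\<Sum>i<n. \<bar>K i\<bar>)" .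
    qed
  qed (use z in auto)
  have int: "simple_integral n' \<tau>' \<xi>' W t \<omega> = simple_integral n \<tau> \<xi> W t \<omega>" if t: "0 \<le> t" "t \<le> T" for t W \<omega>
  proof -
    define g where "g x = W (min t x) \<omega>" for x
    have tel: "(\<Sum>j<n'. indicator {\<tau> i<..\<tau> (Suc i)} (\<tau>' (Suc j)) * (g (\<tau>' (Suc j)) - g (\<tau>' j))) = g (\<tau> (Suc i)) - g (\<tau> i)"
      if i: "i < n" for i
    proof -
      \<comment> \<open>Projecting onto the old cell makes the increments over new cells outside it
        vanish and keeps those inside, so the indicator sum becomes telescoping.\<close>
      define G where "G x = g (max (\<tau> i) (min x (\<tau> (Suc i))))" for x
      have "indicator {\<tau> i<..\<tau> (Suc i)} (\<tau>' (Suc j)) * (g (\<tau>' (Suc j)) - g (\<tau>' j)) = G (\<tau>' (Suc j)) - G (\<tau>' j)"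
        if j: "j < n'" for j
      proof -
        note st' = st[OF j]
        consider "\<tau> i \<le> \<tau>' j" "\<tau>' (Suc j) \<le> \<tau> (Suc i)" | "\<tau>' (Suc j) \<le> \<tau> i" | "\<tau> (Suc i) \<le> \<tau>' j"
          using sepI[of i j "\<tau>' (Suc j)"] sepI[of "Suc i" j "\<tau>' (Suc j)"] i j st' by (auto simp: not_less)
        then show ?thesis
        proof cases
          case 1
          then have "G (\<tau>' (Suc j)) = g (\<tau>' (Suc j))" "G (\<tau>' j) = g (\<tau>' j)"
            using st' unfolding G_def by (simp_all add: max_absorb2 min_absorb1)
          then show ?thesis using 1 st' by (simp add: indicator_def)
        next
          case 2
          then have "G (\<tau>' (Suc j)) = g (\<tau> i)" "G (\<tau>' j) = g (\<tau> i)"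
            using st' mono[OF i] unfolding G_def by (simp_all add: max_absorb1 min_absorb1)
          then show ?thesis using 2 by (simp add: indicator_def)
        next
          case 3
          then have "G (\<tau>' (Suc j)) = g (\<tau> (Suc i))" "G (\<tau>' j) = g (\<tau> (Suc i))"
            using st' mono[OF i] unfolding G_def by (simp_all add: max_absorb2 min_absorb2)
          then show ?thesis using 3 st' by (simp add: indicator_def)
        qed
      qed
      then have "(\<Sum>j<n'. indicator {\<tau> i<..\<tau> (Suc i)} (\<tau>' (Suc j)) * (g (\<tau>' (Suc j)) - g (\<tau>' j))) = G (\<tau>' n') - G (\<tau>' 0)"
        using sum_lessThan_telescope[of "\<lambda>j. G (\<tau>' j)" n'] by simp
      also have "G (\<tau>' 0) = g (\<tau> i)"
        unfolding z G_def using \<tau>nn[of i] \<tau>nn[of "Suc i"] i by (simp add: max_def min_def)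
      also have "G (\<tau>' n') = g (\<tau> (Suc i))"
      proof -
        have "min t (max (\<tau> i) (min T (\<tau> (Suc i)))) = min t (\<tau> (Suc i))"
          using t mono[OF i] by (auto simp: max_def min_def)
        then show ?thesis unfolding zT G_def g_def by simp
      qed
      finally show ?thesis .
    qed
    have "simple_integral n' \<tau>' \<xi>' W t \<omega> =
        (\<Sum>j<n'. \<Sum>i<n. \<xi> i \<omega> * (indicator {\<tau> i<..\<tau> (Suc i)} (\<tau>' (Suc j)) * (g (\<tau>' (Suc j)) - g (\<tau>' j))))"
      unfolding simple_integral_def \<xi>'_def simple_process_def g_def by (simp only: sum_distrib_right mult.assoc)
    also have "\<dots> = (\<Sum>i<n. \<xi> i \<omega> * (\<Sum>j<n'. indicator {\<tau> i<..\<tau> (Suc i)} (\<tau>' (Suc j)) * (g (\<tau>' (Suc j)) - g (\<tau>' j))))"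
      by (subst sum.swap) (simp only: sum_distrib_left)
    also have "\<dots> = simple_integral n \<tau> \<xi> W t \<omega>"
      unfolding simple_integral_def using tel by (simp add: g_def)
    finally show ?thesis .
  qed
  show ?thesis
    by (rule that[OF si' z zT st mesh proc int])
qed

subsection \<open>Second-order expansion of a product of relative increments\<close>

text \<open>The remainder has derivative y^2 / (1 + y), which is at most 2 x^2 for \<bar>y\<bar>
  \<le> \<bar>x\<bar> \<le> 1/2. The cubic bound is written with a separate factor
  \<open>\<bar>x\<bar>\<close> so that a sum of remainders is controlled by the largest increment
  times the quadratic variation.\<close>

lemma ln_quadratic_bound:
  fixes x :: real
  assumes "\<bar>x\<bar> \<le> 1/2"
  shows "\<bar>ln (1 + x) - x + x\<^sup>2 / 2\<bar> \<le> 2 * \<bar>x\<bar> * x\<^sup>2"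
proof -
  define f :: "real \<Rightarrow> real" where "f y = ln (1 + y) - y + y\<^sup>2 / 2" for y
  have D: "(f has_real_derivative (y\<^sup>2 / (1 + y))) (at y)" if "\<bar>y\<bar> \<le> 1/2" for y
    unfolding f_def using that
    by (auto intro!: derivative_eq_intros simp: field_simps power2_eq_square)
  have bd: "\<bar>y\<^sup>2 / (1 + y)\<bar> \<le> 2 * x\<^sup>2" if "\<bar>y\<bar> \<le> \<bar>x\<bar>" for y
  proof -
    have 1: "y\<^sup>2 \<le> x\<^sup>2" using that by (simp add: abs_le_square_iff)
    have 2: "1/2 \<le> 1 + y" using that assms by linarith
    have "y\<^sup>2 / (1 + y) \<le> y\<^sup>2 / (1/2)"
      using 2 by (intro divide_left_mono) auto
    also have "\<dots> = 2 * y\<^sup>2" by simp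
    also have "\<dots> \<le> 2 * x\<^sup>2" using 1 by simp
    finally have 3: "y\<^sup>2 / (1 + y) \<le> 2 * x\<^sup>2" .
    have 4: "0 \<le> y\<^sup>2 / (1 + y)" using 2 by (intro divide_nonneg_nonneg) auto
    show ?thesis using 3 unfolding abs_of_nonneg[OF 4] .
  qed
  have "norm (f x - f 0) \<le> 2 * x\<^sup>2 * norm (x - 0)"
  proof (rule field_differentiable_bound[where S="{- \<bar>x\<bar>..\<bar>x\<bar>}"])
    show "(f has_field_derivative (y\<^sup>2 / (1 + y))) (at y within {- \<bar>x\<bar>..\<bar>x\<bar>})" if "y \<in> {- \<bar>x\<bar>..\<bar>x\<bar>}" for y
      using D[of y] that assms by (auto intro: has_field_derivative_at_within)
    show "norm (y\<^sup>2 / (1 + y)) \<le> 2 * x\<^sup>2" if "y \<in> {- \<bar>x\<bar>..\<bar>x\<bar>}" for y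
      using bd[of y] that by auto
  qed auto
  then show ?thesis by (simp add: f_def mult.commute mult.left_commute)
qed

text \<open>Applied to the relative increments \<open>x\<close> of a price, which split into a drift \<open>b\<close>, an approximation
  error \<open>e\<close> and the increments \<open>v\<close> of a stochastic integral.\<close>

lemma log_sum_limit:
  fixes x b e v :: "nat \<Rightarrow> nat \<Rightarrow> real"
  assumes x: "\<And>k i. i < n k \<Longrightarrow> x k i = b k i + e k i + v k i"
    and small: "\<And>\<eta>. 0 < \<eta> \<Longrightarrow> \<forall>\<^sub>F k in sequentially. \<forall>i<n k. \<bar>x k i\<bar> \<le> \<eta>"
    and b: "(\<lambda>k. \<Sum>i<n k. b k i) \<longlonglongrightarrow> \<beta>" and b2: "(\<lambda>k. \<Sum>i<n k. (b k i)\<^sup>2) \<longlonglongrightarrow> 0"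
    and e: "(\<lambda>k. \<Sum>i<n k. e k i) \<longlonglongrightarrow> 0" and e2: "(\<lambda>k. \<Sum>i<n k. (e k i)\<^sup>2) \<longlonglongrightarrow> 0"
    and v2: "(\<lambda>k. \<Sum>i<n k. (v k i)\<^sup>2) \<longlonglongrightarrow> Q"
    and ln: "(\<lambda>k. \<Sum>i<n k. ln (1 + x k i)) \<longlonglongrightarrow> \<Lambda>"
  shows "(\<lambda>k. \<Sum>i<n k. v k i) \<longlonglongrightarrow> \<Lambda> - \<beta> + Q / 2"
proof -
  let ?L = "\<lambda>f k. L2_set (f k) {..<n k}"
  have L: "(\<lambda>k. ?L f k) \<longlonglongrightarrow> sqrt q" if "(\<lambda>k. \<Sum>i<n k. (f k i)\<^sup>2) \<longlonglongrightarrow> q" for f q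
    unfolding L2_set_def by (rule tendsto_real_sqrt[OF that])
  have be: "(\<lambda>k. ?L b k + ?L e k) \<longlonglongrightarrow> 0"
    using tendsto_add[OF L[OF b2] L[OF e2]] by simp
  \<comment> \<open>Along the grid the Euclidean norms of \<open>x\<close> and \<open>v\<close>
    differ by at most those of \<open>b\<close> and \<open>e\<close>, which vanish; hence the sums
    of squares of \<open>x\<close> and \<open>v\<close> have the same limit.\<close>
  have xL: "(\<lambda>k. ?L x k - ?L v k) \<longlonglongrightarrow> 0"
  proof (rule Lim_null_comparison[OF _ be], rule always_eventually, rule allI)
    fix k
    have "?L x k = L2_set (\<lambda>i. (b k i + e k i) + v k i) {..<n k}"
      using x by (intro L2_set_cong) auto
    also have "\<dots> \<le> L2_set (\<lambda>i. b k i + e k i) {..<n k} + ?L v k" by (rule L2_set_triangle_ineq)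
    also have "L2_set (\<lambda>i. b k i + e k i) {..<n k} \<le> ?L b k + ?L e k" by (rule L2_set_triangle_ineq)
    finally have 1: "?L x k \<le> ?L b k + ?L e k + ?L v k" by simp
    have neg: "L2_set (\<lambda>i. - f i) A = L2_set f A" for f :: "nat \<Rightarrow> real" and A by (simp add: L2_set_def)
    have "?L v k = L2_set (\<lambda>i. x k i + (- b k i + - e k i)) {..<n k}"
      using x by (intro L2_set_cong) auto
    also have "\<dots> \<le> ?L x k + L2_set (\<lambda>i. - b k i + - e k i) {..<n k}" by (rule L2_set_triangle_ineq)
    also have "L2_set (\<lambda>i. - b k i + - e k i) {..<n k} \<le> L2_set (\<lambda>i. - b k i) {..<n k} + L2_set (\<lambda>i. - e k i) {..<n k}"
      by (rule L2_set_triangle_ineq)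
    finally have 2: "?L v k \<le> ?L x k + (?L b k + ?L e k)" by (simp add: neg)
    show "norm (?L x k - ?L v k) \<le> ?L b k + ?L e k" using 1 2 by (simp add: abs_le_iff)
  qed
  have "(\<lambda>k. (?L x k - ?L v k) + ?L v k) \<longlonglongrightarrow> 0 + sqrt Q"
    by (rule tendsto_add[OF xL L[OF v2]])
  then have "(\<lambda>k. (?L x k)\<^sup>2) \<longlonglongrightarrow> (sqrt Q)\<^sup>2"
    by (intro tendsto_power) simp
  moreover have "0 \<le> Q"
    by (rule LIMSEQ_le_const[OF v2]) (auto intro!: sum_nonneg)
  ultimately have x2: "(\<lambda>k. \<Sum>i<n k. (x k i)\<^sup>2) \<longlonglongrightarrow> Q"
    by (simp add: L2_set_def sum_nonneg)
  let ?r = "\<lambda>k. \<Sum>i<n k. ln (1 + x k i) - x k i + (x k i)\<^sup>2 / 2"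
  have r: "?r \<longlonglongrightarrow> 0"
  proof (rule LIMSEQ_I)
    fix \<eta> :: real assume \<eta>: "0 < \<eta>"
    have Q1: "\<forall>\<^sub>F k in sequentially. (\<Sum>i<n k. (x k i)\<^sup>2) < Q + 1"
      using x2 by (rule order_tendstoD) simp
    \<comment> \<open>With increments at most \<open>c\<close> and a sum of squares below
      \<open>Q + 1\<close> the remainders add up to at most 2 c (Q + 1), which is at most \<eta> /
      2. The bound 1/2 keeps the increments in the range of
      \<open>ln_quadratic_bound\<close>.\<close>
    define c where "c = min (1/2) (\<eta> / (4 * (Q + 1)))"
    have c: "0 < c" "c \<le> 1/2" "2 * c * (Q + 1) < \<eta>"
    proof -
      show "0 < c" using \<eta> \<open>0 \<le> Q\<close> by (simp add: c_def)
      show "c \<le> 1/2" unfolding c_def by (rule min.cobounded1)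
      have "2 * c * (Q + 1) \<le> 2 * (\<eta> / (4 * (Q + 1))) * (Q + 1)"
        using \<open>0 \<le> Q\<close> by (intro mult_right_mono mult_left_mono) (auto simp: c_def)
      also have "\<dots> = \<eta> / 2" using \<open>0 \<le> Q\<close> by (simp add: field_simps)
      finally show "2 * c * (Q + 1) < \<eta>" using \<eta> by simp
    qed
    have "\<forall>\<^sub>F k in sequentially. norm (?r k - 0) < \<eta>"
      using Q1 small[OF c(1)]
    proof eventually_elim
      case (elim k)
      have "norm (?r k) \<le> (\<Sum>i<n k. \<bar>ln (1 + x k i) - x k i + (x k i)\<^sup>2 / 2\<bar>)" by (simp add: sum_abs)
      also have "\<dots> \<le> (\<Sum>i<n k. 2 * c * (x k i)\<^sup>2)"
      proof (rule sum_mono)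
        fix i assume "i \<in> {..<n k}"
        then have i: "\<bar>x k i\<bar> \<le> c" using elim(2) by auto
        then have "\<bar>ln (1 + x k i) - x k i + (x k i)\<^sup>2 / 2\<bar> \<le> 2 * \<bar>x k i\<bar> * (x k i)\<^sup>2"
          using c(2) by (intro ln_quadratic_bound) auto
        also have "\<dots> \<le> 2 * c * (x k i)\<^sup>2" using i by (intro mult_right_mono) auto
        finally show "\<bar>ln (1 + x k i) - x k i + (x k i)\<^sup>2 / 2\<bar> \<le> 2 * c * (x k i)\<^sup>2" .
      qed
      also have "\<dots> = 2 * c * (\<Sum>i<n k. (x k i)\<^sup>2)" by (simp add: sum_distrib_left)
      also have "\<dots> \<le> 2 * c * (Q + 1)" using elim(1) c(1) by (intro mult_left_mono) auto
      also have "\<dots> < \<eta>" by (rule c(3))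
      finally show ?case by simp
    qed
    then show "\<exists>no. \<forall>k\<ge>no. norm (?r k - 0) < \<eta>" by (simp add: eventually_sequentially)
  qed
  have eq: "(\<Sum>i<n k. v k i) = (\<Sum>i<n k. ln (1 + x k i)) + (\<Sum>i<n k. (x k i)\<^sup>2) / 2 - ?r k
       - (\<Sum>i<n k. b k i) - (\<Sum>i<n k. e k i)" for k
  proof -
    have "(\<Sum>i<n k. v k i) = (\<Sum>i<n k. x k i - b k i - e k i)" using x by (intro sum.cong) auto
    then show ?thesis by (simp add: sum.distrib sum_subtractf sum_divide_distrib)
  qed
  have "(\<lambda>k. (\<Sum>i<n k. ln (1 + x k i)) + (\<Sum>i<n k. (x k i)\<^sup>2) / 2 - ?r k
       - (\<Sum>i<n k. b k i) - (\<Sum>i<n k. e k i)) \<longlonglongrightarrow> \<Lambda> + Q / 2 - 0 - \<beta> - 0"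
    by (intro tendsto_intros ln x2 r b e) simp
  then show ?thesis unfolding eq by (simp add: algebra_simps)
qed

subsection \<open>Convergence in probability and measurability in time\<close>

text \<open>Convergence in probability gives almost sure convergence only along subsequences. For
  deterministic quantities such as expectations this suffices for the whole sequence.\<close>

lemma LIMSEQ_subseqI:
  fixes c :: "nat \<Rightarrow> real"
  assumes "\<And>r::nat\<Rightarrow>nat. strict_mono r \<Longrightarrow> \<exists>q::nat\<Rightarrow>nat. strict_mono q \<and> (\<lambda>k. c (r (q k))) \<longlonglongrightarrow> L"
  shows "c \<longlonglongrightarrow> L"
proof (rule ccontr)
  assume "\<not> c \<longlonglongrightarrow> L"
  then obtain e where e: "0 < e" "\<And>N. \<exists>n\<ge>N. \<not> norm (c n - L) < e" unfolding LIMSEQ_iff by blast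
  then have "infinite {n. \<not> norm (c n - L) < e}"
    unfolding infinite_nat_iff_unbounded_le by blast
  from infinite_enumerate[OF this] obtain r :: "nat \<Rightarrow> nat" where r: "strict_mono r" "\<And>n. r n \<in> {n. \<not> norm (c n - L) < e}"
    by auto
  obtain q where q: "strict_mono q" "(\<lambda>k. c (r (q k))) \<longlonglongrightarrow> L" using assms[OF r(1)] by auto
  then obtain N where "norm (c (r (q N)) - L) < e" using e(1) unfolding LIMSEQ_iff by blast
  then show False using r(2)[of "q N"] by simp
qed

lemma tendsto_zero_of_min1:
  fixes x :: "nat \<Rightarrow> real"
  assumes "(\<lambda>k. min 1 \<bar>x k\<bar>) \<longlonglongrightarrow> 0" shows "x \<longlonglongrightarrow> 0"
proof -
  have "\<forall>\<^sub>F k in sequentially. min 1 \<bar>x k\<bar> < 1" using assms by (rule order_tendstoD) simp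
  then have "\<forall>\<^sub>F k in sequentially. min 1 \<bar>x k\<bar> = \<bar>x k\<bar>" by eventually_elim auto
  then have "(\<lambda>k. \<bar>x k\<bar>) \<longlonglongrightarrow> 0" using assms by (simp cong: tendsto_cong)
  then show ?thesis by (simp add: tendsto_rabs_zero_iff)
qed

context prob_space
begin

lemma min1_integrable: "X \<in> borel_measurable M \<Longrightarrow> integrable M (\<lambda>\<omega>. min 1 \<bar>X \<omega> :: real\<bar>)"
  by (rule integrable_const_bound[where B=1]) auto

text \<open>The expectation of \<open>min 1 \<bar>Y - Z\<bar>\<close> metrises convergence in
  probability; in this form it can be combined with integral inequalities and dominated
  convergence.\<close>

lemma min1_of_converges_in_prob:
  assumes [measurable]: "\<And>k. Y k \<in> borel_measurable M" "Z \<in> borel_measurable M"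
    and c: "converges_in_prob M Y Z"
  shows "(\<lambda>k. \<integral>\<omega>. min 1 \<bar>Y k \<omega> - Z \<omega>\<bar> \<partial>M) \<longlonglongrightarrow> 0"
proof (rule LIMSEQ_I)
  fix e :: real assume e: "0 < e"
  define A where "A k = {\<omega>\<in>space M. \<bar>Y k \<omega> - Z \<omega>\<bar> > e / 2}" for k
  have [measurable]: "A k \<in> sets M" for k unfolding A_def by measurable
  have "(\<lambda>k. prob (A k)) \<longlonglongrightarrow> 0" using c[unfolded converges_in_prob_def, rule_format, of "e / 2"] e unfolding A_def by simp
  then have "\<forall>\<^sub>F k in sequentially. prob (A k) < e / 2" by (rule order_tendstoD) (use e in simp)
  then have "\<forall>\<^sub>F k in sequentially. norm ((\<integral>\<omega>. min 1 \<bar>Y k \<omega> - Z \<omega>\<bar> \<partial>M) - 0) < e"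
  proof eventually_elim
    case (elim k)
    have [intro]: "integrable M (indicator (A k) :: 'a \<Rightarrow> real)"
      by (rule integrable_const_bound[where B=1]) auto
    have "(\<integral>\<omega>. min 1 \<bar>Y k \<omega> - Z \<omega>\<bar> \<partial>M) \<le> (\<integral>\<omega>. e / 2 + indicator (A k) \<omega> \<partial>M)"
    proof (rule integral_mono)
      show "min 1 \<bar>Y k \<omega> - Z \<omega>\<bar> \<le> e / 2 + indicator (A k) \<omega>" if "\<omega> \<in> space M" for \<omega>
        using that e by (auto simp: A_def indicator_def min_def)
    qed (auto intro!: min1_integrable)
    also have "\<dots> = e / 2 + prob (A k)"
      by (subst Bochner_Integration.integral_add) (auto simp: prob_space emeasure_eq_measure)
    finally show ?case using elim by (simp add: integral_nonneg_AE)
  qed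
  then show "\<exists>no. \<forall>k\<ge>no. norm ((\<integral>\<omega>. min 1 \<bar>Y k \<omega> - Z \<omega>\<bar> \<partial>M) - 0) < e"
    by (simp add: eventually_sequentially)
qed

lemma min1_subseq:
  fixes X :: "nat \<Rightarrow> 'a \<Rightarrow> real"
  assumes [measurable]: "\<And>k. X k \<in> borel_measurable M" and c: "(\<lambda>k. \<integral>\<omega>. min 1 \<bar>X k \<omega>\<bar> \<partial>M) \<longlonglongrightarrow> 0"
  obtains r :: "nat \<Rightarrow> nat" where "strict_mono r" "AE \<omega> in M. (\<lambda>k. X (r k) \<omega>) \<longlonglongrightarrow> 0"
proof -
  have "\<exists>r::nat\<Rightarrow>nat. strict_mono r \<and> (AE \<omega> in M. (\<lambda>k. min 1 \<bar>X (r k) \<omega>\<bar>) \<longlonglongrightarrow> 0)"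
    by (rule tendsto_L1_AE_subseq[where u="\<lambda>k \<omega>. min 1 \<bar>X k \<omega>\<bar>"]) (use c in \<open>auto intro!: min1_integrable\<close>)
  then obtain r :: "nat \<Rightarrow> nat" where r: "strict_mono r" "AE \<omega> in M. (\<lambda>k. min 1 \<bar>X (r k) \<omega>\<bar>) \<longlonglongrightarrow> 0" by auto
  have "AE \<omega> in M. (\<lambda>k. X (r k) \<omega>) \<longlonglongrightarrow> 0" using r(2) by eventually_elim (rule tendsto_zero_of_min1)
  with r(1) show ?thesis by (rule that)
qed

lemma min1_of_AE:
  fixes X :: "nat \<Rightarrow> 'a \<Rightarrow> real"
  assumes [measurable]: "\<And>k. X k \<in> borel_measurable M" and c: "AE \<omega> in M. (\<lambda>k. X k \<omega>) \<longlonglongrightarrow> 0"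
  shows "(\<lambda>k. \<integral>\<omega>. min 1 \<bar>X k \<omega>\<bar> \<partial>M) \<longlonglongrightarrow> 0"
proof -
  have "(\<lambda>k. \<integral>\<omega>. min 1 \<bar>X k \<omega>\<bar> \<partial>M) \<longlonglongrightarrow> (\<integral>\<omega>. 0 \<partial>M)"
  proof (rule integral_dominated_convergence[where w="\<lambda>_. 1"])
    show "AE \<omega> in M. (\<lambda>k. min 1 \<bar>X k \<omega>\<bar>) \<longlonglongrightarrow> 0"
      using c
    proof eventually_elim
      case (elim \<omega>)
      have "(\<lambda>k. min 1 \<bar>X k \<omega>\<bar>) \<longlonglongrightarrow> min 1 \<bar>0\<bar>" by (intro tendsto_intros elim)
      then show ?case by simp
    qed
  qed auto
  then show ?thesis by simp
qed

end

text \<open>Processes live on times \<open>t \<ge> 0\<close>; precomposition with \<open>max 0\<close> extends them to all of \<open>real\<close>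
  so that they can be integrated against \<open>lborel\<close>.\<close>

lemma measurable_process_max:
  assumes "measurable_process M H"
  shows "(\<lambda>(t, \<omega>). H (max 0 t) \<omega>) \<in> borel_measurable (borel \<Otimes>\<^sub>M M)"
proof -
  have "(\<lambda>p::real \<times> 'a. (max 0 (fst p), snd p)) \<in> borel \<Otimes>\<^sub>M M \<rightarrow>\<^sub>M restrict_space borel {0..} \<Otimes>\<^sub>M M"
    by (intro measurable_Pair measurable_restrict_space2) auto
  from measurable_compose[OF this assms[unfolded measurable_process_def]]
  show ?thesis by (simp add: split_beta')
qed

lemma continuous_process_measurable:
  assumes cont: "continuous_process M Y" and meas: "\<And>t. 0 \<le> t \<Longrightarrow> Y t \<in> borel_measurable M"
  shows "(\<lambda>(t, \<omega>). Y (max 0 t) \<omega>) \<in> borel_measurable (borel \<Otimes>\<^sub>M M)"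
proof (rule borel_measurable_LIMSEQ_real)
  \<comment> \<open>Evaluation at the last multiple of 1 / (k + 1) before t needs only countably
    many times and converges by continuity. \<open>nat\<close> sends negative numbers to 0, which
    matches \<open>max 0 t\<close> at negative times.\<close>
  let ?f = "\<lambda>k p. Y (real (nat \<lfloor>real (Suc k) * fst p\<rfloor>) / real (Suc k)) (snd p)"
  show "?f k \<in> borel_measurable (borel \<Otimes>\<^sub>M M)" for k
  proof (rule measurable_compose_countable[where f="\<lambda>j p. Y (real j / real (Suc k)) (snd p)" and g="\<lambda>p. nat \<lfloor>real (Suc k) * fst p\<rfloor>"])
    show "(\<lambda>p. Y (real j / real (Suc k)) (snd p)) \<in> borel_measurable (borel \<Otimes>\<^sub>M M)" for j
      by (rule measurable_compose[OF measurable_snd meas]) simp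
  qed measurable
  fix p assume p: "p \<in> space ((borel :: real measure) \<Otimes>\<^sub>M M)"
  obtain t \<omega> where p': "p = (t, \<omega>)" "\<omega> \<in> space M" using p by (cases p) (auto simp: space_pair_measure)
  have c: "continuous_on {0..} (\<lambda>t. Y t \<omega>)" using cont p' by (auto simp: continuous_process_def)
  have "(\<lambda>k. real (nat \<lfloor>real (Suc k) * t\<rfloor>) / real (Suc k)) \<longlonglongrightarrow> max 0 t"
  proof (rule tendsto_sandwich[where f="\<lambda>k. max 0 t - 1 / real (Suc k)" and h="\<lambda>k. max 0 t"])
    have *: "max 0 t - 1 / c \<le> real (nat \<lfloor>c * t\<rfloor>) / c \<and> real (nat \<lfloor>c * t\<rfloor>) / c \<le> max 0 t" if c: "0 < c" for c :: real
    proof -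
      have "max 0 (c * t) = c * max 0 t" using c by (auto simp: max_def zero_le_mult_iff)
      moreover have "max 0 (c * t) - 1 \<le> real (nat \<lfloor>c * t\<rfloor>)" "real (nat \<lfloor>c * t\<rfloor>) \<le> max 0 (c * t)"
        by linarith+
      ultimately have "c * max 0 t - 1 \<le> real (nat \<lfloor>c * t\<rfloor>)" "real (nat \<lfloor>c * t\<rfloor>) \<le> max 0 t * c"
        by (simp_all add: mult.commute)
      moreover from this(1) have "(c * max 0 t - 1) / c \<le> real (nat \<lfloor>c * t\<rfloor>) / c"
        using c by (intro divide_right_mono) auto
      moreover have "(c * max 0 t - 1) / c = max 0 t - 1 / c" using c by (simp add: diff_divide_distrib)
      ultimately show ?thesis using c by (simp add: pos_divide_le_eq)
    qed
    show "\<forall>\<^sub>F k in sequentially. max 0 t - 1 / real (Suc k) \<le> real (nat \<lfloor>real (Suc k) * t\<rfloor>) / real (Suc k)"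
      "\<forall>\<^sub>F k in sequentially. real (nat \<lfloor>real (Suc k) * t\<rfloor>) / real (Suc k) \<le> max 0 t"
      using * by auto
    have "(\<lambda>k. max 0 t - 1 / real (Suc k)) \<longlonglongrightarrow> max 0 t - 0"
      by (intro tendsto_intros LIMSEQ_Suc[OF lim_1_over_n])
    then show "(\<lambda>k. max 0 t - 1 / real (Suc k)) \<longlonglongrightarrow> max 0 t" by simp
  qed simp
  then have "(\<lambda>k. Y (real (nat \<lfloor>real (Suc k) * t\<rfloor>) / real (Suc k)) \<omega>) \<longlonglongrightarrow> Y (max 0 t) \<omega>"
    by (rule continuous_on_tendsto_compose[OF c]) auto
  then show "(\<lambda>k. ?f k p) \<longlonglongrightarrow> (case p of (t, \<omega>) \<Rightarrow> Y (max 0 t) \<omega>)" using p' by simp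
qed

subsection \<open>Approximation of the volatility\<close>

lemma set_integrable_bounded:
  fixes f :: "real \<Rightarrow> real"
  assumes "f \<in> borel_measurable borel" "\<And>s. 0 < s \<Longrightarrow> s \<le> t \<Longrightarrow> \<bar>f s\<bar> \<le> K"
  shows "set_integrable lborel {0<..t} f"
  unfolding set_integrable_def
proof (rule Bochner_Integration.integrable_bound[where f="\<lambda>s. K * indicator {0<..t} s"])
  show "integrable lborel (\<lambda>s. K * indicator {0<..t} s)" by (cases "0 \<le> t") auto
  show "AE s in lborel. norm (indicat_real {0<..t} s *\<^sub>R f s) \<le> norm (K * indicator {0<..t} s)"
    using assms(2) by (intro AE_I2) (force simp: indicator_def)
qed (use assms(1) in simp)

lemma simple_process_borel_time: "(\<lambda>s. simple_process n \<tau> \<xi> s \<omega>) \<in> borel_measurable borel"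
  unfolding simple_process_def by measurable

lemma simple_process_meas_pair:
  assumes "\<And>i. i < n \<Longrightarrow> \<xi> i \<in> borel_measurable M"
  shows "(\<lambda>p. simple_process n \<tau> \<xi> (snd p) (fst p)) \<in> borel_measurable (M \<Otimes>\<^sub>M borel)"
  unfolding simple_process_def
proof (rule borel_measurable_sum)
  fix i assume "i \<in> {..<n}"
  then have [measurable]: "\<xi> i \<in> borel_measurable M" using assms by simp
  show "(\<lambda>p. \<xi> i (fst p) * indicat_real {\<tau> i<..\<tau> (Suc i)} (snd p)) \<in> borel_measurable (M \<Otimes>\<^sub>M borel)"
    by measurable
qed

lemma simple_process_abs_le: "\<bar>simple_process n \<tau> \<xi> s \<omega>\<bar> \<le> (\<Sum>i<n. \<bar>\<xi> i \<omega>\<bar>)"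
  unfolding simple_process_def by (rule order_trans[OF sum_abs]) (auto intro!: sum_mono simp: indicator_def)

lemma swap_meas: "(\<lambda>p. f (fst p) (snd p)) \<in> borel_measurable (borel \<Otimes>\<^sub>M M) \<Longrightarrow>
    (\<lambda>p. f (snd p) (fst p)) \<in> borel_measurable (M \<Otimes>\<^sub>M borel)"
  for f :: "real \<Rightarrow> 'a \<Rightarrow> real"
  using measurable_compose[of "\<lambda>p. (snd p, fst p)" "M \<Otimes>\<^sub>M borel" "borel \<Otimes>\<^sub>M M" "\<lambda>p. f (fst p) (snd p)"] by simp

lemma time_integral_meas:
  assumes "(\<lambda>p. f (snd p) (fst p)) \<in> borel_measurable (M \<Otimes>\<^sub>M (borel :: real measure))"
  shows "(\<lambda>\<omega>. LBINT s:{0<..t}. f s \<omega> :: real) \<in> borel_measurable M"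
  unfolding set_lebesgue_integral_def
proof (rule lborel.borel_measurable_lebesgue_integral)
  have "(\<lambda>p. f (snd p) (fst p)) \<in> borel_measurable (M \<Otimes>\<^sub>M lborel)"
    using assms by (simp cong: measurable_cong_sets)
  then show "(\<lambda>(\<omega>, s). indicat_real {0<..t} s *\<^sub>R f s \<omega>) \<in> borel_measurable (M \<Otimes>\<^sub>M lborel)"
    by (simp add: split_beta')
qed

text \<open>\<open>Y\<close> solves \<open>dY = r Y dt + a Y dW\<close> on \<open>[0, T]\<close>, \<open>I\<close> is the integral of \<open>a Y\<close>, and \<open>\<xi> k\<close> are the
  coefficients of simple processes that approximate \<open>a Y\<close>. Neither \<open>I\<close> nor \<open>a\<close> has to be adapted.
  Half-open domains of integration match the cells of simple processes, which vanish at time \<open>0\<close>.\<close>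

locale ito_approx = bm_filtration M F W for M :: "'a measure" and F W +
  fixes r a Y I :: "real \<Rightarrow> 'a \<Rightarrow> real" and s0 C T :: real
    and n :: "nat \<Rightarrow> nat" and \<tau> :: "nat \<Rightarrow> nat \<Rightarrow> real" and \<xi> :: "nat \<Rightarrow> nat \<Rightarrow> 'a \<Rightarrow> real"
  assumes T: "0 < T" and C: "0 \<le> C"
    and a_meas: "(\<lambda>p. a (fst p) (snd p)) \<in> borel_measurable (borel \<Otimes>\<^sub>M M)"
    and r_meas: "(\<lambda>p. r (fst p) (snd p)) \<in> borel_measurable (borel \<Otimes>\<^sub>M M)"
    and Y_meas: "(\<lambda>p. Y (fst p) (snd p)) \<in> borel_measurable (borel \<Otimes>\<^sub>M M)"
    and a_bdd: "\<And>t \<omega>. 0 \<le> t \<Longrightarrow> \<omega> \<in> space M \<Longrightarrow> \<bar>a t \<omega>\<bar> \<le> C"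
    and Y_adapted: "\<And>t. 0 \<le> t \<Longrightarrow> Y t \<in> borel_measurable (F t)"
    and Y_cont: "\<And>\<omega>. \<omega> \<in> space M \<Longrightarrow> continuous_on {0..} (\<lambda>t. Y t \<omega>)"
    and Y_pos: "\<And>t \<omega>. 0 \<le> t \<Longrightarrow> \<omega> \<in> space M \<Longrightarrow> 0 < Y t \<omega>"
    and Y0: "\<And>\<omega>. \<omega> \<in> space M \<Longrightarrow> Y 0 \<omega> = s0"
    and I_meas: "\<And>t. 0 \<le> t \<Longrightarrow> I t \<in> borel_measurable M"
    and I_cont: "\<And>\<omega>. \<omega> \<in> space M \<Longrightarrow> continuous_on {0..} (\<lambda>t. I t \<omega>)"
    and r_int: "AE \<omega> in M. set_integrable lborel {0<..T} (\<lambda>s. r s \<omega>)"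
    and sde: "AE \<omega> in M. \<forall>t. 0 \<le> t \<longrightarrow> t \<le> T \<longrightarrow> Y t \<omega> = s0 + (LBINT s:{0<..t}. r s \<omega> * Y s \<omega>) + I t \<omega>"
    and \<tau>_0: "\<And>k. \<tau> k 0 = 0" and \<tau>_n: "\<And>k. \<tau> k (n k) = T"
    and \<tau>_less: "\<And>k i. i < n k \<Longrightarrow> \<tau> k i < \<tau> k (Suc i)"
    and mesh: "\<And>k i. i < n k \<Longrightarrow> \<tau> k (Suc i) - \<tau> k i \<le> T / real (Suc k)"
    and \<xi>_meas: "\<And>k i. i < n k \<Longrightarrow> \<xi> k i \<in> borel_measurable (F (\<tau> k i))"
    and \<xi>_conv: "AE \<omega> in M. (\<lambda>k. LBINT s:{0<..T}. (simple_process (n k) (\<tau> k) (\<xi> k) s \<omega> - a s \<omega> * Y s \<omega>)\<^sup>2) \<longlonglongrightarrow> 0"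
    and I_conv: "\<And>t. 0 \<le> t \<Longrightarrow> t \<le> T \<Longrightarrow>
       (\<lambda>k. \<integral>\<omega>. min 1 \<bar>simple_integral (n k) (\<tau> k) (\<xi> k) W t \<omega> - I t \<omega>\<bar> \<partial>M) \<longlonglongrightarrow> 0"
begin

definition w :: "nat \<Rightarrow> nat \<Rightarrow> 'a \<Rightarrow> real" where "w k i \<omega> = 1 / Y (\<tau> k i) \<omega>"

text \<open>Since \<open>\<xi> k i\<close> is close to \<open>a * Y\<close> on the cell and
  \<open>Y\<close> is close to its value at the left end, the quotient is close to \<open>a\<close>.
  Clamping moves it no farther from \<open>a\<close>, because \<open>\<bar>a\<bar> \<le> C\<close>,
  and makes the coefficients bounded uniformly in the path and in \<open>k\<close>.\<close>

definition A :: "nat \<Rightarrow> nat \<Rightarrow> 'a \<Rightarrow> real" where "A k i \<omega> = max (- C) (min C (\<xi> k i \<omega> * w k i \<omega>))"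

abbreviation "HH k \<equiv> simple_process (n k) (\<tau> k) (\<xi> k)"
abbreviation "WW k \<equiv> simple_process (n k) (\<tau> k) (w k)"
abbreviation "AA k \<equiv> simple_process (n k) (\<tau> k) (A k)"

text \<open>The energy of the difference between the exact integrand \<open>a Y / Y(\<tau>\<^sub>i)\<close> and the simple one.\<close>

definition G :: "nat \<Rightarrow> 'a \<Rightarrow> real" where
  "G k \<omega> = (LBINT s:{0<..T}. (WW k s \<omega> * (a s \<omega> * Y s \<omega>) - AA k s \<omega>)\<^sup>2)"

lemma \<tau>_le: "i < n k \<Longrightarrow> \<tau> k i \<le> \<tau> k (Suc i)" using \<tau>_less by (rule less_imp_le)

lemma \<tau>_mono: "i \<le> j \<Longrightarrow> j \<le> n k \<Longrightarrow> \<tau> k i \<le> \<tau> k j"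
  by (rule grid_mono[where n="n k"]) (auto simp: \<tau>_le)

lemma \<tau>_nonneg: "i \<le> n k \<Longrightarrow> 0 \<le> \<tau> k i" using \<tau>_mono[of 0 i k] \<tau>_0[of k] by simp

lemma \<tau>_le_T: "i \<le> n k \<Longrightarrow> \<tau> k i \<le> T" using \<tau>_mono[of i "n k" k] \<tau>_n[of k] by simp

lemma cell:
  assumes "0 < s" "s \<le> T"
  obtains i where "i < n k" "\<tau> k i < s" "s \<le> \<tau> k (Suc i)"
  using grid_cell_exists[of "\<tau> k" s "n k"] assms \<tau>_0 \<tau>_n by metis

lemma process_cell:
  fixes \<zeta> :: "nat \<Rightarrow> 'a \<Rightarrow> real"
  assumes "i < n k" "\<tau> k i < s" "s \<le> \<tau> k (Suc i)"
  shows "simple_process (n k) (\<tau> k) \<zeta> s \<omega> = \<zeta> i \<omega>"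
  by (rule simple_process_cell[of "n k" "\<tau> k" i s, OF _ assms]) (rule \<tau>_le)

lemma w_meas: "i < n k \<Longrightarrow> w k i \<in> borel_measurable (F (\<tau> k i))"
  unfolding w_def using Y_adapted[OF \<tau>_nonneg[of i k]] by simp

lemma A_meas: "i < n k \<Longrightarrow> A k i \<in> borel_measurable (F (\<tau> k i))"
  unfolding A_def using w_meas[of i k] \<xi>_meas[of i k] by simp

lemma w_measM[measurable]: "i < n k \<Longrightarrow> w k i \<in> borel_measurable M"
  using w_meas by (rule measurable_F_M)

lemma A_measM[measurable]: "i < n k \<Longrightarrow> A k i \<in> borel_measurable M"
  using A_meas by (rule measurable_F_M)

lemma \<xi>_measM[measurable]: "i < n k \<Longrightarrow> \<xi> k i \<in> borel_measurable M"
  using \<xi>_meas by (rule measurable_F_M)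

lemma Y_measM: "0 \<le> t \<Longrightarrow> Y t \<in> borel_measurable M"
  using Y_adapted measurable_F_M by blast

lemma A_bdd: "\<bar>A k i \<omega>\<bar> \<le> C" unfolding A_def using C by auto

lemma AA_bdd: 
  assumes "0 < s" "s \<le> T" shows "\<bar>AA k s \<omega>\<bar> \<le> C"
  using process_cell A_bdd cell[OF assms] by metis

lemma a_time[measurable]: "\<omega> \<in> space M \<Longrightarrow> (\<lambda>s. a s \<omega>) \<in> borel_measurable borel"
  using measurable_compose[OF measurable_Pair2'[of \<omega> M borel] a_meas] by simp

lemma Y_time[measurable]: "\<omega> \<in> space M \<Longrightarrow> (\<lambda>s. Y s \<omega>) \<in> borel_measurable borel"
  using measurable_compose[OF measurable_Pair2'[of \<omega> M borel] Y_meas] by simp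

lemma AA_pair[measurable]: "(\<lambda>p. AA k (snd p) (fst p)) \<in> borel_measurable (M \<Otimes>\<^sub>M borel)"
  by (rule simple_process_meas_pair) (rule A_measM)
lemma WW_pair[measurable]: "(\<lambda>p. WW k (snd p) (fst p)) \<in> borel_measurable (M \<Otimes>\<^sub>M borel)"
  by (rule simple_process_meas_pair) (rule w_measM)
lemma HH_pair[measurable]: "(\<lambda>p. HH k (snd p) (fst p)) \<in> borel_measurable (M \<Otimes>\<^sub>M borel)"
  by (rule simple_process_meas_pair) (rule \<xi>_measM)

lemmas a_pair[measurable] = swap_meas[OF a_meas]
lemmas Y_pair[measurable] = swap_meas[OF Y_meas]
lemmas r_pair[measurable] = swap_meas[OF r_meas]

lemma G_meas[measurable]: "G k \<in> borel_measurable M"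
  unfolding G_def by (rule time_integral_meas) measurable

lemma HH_error_meas[measurable]: "(\<lambda>\<omega>. LBINT s:{0<..T}. (HH k s \<omega> - a s \<omega> * Y s \<omega>)\<^sup>2) \<in> borel_measurable M"
  by (rule time_integral_meas) measurable

lemma Y_bounds:
  assumes "\<omega> \<in> space M"
  obtains K where "0 < K" "\<And>t. 0 \<le> t \<Longrightarrow> t \<le> T \<Longrightarrow> Y t \<omega> \<le> K" "\<And>t. 0 \<le> t \<Longrightarrow> t \<le> T \<Longrightarrow> 1 / Y t \<omega> \<le> K"
proof -
  have c: "continuous_on {0..T} (\<lambda>t. Y t \<omega>)" using Y_cont[OF assms] by (rule continuous_on_subset) auto
  have c': "continuous_on {0..T} (\<lambda>t. 1 / Y t \<omega>)" using Y_pos[OF _ assms] by (intro continuous_intros c) force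
  obtain K1 where K1: "\<And>t. t \<in> {0..T} \<Longrightarrow> Y t \<omega> \<le> K1"
    using continuous_attains_sup[OF _ _ c] T by fastforce
  obtain K2 where K2: "\<And>t. t \<in> {0..T} \<Longrightarrow> 1 / Y t \<omega> \<le> K2"
    using continuous_attains_sup[OF _ _ c'] T by fastforce
  show ?thesis
  proof (rule that[of "max 1 (max K1 K2)"])
    fix t assume "0 \<le> t" "t \<le> T"
    then show "Y t \<omega> \<le> max 1 (max K1 K2)" "1 / Y t \<omega> \<le> max 1 (max K1 K2)"
      using K1[of t] K2[of t] by auto
  qed auto
qed

lemma uniform_modulus:
  fixes f :: "real \<Rightarrow> real"
  assumes "continuous_on {0..} f" "0 < \<eta>"
  obtains d where "0 < d" "\<And>s s'. 0 \<le> s \<Longrightarrow> s \<le> T \<Longrightarrow> 0 \<le> s' \<Longrightarrow> s' \<le> T \<Longrightarrow> \<bar>s - s'\<bar> < d \<Longrightarrow> \<bar>f s - f s'\<bar> < \<eta>"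
proof -
  have "continuous_on {0..T} f" using assms(1) by (rule continuous_on_subset) auto
  then have "uniformly_continuous_on {0..T} f" by (intro compact_uniformly_continuous) auto
  then obtain d where "0 < d" "\<forall>x\<in>{0..T}. \<forall>x'\<in>{0..T}. dist x' x < d \<longrightarrow> dist (f x') (f x) < \<eta>"
    using assms(2) unfolding uniformly_continuous_on_def by blast
  then show ?thesis by (intro that[of d]) (auto simp: dist_real_def)
qed

lemma mesh_eventually:
  assumes "0 < d"
  shows "\<forall>\<^sub>F k in sequentially. \<forall>i<n k. \<tau> k (Suc i) - \<tau> k i < d"
proof -
  have "(\<lambda>k. T * (1 / real (Suc k))) \<longlonglongrightarrow> T * 0"
    by (intro tendsto_mult tendsto_const LIMSEQ_Suc[OF lim_1_over_n])
  then have "\<forall>\<^sub>F k in sequentially. T * (1 / real (Suc k)) < d"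
    by (rule order_tendstoD(2)) (use assms in simp)
  then show ?thesis by eventually_elim (use mesh in fastforce)
qed

lemma Y_ratio:
  assumes \<omega>: "\<omega> \<in> space M" and "0 < \<eta>"
  obtains d where "0 < d" "\<And>s s'. 0 \<le> s \<Longrightarrow> s \<le> T \<Longrightarrow> 0 \<le> s' \<Longrightarrow> s' \<le> T \<Longrightarrow> \<bar>s - s'\<bar> < d \<Longrightarrow> \<bar>Y s \<omega> / Y s' \<omega> - 1\<bar> \<le> \<eta>"
proof -
  obtain K where K: "0 < K" "\<And>t. 0 \<le> t \<Longrightarrow> t \<le> T \<Longrightarrow> 1 / Y t \<omega> \<le> K" by (rule Y_bounds[OF \<omega>]) blast
  obtain d where d: "0 < d" "\<And>s s'. 0 \<le> s \<Longrightarrow> s \<le> T \<Longrightarrow> 0 \<le> s' \<Longrightarrow> s' \<le> T \<Longrightarrow> \<bar>s - s'\<bar> < d \<Longrightarrow> \<bar>Y s \<omega> - Y s' \<omega>\<bar> < \<eta> / K"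
    by (rule uniform_modulus[OF Y_cont[OF \<omega>], of "\<eta> / K"]) (use assms K in auto)
  show ?thesis
  proof (rule that[OF d(1)])
    fix s s' assume s: "0 \<le> s" "s \<le> T" "0 \<le> s'" "s' \<le> T" "\<bar>s - s'\<bar> < d"
    have p: "0 < Y s' \<omega>" using Y_pos \<omega> s by auto
    have "Y s \<omega> / Y s' \<omega> - 1 = (Y s \<omega> - Y s' \<omega>) * (1 / Y s' \<omega>)"
      using p by (simp add: field_simps)
    then have "\<bar>Y s \<omega> / Y s' \<omega> - 1\<bar> = \<bar>Y s \<omega> - Y s' \<omega>\<bar> * (1 / Y s' \<omega>)"
      using p by (simp add: abs_mult)
    also have "\<dots> \<le> (\<eta> / K) * K"
      using d(2)[OF s] K(2)[of s'] s p assms K(1) by (intro mult_mono) auto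
    finally show "\<bar>Y s \<omega> / Y s' \<omega> - 1\<bar> \<le> \<eta>" using K(1) by simp
  qed
qed

text \<open>There are two sources of error: freezing \<open>Y\<close> at the left end of a cell
  costs C \<eta>, and the error D of the approximating process is magnified by at most the bound K
  on 1 / Y. The worse of the two differences is at most 2 C \<eta> + D K, and (x + y)^2 \<le> 2 x^2
  + 2 y^2 gives the stated constants. Both K and the index from which the bound holds depend on the
  path.\<close>

lemma clamp_error:
  assumes \<omega>: "\<omega> \<in> space M" and \<eta>: "0 < \<eta>" 
    and K: "0 < K" "\<forall>t. 0 \<le> t \<longrightarrow> t \<le> T \<longrightarrow> 1 / Y t \<omega> \<le> K"
  shows "\<forall>\<^sub>F k in sequentially. \<forall>s. 0 < s \<longrightarrow> s \<le> T \<longrightarrow>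
     (WW k s \<omega> * (a s \<omega> * Y s \<omega>) - AA k s \<omega>)\<^sup>2 \<le> 8 * C\<^sup>2 * \<eta>\<^sup>2 + 2 * K\<^sup>2 * (HH k s \<omega> - a s \<omega> * Y s \<omega>)\<^sup>2
   \<and> (AA k s \<omega> - a s \<omega>)\<^sup>2 \<le> 8 * C\<^sup>2 * \<eta>\<^sup>2 + 2 * K\<^sup>2 * (HH k s \<omega> - a s \<omega> * Y s \<omega>)\<^sup>2"
proof -
  obtain d where d: "0 < d" "\<And>s s'. 0 \<le> s \<Longrightarrow> s \<le> T \<Longrightarrow> 0 \<le> s' \<Longrightarrow> s' \<le> T \<Longrightarrow> \<bar>s - s'\<bar> < d \<Longrightarrow> \<bar>Y s \<omega> / Y s' \<omega> - 1\<bar> \<le> \<eta>"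
    using Y_ratio[OF \<omega> \<eta>] by metis
  from mesh_eventually[OF d(1)] show ?thesis
  proof eventually_elim
    case (elim k)
    show ?case
    proof (intro allI impI)
      fix s assume s: "0 < s" "s \<le> T"
      obtain i where i: "i < n k" "\<tau> k i < s" "s \<le> \<tau> k (Suc i)" by (rule cell[OF s])
      note c = process_cell[OF i]
      have \<tau>: "0 \<le> \<tau> k i" "\<tau> k i \<le> T" using \<tau>_nonneg[of i k] \<tau>_le_T[of i k] i by auto
      have near: "\<bar>Y s \<omega> / Y (\<tau> k i) \<omega> - 1\<bar> \<le> \<eta>"
        using d(2)[of s "\<tau> k i"] elim i s \<tau> by fastforce
      have ab: "\<bar>a s \<omega>\<bar> \<le> C" using a_bdd[of s \<omega>] s \<omega> by simp
      define z where "z = w k i \<omega> * (a s \<omega> * Y s \<omega>)"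
      define D where "D = \<bar>\<xi> k i \<omega> - a s \<omega> * Y s \<omega>\<bar>"
      have "z - a s \<omega> = a s \<omega> * (Y s \<omega> / Y (\<tau> k i) \<omega> - 1)" by (simp add: z_def w_def field_simps)
      then have 1: "\<bar>z - a s \<omega>\<bar> \<le> C * \<eta>" using ab near \<eta> by (simp add: abs_mult mult_mono)
      have w: "0 \<le> w k i \<omega>" "w k i \<omega> \<le> K" unfolding w_def using K(2) \<tau> Y_pos[OF \<tau>(1) \<omega>] by auto
      have "\<xi> k i \<omega> * w k i \<omega> - z = (\<xi> k i \<omega> - a s \<omega> * Y s \<omega>) * w k i \<omega>"
        by (simp add: z_def algebra_simps)
      then have "\<bar>\<xi> k i \<omega> * w k i \<omega> - z\<bar> = D * w k i \<omega>"
        unfolding D_def using w(1) by (simp add: abs_mult)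
      also have "\<dots> \<le> D * K" using w(2) by (intro mult_left_mono) (auto simp: D_def)
      finally have 2: "\<bar>\<xi> k i \<omega> * w k i \<omega> - z\<bar> \<le> D * K" .
      have 3: "\<bar>A k i \<omega> - a s \<omega>\<bar> \<le> \<bar>\<xi> k i \<omega> * w k i \<omega> - a s \<omega>\<bar>"
        unfolding A_def using ab by (auto simp: max_def min_def)
      have 4: "\<bar>A k i \<omega> - a s \<omega>\<bar> \<le> C * \<eta> + D * K" using 1 2 3 by linarith
      have 5: "\<bar>z - A k i \<omega>\<bar> \<le> 2 * (C * \<eta>) + D * K" using 1 4 by linarith
      have DK: "0 \<le> D * K" "0 \<le> C * \<eta>" using K(1) C \<eta> by (auto simp: D_def)
      have sq: "x\<^sup>2 \<le> 8 * C\<^sup>2 * \<eta>\<^sup>2 + 2 * K\<^sup>2 * D\<^sup>2" if "\<bar>x\<bar> \<le> 2 * (C * \<eta>) + D * K" for x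
      proof -
        have "x\<^sup>2 \<le> (2 * (C * \<eta>) + D * K)\<^sup>2" using that DK by (simp add: abs_le_square_iff[symmetric])
        also have "\<dots> \<le> 2 * (2 * (C * \<eta>))\<^sup>2 + 2 * (D * K)\<^sup>2"
          using sum_squares_bound[of "2 * (C * \<eta>)" "D * K"] by (simp add: power2_sum)
        finally show ?thesis by (simp add: power_mult_distrib algebra_simps)
      qed
      have D2: "D\<^sup>2 = (HH k s \<omega> - a s \<omega> * Y s \<omega>)\<^sup>2" unfolding D_def c by simp
      show "(WW k s \<omega> * (a s \<omega> * Y s \<omega>) - AA k s \<omega>)\<^sup>2 \<le> 8 * C\<^sup>2 * \<eta>\<^sup>2 + 2 * K\<^sup>2 * (HH k s \<omega> - a s \<omega> * Y s \<omega>)\<^sup>2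
   \<and> (AA k s \<omega> - a s \<omega>)\<^sup>2 \<le> 8 * C\<^sup>2 * \<eta>\<^sup>2 + 2 * K\<^sup>2 * (HH k s \<omega> - a s \<omega> * Y s \<omega>)\<^sup>2"
        using sq[of "z - A k i \<omega>"] sq[of "A k i \<omega> - a s \<omega>"] 4 5 DK unfolding D2[symmetric] unfolding c z_def by auto
    qed
  qed
qed

lemma HH_error_integrable:
  assumes \<omega>: "\<omega> \<in> space M"
  shows "set_integrable lborel {0<..T} (\<lambda>s. (HH k s \<omega> - a s \<omega> * Y s \<omega>)\<^sup>2)"
proof -
  obtain K where K: "0 < K" "\<And>t. 0 \<le> t \<Longrightarrow> t \<le> T \<Longrightarrow> Y t \<omega> \<le> K" by (rule Y_bounds[OF \<omega>]) blast
  have [measurable]: "(\<lambda>s. HH k s \<omega>) \<in> borel_measurable borel" by (rule simple_process_borel_time)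
  note [measurable] = a_time[OF \<omega>] Y_time[OF \<omega>]
  show ?thesis
  proof (rule set_integrable_bounded[where K="((\<Sum>i<n k. \<bar>\<xi> k i \<omega>\<bar>) + C * K)\<^sup>2"])
    fix s assume s: "0 < s" "s \<le> T"
    have "\<bar>a s \<omega> * Y s \<omega>\<bar> \<le> C * K"
      unfolding abs_mult using a_bdd[of s \<omega>] K(2)[of s] Y_pos[of s \<omega>] s \<omega> C by (intro mult_mono) auto
    then have "\<bar>HH k s \<omega> - a s \<omega> * Y s \<omega>\<bar> \<le> (\<Sum>i<n k. \<bar>\<xi> k i \<omega>\<bar>) + C * K"
      using simple_process_abs_le[of "n k" "\<tau> k" "\<xi> k" s \<omega>] by linarith
    then show "\<bar>(HH k s \<omega> - a s \<omega> * Y s \<omega>)\<^sup>2\<bar> \<le> ((\<Sum>i<n k. \<bar>\<xi> k i \<omega>\<bar>) + C * K)\<^sup>2"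
      unfolding abs_power2 power2_abs[symmetric, of "HH k s \<omega> - a s \<omega> * Y s \<omega>"] by (rule power_mono) simp
  qed measurable
qed

text \<open>The constant contributes at most \<eta> T and the multiple of the approximation error
  tends to zero. Since \<eta> is fixed first, the factor B may depend on it;
  \<open>AA_tendsto\<close> relies on this.\<close>

lemma integral_squeeze:
  fixes f :: "nat \<Rightarrow> real \<Rightarrow> real"
  assumes \<omega>: "\<omega> \<in> space M" and lim: "(\<lambda>k. LBINT s:{0<..T}. (HH k s \<omega> - a s \<omega> * Y s \<omega>)\<^sup>2) \<longlonglongrightarrow> 0"
    and nonneg: "\<And>k s. 0 \<le> f k s"
    and bd: "\<And>\<eta>. 0 < \<eta> \<Longrightarrow> \<exists>B\<ge>0. \<forall>\<^sub>F k in sequentially. \<forall>s. 0 < s \<longrightarrow> s \<le> T \<longrightarrow>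
       f k s \<le> \<eta> + B * (HH k s \<omega> - a s \<omega> * Y s \<omega>)\<^sup>2"
  shows "(\<lambda>k. LBINT s:{0<..T}. f k s) \<longlonglongrightarrow> 0"
proof (rule LIMSEQ_I)
  fix e :: real assume e: "0 < e"
  define \<eta> where "\<eta> = e / (2 * T)"
  have \<eta>: "0 < \<eta>" using e T by (simp add: \<eta>_def)
  obtain B where B: "0 \<le> B" "\<forall>\<^sub>F k in sequentially. \<forall>s. 0 < s \<longrightarrow> s \<le> T \<longrightarrow>
       f k s \<le> \<eta> + B * (HH k s \<omega> - a s \<omega> * Y s \<omega>)\<^sup>2" using bd[OF \<eta>] by auto
  have "(\<lambda>k. B * (LBINT s:{0<..T}. (HH k s \<omega> - a s \<omega> * Y s \<omega>)\<^sup>2)) \<longlonglongrightarrow> B * 0"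
    by (intro tendsto_mult tendsto_const lim)
  then have "\<forall>\<^sub>F k in sequentially. B * (LBINT s:{0<..T}. (HH k s \<omega> - a s \<omega> * Y s \<omega>)\<^sup>2) < e / 2"
    by (rule order_tendstoD(2)) (use e in simp)
  with B(2) have "\<forall>\<^sub>F k in sequentially. norm ((LBINT s:{0<..T}. f k s) - 0) < e"
  proof eventually_elim
    case (elim k)
    let ?g = "\<lambda>s. \<eta> + B * (HH k s \<omega> - a s \<omega> * Y s \<omega>)\<^sup>2"
    have c: "set_integrable lborel {0<..T} (\<lambda>s. \<eta>)"
      by (rule set_integrable_bounded[where K="\<bar>\<eta>\<bar>"]) auto
    have hint: "set_integrable lborel {0<..T} (\<lambda>s. B * (HH k s \<omega> - a s \<omega> * Y s \<omega>)\<^sup>2)"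
      using HH_error_integrable[OF \<omega>, of k] by simp
    have gint: "set_integrable lborel {0<..T} ?g"
      by (rule set_integral_add(1)[OF c hint])
    have "(LBINT s:{0<..T}. f k s) \<le> (LBINT s:{0<..T}. ?g s)"
      unfolding set_lebesgue_integral_def
    proof (rule integral_mono'[OF gint[unfolded set_integrable_def]])
      fix s :: real
      show "indicat_real {0<..T} s *\<^sub>R f k s \<le> indicat_real {0<..T} s *\<^sub>R ?g s"
        using elim(1) by (auto simp: indicator_def)
      show "0 \<le> indicat_real {0<..T} s *\<^sub>R ?g s" using B(1) \<eta> by (auto simp: indicator_def)
    qed
    also have "\<dots> = \<eta> * T + B * (LBINT s:{0<..T}. (HH k s \<omega> - a s \<omega> * Y s \<omega>)\<^sup>2)"
      unfolding set_integral_add(2)[OF c hint] using T by (simp add: set_lebesgue_integral_def)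
    also have "\<dots> < e" using elim(2) T by (simp add: \<eta>_def)
    finally have "(LBINT s:{0<..T}. f k s) < e" .
    moreover have "0 \<le> (LBINT s:{0<..T}. f k s)"
      unfolding set_lebesgue_integral_def using nonneg by (intro integral_nonneg_AE) auto
    ultimately show ?case by simp
  qed
  then show "\<exists>no. \<forall>k\<ge>no. norm ((LBINT s:{0<..T}. f k s) - 0) < e" by (simp add: eventually_sequentially)
qed

lemma small_square_exists: "0 < e \<Longrightarrow> \<exists>\<eta>>0. K * \<eta>\<^sup>2 \<le> e" for K e :: real
proof -
  assume e: "0 < e"
  show ?thesis
  proof (intro exI conjI)
    let ?h = "sqrt (e / (\<bar>K\<bar> + 1))"
    show "0 < ?h" using e by (simp add: add_nonneg_pos)
    have "K * ?h\<^sup>2 \<le> \<bar>K\<bar> * (e / (\<bar>K\<bar> + 1))" using e by (simp add: mult_right_mono del: times_divide_eq_right)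
    also have "\<dots> \<le> e" using e by (simp add: field_simps)
    finally show "K * ?h\<^sup>2 \<le> e" .
  qed
qed

lemma G_tendsto: "AE \<omega> in M. (\<lambda>k. G k \<omega>) \<longlonglongrightarrow> 0"
  using \<xi>_conv AE_space
proof eventually_elim
  case (elim \<omega>)
  obtain K where K: "0 < K" "\<forall>t. 0 \<le> t \<longrightarrow> t \<le> T \<longrightarrow> 1 / Y t \<omega> \<le> K" by (rule Y_bounds[OF elim(2)]) blast
  show ?case unfolding G_def
  proof (rule integral_squeeze[OF elim(2,1)])
    fix e :: real assume "0 < e"
    then obtain \<eta> where "0 < \<eta>" "8 * C\<^sup>2 * \<eta>\<^sup>2 \<le> e" using small_square_exists by blast
    then show "\<exists>B\<ge>0. \<forall>\<^sub>F k in sequentially. \<forall>s. 0 < s \<longrightarrow> s \<le> T \<longrightarrow>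
       (WW k s \<omega> * (a s \<omega> * Y s \<omega>) - AA k s \<omega>)\<^sup>2 \<le> e + B * (HH k s \<omega> - a s \<omega> * Y s \<omega>)\<^sup>2"
      using clamp_error[OF elim(2) _ K, of \<eta>]
      by (intro exI[of _ "2 * K\<^sup>2"] conjI) (auto elim!: eventually_mono intro: order_trans)
  qed simp
qed

text \<open>The difference of the squares is at most 2 C times the difference of the coefficients,
  whereas \<open>clamp_error\<close> controls the squared difference. The inequality \<bar>x\<bar>
  \<le> c + x^2 / c passes from one to the other.\<close>

lemma AA_tendsto: "AE \<omega> in M. (\<lambda>k. LBINT s:{0<..T}. \<bar>(AA k s \<omega>)\<^sup>2 - (a s \<omega>)\<^sup>2\<bar>) \<longlonglongrightarrow> 0"
  using \<xi>_conv AE_space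
proof eventually_elim
  case (elim \<omega>)
  obtain K where K: "0 < K" "\<forall>t. 0 \<le> t \<longrightarrow> t \<le> T \<longrightarrow> 1 / Y t \<omega> \<le> K" by (rule Y_bounds[OF elim(2)]) blast
  have *: "(\<lambda>k. LBINT s:{0<..T}. indicator {0<..T} s * \<bar>(AA k s \<omega>)\<^sup>2 - (a s \<omega>)\<^sup>2\<bar>) \<longlonglongrightarrow> 0"
  proof (rule integral_squeeze[OF elim(2,1)])
    fix e :: real assume e: "0 < e"
    \<comment> \<open>Chosen so that the constant part 2 C c takes at most e / 2; the summand 1
      keeps the denominator positive for C = 0. The other e / 2 is left for the term with \<eta>,
      which is picked after \<open>c\<close>.\<close>
    define c where "c = e / (4 * C + 1)"
    have c: "0 < c" "2 * C * c \<le> e / 2" using e C by (auto simp: c_def field_simps add_nonneg_pos)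
    have "0 < e * c" using e c by simp
    from small_square_exists[OF this, of "2 * (2 * C + 1) * (8 * C\<^sup>2)"]
    obtain \<eta> where \<eta>: "0 < \<eta>" "2 * (2 * C + 1) * (8 * C\<^sup>2) * \<eta>\<^sup>2 \<le> e * c" by auto
    have "\<forall>\<^sub>F k in sequentially. \<forall>s. 0 < s \<longrightarrow> s \<le> T \<longrightarrow>
        indicator {0<..T} s * \<bar>(AA k s \<omega>)\<^sup>2 - (a s \<omega>)\<^sup>2\<bar> \<le> e + (2 * C + 1) / c * (2 * K\<^sup>2) * (HH k s \<omega> - a s \<omega> * Y s \<omega>)\<^sup>2"
      using clamp_error[OF elim(2) \<eta>(1) K]
    proof eventually_elim
      case (elim k)
      show ?case
      proof (intro allI impI)
        fix s assume s: "0 < s" "s \<le> T"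
        let ?x = "AA k s \<omega> - a s \<omega>" and ?D = "(HH k s \<omega> - a s \<omega> * Y s \<omega>)\<^sup>2"
        have "\<bar>AA k s \<omega> + a s \<omega>\<bar> \<le> 2 * C"
          using AA_bdd[OF s, of k \<omega>] a_bdd[of s \<omega>] s \<open>\<omega> \<in> space M\<close> by linarith
        then have "\<bar>(AA k s \<omega>)\<^sup>2 - (a s \<omega>)\<^sup>2\<bar> \<le> 2 * C * \<bar>?x\<bar>"
          by (simp add: power2_eq_square square_diff_square_factored abs_mult mult_right_mono)
        also have "\<dots> \<le> 2 * C * (c + ?x\<^sup>2 / c)"
        proof (rule mult_left_mono)
          have "2 * (c * \<bar>?x\<bar>) \<le> c\<^sup>2 + ?x\<^sup>2" using sum_squares_bound[of c "\<bar>?x\<bar>"] by (simp add: mult.assoc)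
          moreover have "0 \<le> c * \<bar>?x\<bar>" using c(1) by simp
          ultimately have "c * \<bar>?x\<bar> \<le> c\<^sup>2 + ?x\<^sup>2" by linarith
          then show "\<bar>?x\<bar> \<le> c + ?x\<^sup>2 / c" using c(1) by (simp add: field_simps power2_eq_square)
        qed (use C in simp)
        also have "\<dots> \<le> e / 2 + (2 * C + 1) / c * ?x\<^sup>2"
        proof -
          have "0 \<le> ?x\<^sup>2 / c" using c(1) by simp
          moreover have "(2 * C + 1) / c * ?x\<^sup>2 = 2 * C * (?x\<^sup>2 / c) + ?x\<^sup>2 / c" using c(1) by (simp add: field_simps)
          moreover have "2 * C * (c + ?x\<^sup>2 / c) = 2 * C * c + 2 * C * (?x\<^sup>2 / c)" by (simp only: distrib_left)
          ultimately show ?thesis using c(2) by linarith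
        qed
        also have "\<dots> \<le> e / 2 + (2 * C + 1) / c * (8 * C\<^sup>2 * \<eta>\<^sup>2 + 2 * K\<^sup>2 * ?D)"
          using elim s c C by (intro add_left_mono mult_left_mono) auto
        also have "\<dots> = e / 2 + ((2 * C + 1) * (8 * C\<^sup>2) * \<eta>\<^sup>2) / c + (2 * C + 1) / c * (2 * K\<^sup>2) * ?D"
          by (simp add: algebra_simps add_divide_distrib)
        also have "((2 * C + 1) * (8 * C\<^sup>2) * \<eta>\<^sup>2) / c \<le> e / 2"
          using \<eta>(2) c(1) by (simp add: field_simps)
        finally show "indicator {0<..T} s * \<bar>(AA k s \<omega>)\<^sup>2 - (a s \<omega>)\<^sup>2\<bar> \<le> e + (2 * C + 1) / c * (2 * K\<^sup>2) * ?D"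
          using s by simp
      qed
    qed
    then show "\<exists>B\<ge>0. \<forall>\<^sub>F k in sequentially. \<forall>s. 0 < s \<longrightarrow> s \<le> T \<longrightarrow>
       indicator {0<..T} s * \<bar>(AA k s \<omega>)\<^sup>2 - (a s \<omega>)\<^sup>2\<bar> \<le> e + B * (HH k s \<omega> - a s \<omega> * Y s \<omega>)\<^sup>2"
      using c(1) C by (intro exI[of _ "(2 * C + 1) / c * (2 * K\<^sup>2)"] conjI) auto
  qed (simp add: indicator_def)
  have "(LBINT s:{0<..T}. indicator {0<..T} s * \<bar>(AA k s \<omega>)\<^sup>2 - (a s \<omega>)\<^sup>2\<bar>) = (LBINT s:{0<..T}. \<bar>(AA k s \<omega>)\<^sup>2 - (a s \<omega>)\<^sup>2\<bar>)" for k
    unfolding set_lebesgue_integral_def by (intro Bochner_Integration.integral_cong) (auto simp: indicator_def)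
  with * show ?case by simp
qed

end

section \<open>Mean-square error of the discrete quadratic variation\<close>

context bm_filtration
begin

lemma simple_integral_meas:
  assumes "\<And>i. i < N \<Longrightarrow> \<zeta> i \<in> borel_measurable M" "\<And>i. i \<le> N \<Longrightarrow> 0 \<le> \<theta> i" "0 \<le> t"
  shows "simple_integral N \<theta> \<zeta> W t \<in> borel_measurable M"
  unfolding simple_integral_def
  by (intro borel_measurable_sum borel_measurable_times borel_measurable_diff W_measurable assms) (auto intro!: assms)

text \<open>Different terms \<open>D i\<close> are orthogonal: the centred square of the later
  increment has mean zero, and everything else in the product is known at its left end. Only the
  diagonal remains, with the variance 2 (p (Suc i) - p i)^2 of the squared Gaussian
  increment.\<close>

lemma quadratic_variation_error:
  fixes Z :: "nat \<Rightarrow> 'a \<Rightarrow> real"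
  assumes p0: "0 \<le> p 0" and p: "\<And>i. i < N \<Longrightarrow> p i \<le> p (Suc i)"
    and Z: "\<And>i. i < N \<Longrightarrow> Z i \<in> borel_measurable (F (p i))" and B: "\<And>i \<omega>. i < N \<Longrightarrow> \<bar>Z i \<omega>\<bar> \<le> B"
  defines "D \<equiv> \<lambda>i \<omega>. Z i \<omega> * ((W (p (Suc i)) \<omega> - W (p i) \<omega>)\<^sup>2 - (p (Suc i) - p i))"
  shows "integrable M (\<lambda>\<omega>. (\<Sum>i<N. D i \<omega>)\<^sup>2)"
    and "(\<integral>\<omega>. (\<Sum>i<N. D i \<omega>)\<^sup>2 \<partial>M) \<le> (\<Sum>i<N. B\<^sup>2 * (2 * (p (Suc i) - p i)\<^sup>2))"
proof -
  define g where "g i x = x\<^sup>2 - (p (Suc i) - p i)" for i and x :: real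
  define \<Delta> where "\<Delta> i \<omega> = W (p (Suc i)) \<omega> - W (p i) \<omega>" for i \<omega>
  have D: "D i \<omega> = Z i \<omega> * g i (\<Delta> i \<omega>)" for i \<omega> by (simp add: D_def g_def \<Delta>_def)
  have pnn: "0 \<le> p i" if "i \<le> N" for i using grid_mono[of N p 0 i, OF p] p0 that by simp
  have ZM: "Z i \<in> borel_measurable M" if "i < N" for i using Z[OF that] by (rule measurable_F_M)
  have gm[measurable]: "g i \<in> borel_measurable borel" for i unfolding g_def by measurable
  have \<Delta>F: "\<Delta> i \<in> borel_measurable (F t)" if "i < N" "p (Suc i) \<le> t" for i t
    unfolding \<Delta>_def using W_measurable_F'[of "p (Suc i)" t] W_measurable_F'[of "p i" t] pnn[of i] pnn[of "Suc i"] p[OF that(1)] that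
    by auto
  have \<Delta>M: "\<Delta> i \<in> borel_measurable M" if "i < N" for i
    using measurable_F_M[OF \<Delta>F[OF that order_refl]] .
  have mom: "integrable M (\<lambda>\<omega>. g i (\<Delta> i \<omega>))" "(\<integral>\<omega>. g i (\<Delta> i \<omega>) \<partial>M) = 0" 
    "integrable M (\<lambda>\<omega>. (g i (\<Delta> i \<omega>))\<^sup>2)" "(\<integral>\<omega>. (g i (\<Delta> i \<omega>))\<^sup>2 \<partial>M) = 2 * (p (Suc i) - p i)\<^sup>2" if "i < N" for i
  proof -
    note m = W_increment_moments[OF pnn[OF less_imp_le[OF that]] p[OF that], folded \<Delta>_def]
    show "integrable M (\<lambda>\<omega>. g i (\<Delta> i \<omega>))" "(\<integral>\<omega>. g i (\<Delta> i \<omega>) \<partial>M) = 0"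
      unfolding g_def using m(1)[of 2] m(3) by (auto simp: prob_space)
    have "(\<lambda>\<omega>. (g i (\<Delta> i \<omega>))\<^sup>2) = (\<lambda>\<omega>. (\<Delta> i \<omega>)^4 - 2 * (p (Suc i) - p i) * (\<Delta> i \<omega>)\<^sup>2 + (p (Suc i) - p i)\<^sup>2)"
      unfolding g_def by (auto simp: power2_eq_square power4_eq_xxxx algebra_simps)
    then show "integrable M (\<lambda>\<omega>. (g i (\<Delta> i \<omega>))\<^sup>2)" using m(1)[of 2] m(1)[of 4] by auto
    show "(\<integral>\<omega>. (g i (\<Delta> i \<omega>))\<^sup>2 \<partial>M) = 2 * (p (Suc i) - p i)\<^sup>2"
      using m(4) by (simp add: g_def)
  qed
  have Z2: "(Z i \<omega>)\<^sup>2 \<le> B\<^sup>2" if "i < N" for i \<omega>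
    using power_mono[OF B[OF that, of \<omega>], of 2] by simp
  have Z2int: "integrable M (\<lambda>\<omega>. (Z i \<omega>)\<^sup>2)" if "i < N" for i
    using Z2[OF that] ZM[OF that] by (intro integrable_const_bound[where B="B\<^sup>2"]) auto
  have diag: "integrable M (\<lambda>\<omega>. D i \<omega> * D i \<omega>) \<and> (\<integral>\<omega>. D i \<omega> * D i \<omega> \<partial>M) \<le> B\<^sup>2 * (2 * (p (Suc i) - p i)\<^sup>2)" if i: "i < N" for i
  proof -
    have e: "(\<lambda>\<omega>. D i \<omega> * D i \<omega>) = (\<lambda>\<omega>. (Z i \<omega>)\<^sup>2 * (g i (\<Delta> i \<omega>))\<^sup>2)" by (auto simp: D power2_eq_square)
    have ZF: "(\<lambda>\<omega>. (Z i \<omega>)\<^sup>2) \<in> borel_measurable (F (p i))" using Z[OF i] by simp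
    note w = W_increment_mult[OF pnn[OF less_imp_le[OF i]] p[OF i] ZF Z2int[OF i], of "\<lambda>x. (g i x)\<^sup>2", folded \<Delta>_def, OF _ mom(3)[OF i]]
    have "(\<integral>\<omega>. (Z i \<omega>)\<^sup>2 \<partial>M) \<le> (\<integral>\<omega>. B\<^sup>2 \<partial>M)" using Z2[OF i] Z2int[OF i] by (intro integral_mono) auto
    then have "(\<integral>\<omega>. (Z i \<omega>)\<^sup>2 \<partial>M) \<le> B\<^sup>2" by (simp add: prob_space)
    then show ?thesis unfolding e using w mom(4)[OF i] by (auto intro!: mult_right_mono)
  qed
  have off': "integrable M (\<lambda>\<omega>. D i \<omega> * D j \<omega>) \<and> (\<integral>\<omega>. D i \<omega> * D j \<omega> \<partial>M) = 0" if "i < j" "j < N" for i j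
  proof -
    have i: "i < N" and ij: "p (Suc i) \<le> p j" "p i \<le> p j" 
      using that grid_mono[of N p "Suc i" j, OF p] grid_mono[of N p i j, OF p] by auto
    let ?f = "\<lambda>\<omega>. Z j \<omega> * (Z i \<omega> * g i (\<Delta> i \<omega>))"
    have "?f \<in> borel_measurable (F (p j))"
      using Z[OF that(2)] measurable_F_mono[OF Z[OF i] ij(2)] measurable_compose[OF \<Delta>F[OF i ij(1)] gm[of i]] by auto
    moreover have "integrable M ?f"
      by (rule integrable_bounded_mult[OF integrable_bounded_mult[OF mom(1)[OF i] ZM[OF i] B[OF i]] ZM[OF that(2)] B[OF that(2)]])
    ultimately have "integrable M (\<lambda>\<omega>. ?f \<omega> * g j (\<Delta> j \<omega>))" "(\<integral>\<omega>. ?f \<omega> * g j (\<Delta> j \<omega>) \<partial>M) = 0"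
      using W_increment_mult[OF pnn[OF less_imp_le[OF that(2)]] p[OF that(2)], of ?f "g j", folded \<Delta>_def] mom(1,2)[OF that(2)]
      by auto
    moreover have "(\<lambda>\<omega>. ?f \<omega> * g j (\<Delta> j \<omega>)) = (\<lambda>\<omega>. D i \<omega> * D j \<omega>)" by (auto simp: D)
    ultimately show ?thesis by simp
  qed
  have off: "integrable M (\<lambda>\<omega>. D i \<omega> * D j \<omega>) \<and> (\<integral>\<omega>. D i \<omega> * D j \<omega> \<partial>M) = 0" if "i \<noteq> j" "i < N" "j < N" for i j
    using off'[of i j] off'[of j i] that by (cases "i < j") (auto simp: mult.commute)
  have all: "integrable M (\<lambda>\<omega>. D i \<omega> * D j \<omega>)" if "i < N" "j < N" for i j
    using off[of i j] diag[of i] that by (cases "i = j") auto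
  have e: "(\<lambda>\<omega>. (\<Sum>i<N. D i \<omega>)\<^sup>2) = (\<lambda>\<omega>. \<Sum>i<N. \<Sum>j<N. D i \<omega> * D j \<omega>)"
    unfolding power2_eq_square sum_product ..
  have hb: "has_bochner_integral M (\<lambda>\<omega>. (\<Sum>i<N. D i \<omega>)\<^sup>2) (\<Sum>i<N. \<Sum>j<N. \<integral>\<omega>. D i \<omega> * D j \<omega> \<partial>M)"
    unfolding e by (intro has_bochner_integral_sum has_bochner_integral_integrable all) auto
  show "integrable M (\<lambda>\<omega>. (\<Sum>i<N. D i \<omega>)\<^sup>2)" using hb by (rule integrable.intros)
  have "(\<Sum>i<N. \<Sum>j<N. \<integral>\<omega>. D i \<omega> * D j \<omega> \<partial>M) = (\<Sum>i<N. \<integral>\<omega>. D i \<omega> * D i \<omega> \<partial>M)"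
  proof (intro sum.cong refl)
    fix i assume i: "i \<in> {..<N}"
    have "(\<Sum>j<N. \<integral>\<omega>. D i \<omega> * D j \<omega> \<partial>M) = (\<Sum>j\<in>{i}. \<integral>\<omega>. D i \<omega> * D j \<omega> \<partial>M)"
      using i off by (intro sum.mono_neutral_right) auto
    then show "(\<Sum>j<N. \<integral>\<omega>. D i \<omega> * D j \<omega> \<partial>M) = (\<integral>\<omega>. D i \<omega> * D i \<omega> \<partial>M)" by simp
  qed
  also have "\<dots> \<le> (\<Sum>i<N. B\<^sup>2 * (2 * (p (Suc i) - p i)\<^sup>2))" using diag by (intro sum_mono) auto
  finally show "(\<integral>\<omega>. (\<Sum>i<N. D i \<omega>)\<^sup>2 \<partial>M) \<le> (\<Sum>i<N. B\<^sup>2 * (2 * (p (Suc i) - p i)\<^sup>2))"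
    using has_bochner_integral_integral_eq[OF hb] by simp
qed

end

section \<open>Errors along a grid stopped at a fixed time\<close>

context ito_approx
begin

text \<open>The discrete quadratic variation of the simple integral of \<open>A\<close> up to time
  t, minus its compensator. It vanishes in mean square with the mesh.\<close>

definition V :: "real \<Rightarrow> nat \<Rightarrow> 'a \<Rightarrow> real" where
  "V t k \<omega> = (\<Sum>i<n k. (A k i \<omega>)\<^sup>2 * ((W (min t (\<tau> k (Suc i))) \<omega> - W (min t (\<tau> k i)) \<omega>)\<^sup>2
     - (min t (\<tau> k (Suc i)) - min t (\<tau> k i))))"

text \<open>What is lost in a relative price increment when the exact integral is replaced by the
  simple integral of \<open>A\<close>; this is the term \<open>e\<close> of
  \<open>log_sum_limit\<close>. The coefficients stay at the node while the increments are stopped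
  at t, so cells beyond t contribute 0.\<close>

definition err :: "real \<Rightarrow> nat \<Rightarrow> nat \<Rightarrow> 'a \<Rightarrow> real" where
  "err t k i \<omega> = w k i \<omega> * (I (min t (\<tau> k (Suc i))) \<omega> - I (min t (\<tau> k i)) \<omega>)
     - A k i \<omega> * (W (min t (\<tau> k (Suc i))) \<omega> - W (min t (\<tau> k i)) \<omega>)"

lemma stopped_sum:
  fixes f :: "real \<Rightarrow> real"
  assumes "0 \<le> t" "t \<le> T"
  shows "(\<Sum>i<n k. f (min t (\<tau> k (Suc i))) - f (min t (\<tau> k i))) = f t - f 0"
  using sum_lessThan_telescope[of "\<lambda>i. f (min t (\<tau> k i))" "n k"] assms by (simp add: \<tau>_0 \<tau>_n)

lemma stopped_mono: "i < n k \<Longrightarrow> min t (\<tau> k i) \<le> min t (\<tau> k (Suc i))"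
  using \<tau>_le[of i k] by (simp add: min_le_iff_disj)

lemma stopped_mesh: "i < n k \<Longrightarrow> min t (\<tau> k (Suc i)) - min t (\<tau> k i) \<le> T / real (Suc k)"
proof -
  assume i: "i < n k"
  have "min t (\<tau> k (Suc i)) - min t (\<tau> k i) \<le> \<tau> k (Suc i) - \<tau> k i"
    using \<tau>_le[OF i] by (auto simp: min_def)
  with mesh[OF i] show ?thesis by linarith
qed

lemma stopped_nonneg: "0 \<le> t \<Longrightarrow> i \<le> n k \<Longrightarrow> 0 \<le> min t (\<tau> k i)"
  using \<tau>_nonneg[of i k] by simp

lemma V_square:
  assumes t: "0 \<le> t" "t \<le> T"
  shows "integrable M (\<lambda>\<omega>. (V t k \<omega>)\<^sup>2)" "(\<integral>\<omega>. (V t k \<omega>)\<^sup>2 \<partial>M) \<le> 2 * C ^ 4 * T\<^sup>2 * (1 / real (Suc k))"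
proof -
  define p where "p i = min t (\<tau> k i)" for i
  \<comment> \<open>For a cell starting at or after t the stopped left end is t, where
    \<open>A k i\<close> need not be known yet. Setting its coefficient to 0 restores measurability
    and changes nothing, because the stopped cell is empty.\<close>
  define Z where "Z i \<omega> = (if \<tau> k i < t then (A k i \<omega>)\<^sup>2 else 0)" for i \<omega>
  have p0: "0 \<le> p 0" using t by (simp add: p_def \<tau>_0)
  have p: "p i \<le> p (Suc i)" if "i < n k" for i using stopped_mono[OF that] by (simp add: p_def)
  have Zm: "Z i \<in> borel_measurable (F (p i))" if "i < n k" for i
    unfolding Z_def p_def using A_meas[OF that] by (cases "\<tau> k i < t") (auto simp: min_def)
  have ZB: "\<bar>Z i \<omega>\<bar> \<le> C\<^sup>2" for i \<omega>
    using power_mono[OF A_bdd[of k i \<omega>], of 2] by (auto simp: Z_def)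
  have V: "V t k \<omega> = (\<Sum>i<n k. Z i \<omega> * ((W (p (Suc i)) \<omega> - W (p i) \<omega>)\<^sup>2 - (p (Suc i) - p i)))" for \<omega>
    unfolding V_def
  proof (intro sum.cong refl)
    fix i assume "i \<in> {..<n k}"
    then have i: "i < n k" by simp
    show "(A k i \<omega>)\<^sup>2 * ((W (min t (\<tau> k (Suc i))) \<omega> - W (min t (\<tau> k i)) \<omega>)\<^sup>2 - (min t (\<tau> k (Suc i)) - min t (\<tau> k i))) =
         Z i \<omega> * ((W (p (Suc i)) \<omega> - W (p i) \<omega>)\<^sup>2 - (p (Suc i) - p i))"
      using \<tau>_le[OF i] by (cases "\<tau> k i < t") (auto simp: Z_def p_def min_absorb1)
  qed
  note q = quadratic_variation_error[where p=p and N="n k" and Z=Z and B="C\<^sup>2", OF p0 p Zm ZB]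
  show "integrable M (\<lambda>\<omega>. (V t k \<omega>)\<^sup>2)" unfolding V using q(1) by simp
  have "(\<integral>\<omega>. (V t k \<omega>)\<^sup>2 \<partial>M) \<le> (\<Sum>i<n k. (C\<^sup>2)\<^sup>2 * (2 * (p (Suc i) - p i)\<^sup>2))" unfolding V using q(2) by simp
  \<comment> \<open>One factor of each squared length is bounded by the mesh; the remaining lengths
    add up to t.\<close>
  also have "\<dots> \<le> (\<Sum>i<n k. (C\<^sup>2)\<^sup>2 * (2 * ((p (Suc i) - p i) * (T / real (Suc k)))))"
    unfolding power2_eq_square[of "p _ - p _"]
  proof (intro sum_mono mult_left_mono)
    fix i assume "i \<in> {..<n k}"
    then show "p (Suc i) - p i \<le> T / real (Suc k)" "0 \<le> p (Suc i) - p i" using stopped_mesh[of i k t] p[of i] by (auto simp: p_def)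
  qed auto
  also have "\<dots> = (C\<^sup>2)\<^sup>2 * 2 * (T / real (Suc k)) * (\<Sum>i<n k. p (Suc i) - p i)"
    unfolding sum_distrib_left by (intro sum.cong refl) (simp add: mult_ac)
  also have "(\<Sum>i<n k. p (Suc i) - p i) = t" unfolding p_def using stopped_sum[OF t, of "\<lambda>x. x"] by simp
  also have "(C\<^sup>2)\<^sup>2 * 2 * (T / real (Suc k)) * t \<le> (C\<^sup>2)\<^sup>2 * 2 * (T / real (Suc k)) * T"
    using t T by (intro mult_left_mono) auto
  also have "\<dots> = 2 * C ^ 4 * T\<^sup>2 * (1 / real (Suc k))" by (simp add: power2_eq_square power4_eq_xxxx)
  finally show "(\<integral>\<omega>. (V t k \<omega>)\<^sup>2 \<partial>M) \<le> 2 * C ^ 4 * T\<^sup>2 * (1 / real (Suc k))" .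
qed

lemma V_tendsto:
  assumes t: "0 \<le> t" "t \<le> T"
  shows "(\<lambda>k. \<integral>\<omega>. norm ((V t k \<omega>)\<^sup>2) \<partial>M) \<longlonglongrightarrow> 0"
proof (rule Lim_null_comparison)
  show "\<forall>\<^sub>F k in sequentially. norm (\<integral>\<omega>. norm ((V t k \<omega>)\<^sup>2) \<partial>M) \<le> 2 * C ^ 4 * T\<^sup>2 * (1 / real (Suc k))"
    using V_square(2)[OF t] by (auto simp: integral_nonneg_AE)
  have "(\<lambda>k. 2 * C ^ 4 * T\<^sup>2 * (1 / real (Suc k))) \<longlonglongrightarrow> 2 * C ^ 4 * T\<^sup>2 * 0"
    by (intro tendsto_mult tendsto_const LIMSEQ_Suc[OF lim_1_over_n])
  then show "(\<lambda>k. 2 * C ^ 4 * T\<^sup>2 * (1 / real (Suc k))) \<longlonglongrightarrow> 0" by simp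
qed

text \<open>\<open>clip i\<close> is the projection onto the \<open>i\<close>-th cell of grid \<open>k\<close> stopped at \<open>t\<close>; it cuts grid \<open>l\<close> into
  pieces of that cell, so the common refinement of the two grids is indexed by pairs. The block map \<open>c\<close>
  covers two cases: \<open>id\<close> gives the quadratic variation of the error, a constant gives its square.\<close>

lemma block_error_approx:
  fixes c :: "nat \<Rightarrow> nat"
  assumes t: "0 \<le> t" "t \<le> T" and \<delta>: "0 < \<delta>"
  shows "(\<integral>\<omega>. min 1 (\<Sum>b\<in>c ` {..<n k}. (\<Sum>i\<in>{i\<in>{..<n k}. c i = b}.
        w k i \<omega> * (simple_integral (n l) (\<tau> l) (\<xi> l) W (min t (\<tau> k (Suc i))) \<omega> - simple_integral (n l) (\<tau> l) (\<xi> l) W (min t (\<tau> k i)) \<omega>)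
        - A k i \<omega> * (W (min t (\<tau> k (Suc i))) \<omega> - W (min t (\<tau> k i)) \<omega>))\<^sup>2) \<partial>M)
     \<le> \<delta> + (\<integral>\<omega>. min 1 ((LBINT s:{0<..T}. (WW k s \<omega> * HH l s \<omega> - AA k s \<omega>)\<^sup>2) / \<delta>) \<partial>M)"
proof -
  define p where "p i = min t (\<tau> k i)" for i
  define clip where "clip i x = max (p i) (min x (p (Suc i)))" for i x
  define L where "L q = clip (fst q) (\<tau> l (snd q))" for q
  define U where "U q = clip (fst q) (\<tau> l (Suc (snd q)))" for q
  define \<zeta> where "\<zeta> q \<omega> = w k (fst q) \<omega> * \<xi> l (snd q) \<omega> - A k (fst q) \<omega>" for q \<omega>
  \<comment> \<open>Only nonempty pieces are kept. A nonempty piece starts no earlier than either of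
    the two cells it comes from, so \<open>\<zeta> q\<close> is known at its left end.\<close>
  define J where "J = {q\<in>{..<n k} \<times> {..<n l}. L q < U q}"
  have pm: "p i \<le> p (Suc i)" if "i < n k" for i using stopped_mono[OF that] by (simp add: p_def)
  have pmono: "p i \<le> p j" if "i \<le> j" "j \<le> n k" for i j
    using grid_mono[of "n k" p i j, OF pm] that by simp
  have p0: "0 \<le> p i" if "i \<le> n k" for i using stopped_nonneg[OF t(1) that] by (simp add: p_def)
  have pT: "p i \<le> T" for i using t by (simp add: p_def)
  have clip_b: "p i \<le> clip i x" "clip i x \<le> p (Suc i)" if "i < n k" for i x
    using pm[OF that] by (auto simp: clip_def)
  have clip_mono: "clip i x \<le> clip i y" if "x \<le> y" for i x y using that by (auto simp: clip_def)
  have LU: "L q \<le> U q" if "q \<in> {..<n k} \<times> {..<n l}" for q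
    using that \<tau>_le[of "snd q" l] clip_mono by (auto simp: L_def U_def)
  have Jq: "fst q < n k" "snd q < n l" "\<tau> k (fst q) < t" "\<tau> k (fst q) \<le> L q" "\<tau> l (snd q) \<le> L q" if "q \<in> J" for q
  proof -
    show i: "fst q < n k" and j: "snd q < n l" using that by (auto simp: J_def)
    have lu: "L q < U q" using that by (simp add: J_def)
    have "p (fst q) < p (Suc (fst q))" using lu clip_b[OF i] unfolding L_def U_def by (meson le_less_trans less_le_trans)
    then show it: "\<tau> k (fst q) < t" by (auto simp: p_def min_def split: if_splits)
    then have "p (fst q) = \<tau> k (fst q)" by (simp add: p_def)
    then show "\<tau> k (fst q) \<le> L q" using clip_b(1)[OF i, of "\<tau> l (snd q)"] by (simp add: L_def)
    have "\<tau> l (snd q) \<le> p (Suc (fst q))"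
    proof (rule ccontr)
      assume "\<not> \<tau> l (snd q) \<le> p (Suc (fst q))"
      then have "L q = p (Suc (fst q))" using pm[OF i] by (simp add: L_def clip_def)
      then show False using lu clip_b(2)[OF i, of "\<tau> l (Suc (snd q))"] by (simp add: U_def)
    qed
    then show "\<tau> l (snd q) \<le> L q" by (simp add: L_def clip_def)
  qed
  have Jfin: "finite J" by (simp add: J_def)
  have bound: "(\<integral>\<omega>. min 1 (\<Sum>b\<in>c ` {..<n k}. (\<Sum>q\<in>{q\<in>J. (c \<circ> fst) q = b}. \<zeta> q \<omega> * (W (U q) \<omega> - W (L q) \<omega>))\<^sup>2) \<partial>M)
     \<le> \<delta> + (\<integral>\<omega>. min 1 ((\<Sum>q\<in>J. (\<zeta> q \<omega>)\<^sup>2 * (U q - L q)) / \<delta>) \<partial>M)"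
  proof (rule simple_sum_bound)
    fix q assume q: "q \<in> J"
    show "0 \<le> L q" using Jq(4)[OF q] \<tau>_nonneg[of "fst q" k] Jq(1)[OF q] by simp
    show "L q < U q" using q by (simp add: J_def)
    show "\<zeta> q \<in> borel_measurable (F (L q))"
      unfolding \<zeta>_def using measurable_F_mono[OF w_meas[OF Jq(1)[OF q]] Jq(4)[OF q]]
        measurable_F_mono[OF A_meas[OF Jq(1)[OF q]] Jq(4)[OF q]] measurable_F_mono[OF \<xi>_meas[OF Jq(2)[OF q]] Jq(5)[OF q]]
      by simp
  next
    fix q q' assume q: "q \<in> J" "q' \<in> J" "q \<noteq> q'"
    have *: "U q \<le> L q'" if "q \<in> J" "q' \<in> J" "fst q < fst q' \<or> (fst q = fst q' \<and> snd q < snd q')" for q q'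
    proof (cases "fst q < fst q'")
      case True
      have "U q \<le> p (Suc (fst q))" using clip_b(2)[OF Jq(1)[OF that(1)]] by (simp add: U_def)
      also have "\<dots> \<le> p (fst q')" using pmono[of "Suc (fst q)" "fst q'"] True Jq(1)[OF that(2)] by simp
      also have "\<dots> \<le> L q'" using clip_b(1)[OF Jq(1)[OF that(2)]] by (simp add: L_def)
      finally show ?thesis .
    next
      case False
      then have "fst q = fst q'" "snd q < snd q'" using that by auto
      then show ?thesis using \<tau>_mono[of "Suc (snd q)" "snd q'" l] Jq(2)[OF that(2)] by (auto simp: U_def L_def intro!: clip_mono)
    qed
    show "U q \<le> L q' \<or> U q' \<le> L q"
    proof -
      have "(fst q < fst q' \<or> (fst q = fst q' \<and> snd q < snd q')) \<or> (fst q' < fst q \<or> (fst q' = fst q \<and> snd q' < snd q))"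
        using q(3) by (metis linorder_neqE_nat prod_eqI)
      then show ?thesis using *[OF q(1,2)] *[OF q(2,1)] by blast
    qed
  qed (use Jfin \<delta> in auto)
  have inner: "(\<Sum>q\<in>{q\<in>J. (c \<circ> fst) q = b}. \<zeta> q \<omega> * (W (U q) \<omega> - W (L q) \<omega>)) =
      (\<Sum>i\<in>{i\<in>{..<n k}. c i = b}. w k i \<omega> * (simple_integral (n l) (\<tau> l) (\<xi> l) W (p (Suc i)) \<omega> - simple_integral (n l) (\<tau> l) (\<xi> l) W (p i) \<omega>)
        - A k i \<omega> * (W (p (Suc i)) \<omega> - W (p i) \<omega>))" for b \<omega>
  proof -
    have "(\<Sum>q\<in>{q\<in>J. (c \<circ> fst) q = b}. \<zeta> q \<omega> * (W (U q) \<omega> - W (L q) \<omega>)) =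
       (\<Sum>q\<in>{i\<in>{..<n k}. c i = b} \<times> {..<n l}. \<zeta> q \<omega> * (W (U q) \<omega> - W (L q) \<omega>))"
    proof (rule sum.mono_neutral_left)
      show "\<forall>q\<in>{i\<in>{..<n k}. c i = b} \<times> {..<n l} - {q\<in>J. (c \<circ> fst) q = b}. \<zeta> q \<omega> * (W (U q) \<omega> - W (L q) \<omega>) = 0"
      proof
        fix q assume "q \<in> {i\<in>{..<n k}. c i = b} \<times> {..<n l} - {q\<in>J. (c \<circ> fst) q = b}"
        then have "q \<in> {..<n k} \<times> {..<n l}" "\<not> L q < U q" by (auto simp: J_def)
        then have "L q = U q" using LU[of q] by simp
        then show "\<zeta> q \<omega> * (W (U q) \<omega> - W (L q) \<omega>) = 0" by simp
      qed
    qed (auto simp: J_def)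
    also have "\<dots> = (\<Sum>i\<in>{i\<in>{..<n k}. c i = b}. \<Sum>j<n l. \<zeta> (i, j) \<omega> * (W (U (i, j)) \<omega> - W (L (i, j)) \<omega>))"
      by (simp add: sum.cartesian_product)
    also have "\<dots> = (\<Sum>i\<in>{i\<in>{..<n k}. c i = b}. w k i \<omega> * (simple_integral (n l) (\<tau> l) (\<xi> l) W (p (Suc i)) \<omega> - simple_integral (n l) (\<tau> l) (\<xi> l) W (p i) \<omega>)
        - A k i \<omega> * (W (p (Suc i)) \<omega> - W (p i) \<omega>))"
    proof (intro sum.cong refl)
      fix i assume "i \<in> {i\<in>{..<n k}. c i = b}"
      then have i: "i < n k" by simp
      \<comment> \<open>Expresses the projection through two stopped times. Summed against the
        coefficients of grid \<open>l\<close>, increments over pieces thereby become differences of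
        simple integrals at the two ends of the cell of grid \<open>k\<close>.\<close>
      have clipf: "W (clip i x) \<omega> = W (min (p (Suc i)) x) \<omega> - W (min (p i) x) \<omega> + W (p i) \<omega>" for x
        using pm[OF i] by (auto simp: clip_def min_def max_def)
      have tel: "(\<Sum>j<n l. W (U (i, j)) \<omega> - W (L (i, j)) \<omega>) = W (p (Suc i)) \<omega> - W (p i) \<omega>"
      proof -
        have "(\<Sum>j<n l. W (U (i, j)) \<omega> - W (L (i, j)) \<omega>) = W (clip i (\<tau> l (n l))) \<omega> - W (clip i (\<tau> l 0)) \<omega>"
          unfolding U_def L_def fst_conv snd_conv using sum_lessThan_telescope[of "\<lambda>j. W (clip i (\<tau> l j)) \<omega>" "n l"] .
        also have "clip i (\<tau> l (n l)) = p (Suc i)" using pT[of "Suc i"] pm[OF i] by (simp add: clip_def \<tau>_n)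
        also have "clip i (\<tau> l 0) = p i" using p0[of i] p0[of "Suc i"] i by (simp add: clip_def \<tau>_0)
        finally show ?thesis .
      qed
      have "(\<Sum>j<n l. \<zeta> (i, j) \<omega> * (W (U (i, j)) \<omega> - W (L (i, j)) \<omega>)) =
         w k i \<omega> * (\<Sum>j<n l. \<xi> l j \<omega> * (W (U (i, j)) \<omega> - W (L (i, j)) \<omega>)) - A k i \<omega> * (\<Sum>j<n l. W (U (i, j)) \<omega> - W (L (i, j)) \<omega>)"
        unfolding sum_distrib_left sum_subtractf[symmetric] \<zeta>_def by (intro sum.cong refl) (simp add: algebra_simps)
      also have "(\<Sum>j<n l. \<xi> l j \<omega> * (W (U (i, j)) \<omega> - W (L (i, j)) \<omega>)) =
          simple_integral (n l) (\<tau> l) (\<xi> l) W (p (Suc i)) \<omega> - simple_integral (n l) (\<tau> l) (\<xi> l) W (p i) \<omega>"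
        unfolding simple_integral_def sum_subtractf[symmetric] U_def L_def fst_conv snd_conv clipf
        by (intro sum.cong refl) (simp add: algebra_simps)
      finally show "(\<Sum>j<n l. \<zeta> (i, j) \<omega> * (W (U (i, j)) \<omega> - W (L (i, j)) \<omega>)) =
          w k i \<omega> * (simple_integral (n l) (\<tau> l) (\<xi> l) W (p (Suc i)) \<omega> - simple_integral (n l) (\<tau> l) (\<xi> l) W (p i) \<omega>)
        - A k i \<omega> * (W (p (Suc i)) \<omega> - W (p i) \<omega>)" unfolding tel .
    qed
    finally show ?thesis .
  qed
  \<comment> \<open>The pieces are disjoint, and on each of them the integrand on the right equals
    the constant \<open>(\<zeta> q \<omega>)\<^sup>2\<close>. They reach only up to t, hence an
    inequality.\<close>
  have energy: "(\<Sum>q\<in>J. (\<zeta> q \<omega>)\<^sup>2 * (U q - L q)) \<le> (LBINT s:{0<..T}. (WW k s \<omega> * HH l s \<omega> - AA k s \<omega>)\<^sup>2)"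
    if \<omega>: "\<omega> \<in> space M" for \<omega>
  proof -
    let ?f = "\<lambda>s. (WW k s \<omega> * HH l s \<omega> - AA k s \<omega>)\<^sup>2"
    have "set_integrable lborel {0<..T} ?f"
    proof (rule set_integrable_bounded)
      show "?f \<in> borel_measurable borel"
        by (intro borel_measurable_power borel_measurable_diff borel_measurable_times simple_process_borel_time)
      fix s :: real
      let ?K = "(\<Sum>i<n k. \<bar>w k i \<omega>\<bar>) * (\<Sum>i<n l. \<bar>\<xi> l i \<omega>\<bar>) + (\<Sum>i<n k. \<bar>A k i \<omega>\<bar>)"
      have "\<bar>WW k s \<omega> * HH l s \<omega>\<bar> \<le> (\<Sum>i<n k. \<bar>w k i \<omega>\<bar>) * (\<Sum>i<n l. \<bar>\<xi> l i \<omega>\<bar>)"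
        unfolding abs_mult by (intro mult_mono simple_process_abs_le) (auto intro: sum_nonneg)
      then have "\<bar>WW k s \<omega> * HH l s \<omega> - AA k s \<omega>\<bar> \<le> ?K"
        using simple_process_abs_le[of "n k" "\<tau> k" "A k" s \<omega>] by linarith
      from power_mono[OF this, of 2] show "\<bar>?f s\<bar> \<le> ?K\<^sup>2" by simp
    qed
    then have fint: "integrable lborel (\<lambda>s. indicator {0<..T} s * ?f s)" by (simp add: set_integrable_def)
    define g where "g s = (\<Sum>q\<in>J. (\<zeta> q \<omega>)\<^sup>2 * indicator {L q<..U q} s)" for s
    have gint: "integrable lborel (\<lambda>s. (\<zeta> q \<omega>)\<^sup>2 * indicator {L q<..U q} s)" if "q \<in> J" for q
      using that by (simp add: J_def)
    have "(\<Sum>q\<in>J. (\<zeta> q \<omega>)\<^sup>2 * (U q - L q)) = (\<Sum>q\<in>J. \<integral>s. (\<zeta> q \<omega>)\<^sup>2 * indicator {L q<..U q} s \<partial>lborel)"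
      by (intro sum.cong refl) (simp add: J_def)
    also have "\<dots> = (\<integral>s. g s \<partial>lborel)" unfolding g_def using gint by (subst Bochner_Integration.integral_sum) auto
    also have "\<dots> \<le> (\<integral>s. indicator {0<..T} s * ?f s \<partial>lborel)"
    proof (rule integral_mono'[OF fint])
      fix s :: real
      show "g s \<le> indicator {0<..T} s * ?f s"
      proof (cases "\<exists>q\<in>J. L q < s \<and> s \<le> U q")
        case False
        then have "g s = 0" unfolding g_def by (intro sum.neutral) (auto simp: indicator_def)
        then show ?thesis by simp
      next
        case True
        then obtain q where q: "q \<in> J" "L q < s" "s \<le> U q" by auto
        have split: "p (fst q) < s \<and> s \<le> p (Suc (fst q)) \<and> \<tau> l (snd q) < s \<and> s \<le> \<tau> l (Suc (snd q))"
          if "L q < s" "s \<le> U q" "q \<in> J" for q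
          using that Jq(5)[OF that(3)] pm[OF Jq(1)[OF that(3)]] by (auto simp: L_def U_def clip_def min_def max_def split: if_splits)
        have split': "\<tau> k (fst q) < s \<and> s \<le> \<tau> k (Suc (fst q))" if "L q < s" "s \<le> U q" "q \<in> J" for q
          using split[OF that] Jq(3)[OF that(3)] by (auto simp: p_def min_def split: if_splits)
        have uniq: "q' = q" if q': "q' \<in> J" "L q' < s" "s \<le> U q'" for q'
        proof (rule prod_eqI)
          show "fst q' = fst q"
            using grid_cell_unique[of "n k" "\<tau> k" "fst q'" s "fst q", OF \<tau>_le] Jq(1)[OF q(1)] Jq(1)[OF q'(1)]
              split'[OF q(2,3,1)] split'[OF q'(2,3,1)] by blast
          show "snd q' = snd q"
            using grid_cell_unique[of "n l" "\<tau> l" "snd q'" s "snd q", OF \<tau>_le] Jq(2)[OF q(1)] Jq(2)[OF q'(1)]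
              split[OF q(2,3,1)] split[OF q'(2,3,1)] by blast
        qed
        have "g s = (\<Sum>q'\<in>{q}. (\<zeta> q' \<omega>)\<^sup>2 * indicator {L q'<..U q'} s)"
          unfolding g_def using Jfin q(1) uniq by (intro sum.mono_neutral_right) (auto simp: indicator_def)
        also have "\<dots> = (\<zeta> q \<omega>)\<^sup>2" using q by simp
        also have "\<dots> = ?f s"
          using process_cell[OF Jq(1)[OF q(1)], of s] process_cell[OF Jq(2)[OF q(1)], of s] split[OF q(2,3,1)] split'[OF q(2,3,1)]
          by (simp add: \<zeta>_def)
        also have "\<dots> = indicator {0<..T} s * ?f s"
          using split[OF q(2,3,1)] p0[of "fst q"] pT[of "Suc (fst q)"] Jq(1)[OF q(1)] by (simp add: indicator_def)
        finally show ?thesis by simp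
      qed
    qed simp
    finally show ?thesis by (simp add: set_lebesgue_integral_def)
  qed
  have Nmeas: "(\<lambda>\<omega>. LBINT s:{0<..T}. (WW k s \<omega> * HH l s \<omega> - AA k s \<omega>)\<^sup>2) \<in> borel_measurable M"
    by (rule time_integral_meas) measurable
  have Nnn: "0 \<le> (LBINT s:{0<..T}. (WW k s \<omega> * HH l s \<omega> - AA k s \<omega>)\<^sup>2)" for \<omega>
    unfolding set_lebesgue_integral_def by (intro integral_nonneg_AE) auto
  have \<zeta>M: "\<zeta> q \<in> borel_measurable M" if "q \<in> J" for q
    unfolding \<zeta>_def using w_measM[OF Jq(1)[OF that]] A_measM[OF Jq(1)[OF that]] \<xi>_measM[OF Jq(2)[OF that]] by simp
  have "(\<integral>\<omega>. min 1 ((\<Sum>q\<in>J. (\<zeta> q \<omega>)\<^sup>2 * (U q - L q)) / \<delta>) \<partial>M) \<le>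
     (\<integral>\<omega>. min 1 ((LBINT s:{0<..T}. (WW k s \<omega> * HH l s \<omega> - AA k s \<omega>)\<^sup>2) / \<delta>) \<partial>M)"
  proof (rule integral_mono)
    show "integrable M (\<lambda>\<omega>. min 1 ((\<Sum>q\<in>J. (\<zeta> q \<omega>)\<^sup>2 * (U q - L q)) / \<delta>))"
    proof (rule integrable_const_bound[where B=1])
      show "AE \<omega> in M. norm (min 1 ((\<Sum>q\<in>J. (\<zeta> q \<omega>)\<^sup>2 * (U q - L q)) / \<delta>)) \<le> 1"
      proof (rule AE_I2)
        fix \<omega>
        have "0 \<le> (\<Sum>q\<in>J. (\<zeta> q \<omega>)\<^sup>2 * (U q - L q)) / \<delta>"
          using \<delta> by (intro divide_nonneg_pos sum_nonneg) (auto simp: J_def)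
        then show "norm (min 1 ((\<Sum>q\<in>J. (\<zeta> q \<omega>)\<^sup>2 * (U q - L q)) / \<delta>)) \<le> 1" by auto
      qed
    qed (use \<zeta>M in measurable)
    show "integrable M (\<lambda>\<omega>. min 1 ((LBINT s:{0<..T}. (WW k s \<omega> * HH l s \<omega> - AA k s \<omega>)\<^sup>2) / \<delta>))"
      using Nnn Nmeas \<delta> by (intro integrable_const_bound[where B=1]) auto
    show "min 1 ((\<Sum>q\<in>J. (\<zeta> q \<omega>)\<^sup>2 * (U q - L q)) / \<delta>) \<le> min 1 ((LBINT s:{0<..T}. (WW k s \<omega> * HH l s \<omega> - AA k s \<omega>)\<^sup>2) / \<delta>)"
      if "\<omega> \<in> space M" for \<omega>
      using energy[OF that] \<delta> by (intro min.mono divide_right_mono) auto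
  qed
  with bound show ?thesis unfolding inner p_def by linarith
qed

end

lemma min1_sum: "finite S \<Longrightarrow> (\<And>i. i \<in> S \<Longrightarrow> 0 \<le> f i) \<Longrightarrow> min 1 (\<Sum>i\<in>S. f i) \<le> (\<Sum>i\<in>S. min 1 (f i :: real))"
proof (induction S rule: finite_induct)
  case (insert i S)
  have "0 \<le> (\<Sum>i\<in>S. f i)" using insert by (intro sum_nonneg) auto
  then have "min 1 (f i + (\<Sum>i\<in>S. f i)) \<le> min 1 (f i) + min 1 (\<Sum>i\<in>S. f i)"
    using insert.prems[of i] by (auto simp: min_def)
  also have "\<dots> \<le> min 1 (f i) + (\<Sum>i\<in>S. min 1 (f i))" using insert by auto
  finally show ?case using insert by simp
qed simp

section \<open>Comparison with the exact stochastic integral\<close>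

context ito_approx
begin

abbreviation "SI k t \<equiv> simple_integral (n k) (\<tau> k) (\<xi> k) W t"

lemma SI_meas: "0 \<le> t \<Longrightarrow> SI k t \<in> borel_measurable M"
  by (rule simple_integral_meas) (auto intro: \<xi>_measM \<tau>_nonneg)

lemma err_meas: 
  assumes "0 \<le> t" "i < n k" shows "err t k i \<in> borel_measurable M"
  unfolding err_def
  using assms stopped_nonneg[of t i k] stopped_nonneg[of t "Suc i" k]
  by (intro borel_measurable_diff borel_measurable_times w_measM A_measM I_meas W_measurable) auto

lemma G_nonneg: "0 \<le> G k \<omega>"
  unfolding G_def set_lebesgue_integral_def by (intro integral_nonneg_AE) auto

lemma G_integrable:
  assumes \<omega>: "\<omega> \<in> space M"
  shows "set_integrable lborel {0<..T} (\<lambda>s. (WW k s \<omega> * (a s \<omega> * Y s \<omega>) - AA k s \<omega>)\<^sup>2)"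
proof -
  obtain K where K: "0 < K" "\<And>t. 0 \<le> t \<Longrightarrow> t \<le> T \<Longrightarrow> Y t \<omega> \<le> K" by (rule Y_bounds[OF \<omega>]) blast
  note [measurable] = a_time[OF \<omega>] Y_time[OF \<omega>]
  show ?thesis
  proof (rule set_integrable_bounded)
    show "(\<lambda>s. (WW k s \<omega> * (a s \<omega> * Y s \<omega>) - AA k s \<omega>)\<^sup>2) \<in> borel_measurable borel"
      by (intro borel_measurable_power borel_measurable_diff borel_measurable_times simple_process_borel_time a_time Y_time \<omega>)
    fix s assume s: "0 < s" "s \<le> T"
    have "\<bar>a s \<omega> * Y s \<omega>\<bar> \<le> C * K"
      unfolding abs_mult using a_bdd[of s \<omega>] K(2)[of s] Y_pos[of s \<omega>] s \<omega> C by (intro mult_mono) auto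
    then have "\<bar>WW k s \<omega> * (a s \<omega> * Y s \<omega>)\<bar> \<le> (\<Sum>i<n k. \<bar>w k i \<omega>\<bar>) * (C * K)"
      unfolding abs_mult[of "WW k s \<omega>"] by (intro mult_mono simple_process_abs_le) (auto intro: sum_nonneg)
    then have "\<bar>WW k s \<omega> * (a s \<omega> * Y s \<omega>) - AA k s \<omega>\<bar> \<le> (\<Sum>i<n k. \<bar>w k i \<omega>\<bar>) * (C * K) + (\<Sum>i<n k. \<bar>A k i \<omega>\<bar>)"
      using simple_process_abs_le[of "n k" "\<tau> k" "A k" s \<omega>] by linarith
    from power_mono[OF this, of 2] show "\<bar>(WW k s \<omega> * (a s \<omega> * Y s \<omega>) - AA k s \<omega>)\<^sup>2\<bar> \<le> ((\<Sum>i<n k. \<bar>w k i \<omega>\<bar>) * (C * K) + (\<Sum>i<n k. \<bar>A k i \<omega>\<bar>))\<^sup>2"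
      by simp
  qed
qed

text \<open>Inserting \<open>a * Y\<close> splits the integrand into the part measured by
  \<open>G k\<close> and the error of \<open>HH l\<close> times \<open>WW k\<close>. The crude bound
  on \<open>WW k\<close> by the sum of all its coefficients is good enough, since it does not depend
  on \<open>l\<close>.\<close>

lemma energy_bound:
  assumes \<omega>: "\<omega> \<in> space M"
  shows "(LBINT s:{0<..T}. (WW k s \<omega> * HH l s \<omega> - AA k s \<omega>)\<^sup>2) \<le>
    2 * (\<Sum>i<n k. \<bar>w k i \<omega>\<bar>)\<^sup>2 * (LBINT s:{0<..T}. (HH l s \<omega> - a s \<omega> * Y s \<omega>)\<^sup>2) + 2 * G k \<omega>"
proof -
  let ?K = "\<Sum>i<n k. \<bar>w k i \<omega>\<bar>"
  let ?h = "\<lambda>s. 2 * ?K\<^sup>2 * (HH l s \<omega> - a s \<omega> * Y s \<omega>)\<^sup>2" and ?g = "\<lambda>s. 2 * (WW k s \<omega> * (a s \<omega> * Y s \<omega>) - AA k s \<omega>)\<^sup>2"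
  have hi: "set_integrable lborel {0<..T} ?h" using HH_error_integrable[OF \<omega>, of l] by simp
  have gi: "set_integrable lborel {0<..T} ?g" using G_integrable[OF \<omega>, of k] by simp
  have "(LBINT s:{0<..T}. (WW k s \<omega> * HH l s \<omega> - AA k s \<omega>)\<^sup>2) \<le> (LBINT s:{0<..T}. ?h s + ?g s)"
    unfolding set_lebesgue_integral_def
  proof (rule integral_mono'[OF set_integral_add(1)[OF hi gi, unfolded set_integrable_def]])
    fix s
    have "(WW k s \<omega> * HH l s \<omega> - AA k s \<omega>)\<^sup>2 = (WW k s \<omega> * (HH l s \<omega> - a s \<omega> * Y s \<omega>) + (WW k s \<omega> * (a s \<omega> * Y s \<omega>) - AA k s \<omega>))\<^sup>2"
      by (simp add: algebra_simps)
    also have "\<dots> \<le> 2 * (WW k s \<omega> * (HH l s \<omega> - a s \<omega> * Y s \<omega>))\<^sup>2 + ?g s"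
      using sum_squares_bound[of "WW k s \<omega> * (HH l s \<omega> - a s \<omega> * Y s \<omega>)" "WW k s \<omega> * (a s \<omega> * Y s \<omega>) - AA k s \<omega>"]
      unfolding power2_sum by linarith
    also have "2 * (WW k s \<omega> * (HH l s \<omega> - a s \<omega> * Y s \<omega>))\<^sup>2 \<le> ?h s"
      unfolding power_mult_distrib mult.assoc
      using power_mono[OF simple_process_abs_le[of "n k" "\<tau> k" "w k" s \<omega>], of 2] by (intro mult_left_mono mult_right_mono) auto
    finally show "indicat_real {0<..T} s *\<^sub>R (WW k s \<omega> * HH l s \<omega> - AA k s \<omega>)\<^sup>2 \<le> indicat_real {0<..T} s *\<^sub>R (?h s + ?g s)"
      by (auto simp: indicator_def)
    show "0 \<le> indicat_real {0<..T} s *\<^sub>R (?h s + ?g s)" by (auto simp: indicator_def)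
  qed
  also have "\<dots> = 2 * ?K\<^sup>2 * (LBINT s:{0<..T}. (HH l s \<omega> - a s \<omega> * Y s \<omega>)\<^sup>2) + 2 * G k \<omega>"
    unfolding set_integral_add(2)[OF hi gi] G_def by simp
  finally show ?thesis .
qed

text \<open>Here \<open>l\<close> tends to infinity in \<open>block_error_approx\<close> while
  \<open>k\<close> stays fixed. By \<open>energy_bound\<close> the limiting energy is at most
  \<open>2 * G k\<close>; dominated convergence applies on both sides because of the truncation at
  1.\<close>

lemma block_error:
  fixes c :: "nat \<Rightarrow> nat"
  assumes t: "0 \<le> t" "t \<le> T" and \<delta>: "0 < \<delta>"
  shows "(\<integral>\<omega>. min 1 (\<Sum>b\<in>c ` {..<n k}. (\<Sum>i\<in>{i\<in>{..<n k}. c i = b}. err t k i \<omega>)\<^sup>2) \<partial>M)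
     \<le> \<delta> + (\<integral>\<omega>. min 1 (2 * G k \<omega> / \<delta>) \<partial>M)"
proof -
  define p where "p i = min t (\<tau> k i)" for i
  have p0: "0 \<le> p i" "p i \<le> T" if "i \<le> n k" for i using stopped_nonneg[OF t(1) that] t by (auto simp: p_def)
  \<comment> \<open>Adding the errors at all nodes of grid \<open>k\<close> yields one subsequence
    along which the integrals converge almost surely at every node.\<close>
  define X where "X l \<omega> = (\<Sum>i\<le>n k. \<bar>SI l (p i) \<omega> - I (p i) \<omega>\<bar>)" for l \<omega>
  have d_meas: "(\<lambda>\<omega>. SI l (p i) \<omega> - I (p i) \<omega>) \<in> borel_measurable M" if "i \<le> n k" for i l
    using SI_meas[OF p0(1)[OF that]] I_meas[OF p0(1)[OF that]] by simp
  have X_meas: "X l \<in> borel_measurable M" for l unfolding X_def using d_meas by (intro borel_measurable_sum borel_measurable_abs) auto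
  have "(\<lambda>l. \<integral>\<omega>. min 1 \<bar>X l \<omega>\<bar> \<partial>M) \<longlonglongrightarrow> 0"
  proof (rule Lim_null_comparison)
    show "\<forall>\<^sub>F l in sequentially. norm (\<integral>\<omega>. min 1 \<bar>X l \<omega>\<bar> \<partial>M) \<le> (\<Sum>i\<le>n k. \<integral>\<omega>. min 1 \<bar>SI l (p i) \<omega> - I (p i) \<omega>\<bar> \<partial>M)"
    proof (intro always_eventually allI)
      fix l
      have "(\<integral>\<omega>. min 1 \<bar>X l \<omega>\<bar> \<partial>M) \<le> (\<integral>\<omega>. (\<Sum>i\<le>n k. min 1 \<bar>SI l (p i) \<omega> - I (p i) \<omega>\<bar>) \<partial>M)"
      proof (rule integral_mono)
        show "min 1 \<bar>X l \<omega>\<bar> \<le> (\<Sum>i\<le>n k. min 1 \<bar>SI l (p i) \<omega> - I (p i) \<omega>\<bar>)" for \<omega>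
          unfolding X_def using min1_sum[of "{..n k}" "\<lambda>i. \<bar>SI l (p i) \<omega> - I (p i) \<omega>\<bar>"] by (simp add: sum_nonneg)
      qed (use d_meas X_meas in \<open>auto intro!: min1_integrable Bochner_Integration.integrable_sum\<close>)
      also have "\<dots> = (\<Sum>i\<le>n k. \<integral>\<omega>. min 1 \<bar>SI l (p i) \<omega> - I (p i) \<omega>\<bar> \<partial>M)"
        using d_meas by (intro Bochner_Integration.integral_sum min1_integrable) auto
      finally show "norm (\<integral>\<omega>. min 1 \<bar>X l \<omega>\<bar> \<partial>M) \<le> (\<Sum>i\<le>n k. \<integral>\<omega>. min 1 \<bar>SI l (p i) \<omega> - I (p i) \<omega>\<bar> \<partial>M)"
        by (simp add: integral_nonneg_AE)
    qed
    have "(\<lambda>l. \<Sum>i\<le>n k. \<integral>\<omega>. min 1 \<bar>SI l (p i) \<omega> - I (p i) \<omega>\<bar> \<partial>M) \<longlonglongrightarrow> (\<Sum>i\<le>n k. 0)"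
      using p0 by (intro tendsto_sum I_conv) auto
    then show "(\<lambda>l. \<Sum>i\<le>n k. \<integral>\<omega>. min 1 \<bar>SI l (p i) \<omega> - I (p i) \<omega>\<bar> \<partial>M) \<longlonglongrightarrow> 0" by simp
  qed
  from min1_subseq[OF X_meas this] obtain r :: "nat \<Rightarrow> nat"
    where r: "strict_mono r" "AE \<omega> in M. (\<lambda>l. X (r l) \<omega>) \<longlonglongrightarrow> 0" by blast
  define e where "e l i \<omega> = w k i \<omega> * (SI l (p (Suc i)) \<omega> - SI l (p i) \<omega>) - A k i \<omega> * (W (p (Suc i)) \<omega> - W (p i) \<omega>)" for l i \<omega>
  have e_meas: "e l i \<in> borel_measurable M" if "i < n k" for l i
    unfolding e_def using that p0 
    by (intro borel_measurable_diff borel_measurable_times w_measM A_measM SI_meas W_measurable) auto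
  define Q where "Q l \<omega> = (\<Sum>b\<in>c ` {..<n k}. (\<Sum>i\<in>{i\<in>{..<n k}. c i = b}. e l i \<omega>)\<^sup>2)" for l \<omega>
  define Q' where "Q' \<omega> = (\<Sum>b\<in>c ` {..<n k}. (\<Sum>i\<in>{i\<in>{..<n k}. c i = b}. err t k i \<omega>)\<^sup>2)" for \<omega>
  have Q_meas: "Q l \<in> borel_measurable M" for l 
    unfolding Q_def by (intro borel_measurable_sum borel_measurable_power e_meas) auto
  have Q'_meas: "Q' \<in> borel_measurable M"
    unfolding Q'_def using t by (intro borel_measurable_sum borel_measurable_power err_meas) auto
  have Qnn: "0 \<le> Q l \<omega>" "0 \<le> Q' \<omega>" for l \<omega> by (auto simp: Q_def Q'_def intro!: sum_nonneg)
  define E where "E l \<omega> = (LBINT s:{0<..T}. (HH l s \<omega> - a s \<omega> * Y s \<omega>)\<^sup>2)" for l \<omega>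
  have E_meas[measurable]: "E l \<in> borel_measurable M" for l unfolding E_def by (rule HH_error_meas)
  have Enn: "0 \<le> E l \<omega>" for l \<omega> unfolding E_def set_lebesgue_integral_def by (intro integral_nonneg_AE) auto
  define K where "K \<omega> = 2 * (\<Sum>i<n k. \<bar>w k i \<omega>\<bar>)\<^sup>2" for \<omega>
  have K_meas[measurable]: "K \<in> borel_measurable M" unfolding K_def using w_measM by (intro borel_measurable_times borel_measurable_power borel_measurable_sum) auto
  have Knn: "0 \<le> K \<omega>" for \<omega> by (simp add: K_def)
  have lhs: "(\<lambda>l. \<integral>\<omega>. min 1 (Q (r l) \<omega>) \<partial>M) \<longlonglongrightarrow> (\<integral>\<omega>. min 1 (Q' \<omega>) \<partial>M)"
  proof (rule integral_dominated_convergence[where w="\<lambda>_. 1"])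
    show "AE \<omega> in M. (\<lambda>l. min 1 (Q (r l) \<omega>)) \<longlonglongrightarrow> min 1 (Q' \<omega>)"
      using r(2)
    proof eventually_elim
      case (elim \<omega>)
      have S: "(\<lambda>l. SI (r l) (p i) \<omega>) \<longlonglongrightarrow> I (p i) \<omega>" if "i \<le> n k" for i
      proof -
        have "(\<lambda>l. SI (r l) (p i) \<omega> - I (p i) \<omega>) \<longlonglongrightarrow> 0"
        proof (rule Lim_null_comparison[OF _ elim], intro always_eventually allI)
          fix l show "norm (SI (r l) (p i) \<omega> - I (p i) \<omega>) \<le> X (r l) \<omega>"
            unfolding X_def real_norm_def using that by (intro member_le_sum) auto
        qed
        then show ?thesis by (rule LIM_zero_cancel)
      qed
      have "(\<lambda>l. e (r l) i \<omega>) \<longlonglongrightarrow> err t k i \<omega>" if "i < n k" for i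
        unfolding e_def err_def p_def[symmetric] using that by (intro tendsto_intros S) auto
      then show ?case unfolding Q_def Q'_def by (intro tendsto_intros) auto
    qed
  qed (use Q_meas Q'_meas Qnn in auto)
  have rhs: "(\<lambda>l. \<integral>\<omega>. min 1 ((K \<omega> * E (r l) \<omega> + 2 * G k \<omega>) / \<delta>) \<partial>M) \<longlonglongrightarrow> (\<integral>\<omega>. min 1 ((K \<omega> * 0 + 2 * G k \<omega>) / \<delta>) \<partial>M)"
  proof (rule integral_dominated_convergence[where w="\<lambda>_. 1"])
    show "AE \<omega> in M. (\<lambda>l. min 1 ((K \<omega> * E (r l) \<omega> + 2 * G k \<omega>) / \<delta>)) \<longlonglongrightarrow> min 1 ((K \<omega> * 0 + 2 * G k \<omega>) / \<delta>)"
      using \<xi>_conv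
    proof eventually_elim
      case (elim \<omega>)
      from LIMSEQ_subseq_LIMSEQ[OF elim r(1)] have "(\<lambda>l. E (r l) \<omega>) \<longlonglongrightarrow> 0" by (simp add: E_def comp_def)
      then show ?case using \<delta> by (intro tendsto_intros) auto
    qed
    show "AE \<omega> in M. norm (min 1 ((K \<omega> * E (r l) \<omega> + 2 * G k \<omega>) / \<delta>)) \<le> 1" for l
      using Knn Enn G_nonneg \<delta> by (intro AE_I2) auto
  qed simp_all
  have "(\<integral>\<omega>. min 1 (Q l \<omega>) \<partial>M) \<le> \<delta> + (\<integral>\<omega>. min 1 ((K \<omega> * E l \<omega> + 2 * G k \<omega>) / \<delta>) \<partial>M)" for l
  proof -
    let ?N = "\<lambda>\<omega>. LBINT s:{0<..T}. (WW k s \<omega> * HH l s \<omega> - AA k s \<omega>)\<^sup>2"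
    have "?N \<in> borel_measurable M" by (rule time_integral_meas) measurable
    moreover have "0 \<le> ?N \<omega>" for \<omega> unfolding set_lebesgue_integral_def by (intro integral_nonneg_AE) auto
    moreover have "0 \<le> K \<omega> * E l \<omega> + 2 * G k \<omega>" for \<omega> using Knn Enn G_nonneg by simp
    moreover have "?N \<omega> \<le> K \<omega> * E l \<omega> + 2 * G k \<omega>" if "\<omega> \<in> space M" for \<omega>
      using energy_bound[OF that] by (simp add: K_def E_def)
    ultimately have "(\<integral>\<omega>. min 1 (?N \<omega> / \<delta>) \<partial>M) \<le> (\<integral>\<omega>. min 1 ((K \<omega> * E l \<omega> + 2 * G k \<omega>) / \<delta>) \<partial>M)"
    proof (intro integral_mono)
      assume *: "?N \<in> borel_measurable M" "\<And>\<omega>. 0 \<le> ?N \<omega>" "\<And>\<omega>. 0 \<le> K \<omega> * E l \<omega> + 2 * G k \<omega>"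
        "\<And>\<omega>. \<omega> \<in> space M \<Longrightarrow> ?N \<omega> \<le> K \<omega> * E l \<omega> + 2 * G k \<omega>"
      show "integrable M (\<lambda>\<omega>. min 1 (?N \<omega> / \<delta>))" "integrable M (\<lambda>\<omega>. min 1 ((K \<omega> * E l \<omega> + 2 * G k \<omega>) / \<delta>))"
        using *(1,2,3) \<delta> by (auto intro!: integrable_const_bound[where B=1])
      show "min 1 (?N \<omega> / \<delta>) \<le> min 1 ((K \<omega> * E l \<omega> + 2 * G k \<omega>) / \<delta>)" if "\<omega> \<in> space M" for \<omega>
        using *(4)[OF that] \<delta> by (intro min.mono divide_right_mono) auto
    qed
    then show ?thesis using block_error_approx[OF t \<delta>, where c=c and k=k and l=l] unfolding Q_def e_def p_def by linarith
  qed
  then have "(\<integral>\<omega>. min 1 (Q' \<omega>) \<partial>M) \<le> \<delta> + (\<integral>\<omega>. min 1 ((K \<omega> * 0 + 2 * G k \<omega>) / \<delta>) \<partial>M)"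
    by (intro LIMSEQ_le[OF lhs tendsto_add[OF tendsto_const[of \<delta>] rhs]]) auto
  then show ?thesis unfolding Q'_def by simp
qed

lemma block_error_tendsto:
  fixes c :: "nat \<Rightarrow> nat"
  assumes t: "0 \<le> t" "t \<le> T"
  shows "(\<lambda>k. \<integral>\<omega>. min 1 (\<Sum>b\<in>c ` {..<n k}. (\<Sum>i\<in>{i\<in>{..<n k}. c i = b}. err t k i \<omega>)\<^sup>2) \<partial>M) \<longlonglongrightarrow> 0"
proof (rule LIMSEQ_I)
  fix x :: real assume x: "0 < x"
  define \<delta> where "\<delta> = x / 2"
  have \<delta>: "0 < \<delta>" using x by (simp add: \<delta>_def)
  have "(\<lambda>k. \<integral>\<omega>. min 1 \<bar>2 * G k \<omega> / \<delta>\<bar> \<partial>M) \<longlonglongrightarrow> 0"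
  proof (rule min1_of_AE)
    show "AE \<omega> in M. (\<lambda>k. 2 * G k \<omega> / \<delta>) \<longlonglongrightarrow> 0"
      using G_tendsto
    proof eventually_elim
      case (elim \<omega>)
      have "(\<lambda>k. 2 * G k \<omega> / \<delta>) \<longlonglongrightarrow> 2 * 0 / \<delta>" using \<delta> by (intro tendsto_intros elim) auto
      then show ?case by simp
    qed
  qed simp
  then have "\<forall>\<^sub>F k in sequentially. (\<integral>\<omega>. min 1 \<bar>2 * G k \<omega> / \<delta>\<bar> \<partial>M) < \<delta>"
    by (rule order_tendstoD(2)) (rule \<delta>)
  then have "\<forall>\<^sub>F k in sequentially. norm ((\<integral>\<omega>. min 1 (\<Sum>b\<in>c ` {..<n k}. (\<Sum>i\<in>{i\<in>{..<n k}. c i = b}. err t k i \<omega>)\<^sup>2) \<partial>M) - 0) < x"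
  proof eventually_elim
    case (elim k)
    have "0 \<le> (\<integral>\<omega>. min 1 (\<Sum>b\<in>c ` {..<n k}. (\<Sum>i\<in>{i\<in>{..<n k}. c i = b}. err t k i \<omega>)\<^sup>2) \<partial>M)"
      by (intro integral_nonneg_AE AE_I2) (auto intro!: sum_nonneg)
    moreover have "\<bar>2 * G k \<omega> / \<delta>\<bar> = 2 * G k \<omega> / \<delta>" for \<omega> using G_nonneg \<delta> by simp
    ultimately show ?case using block_error[OF t \<delta>, where c=c and k=k] elim by (simp add: \<delta>_def)
  qed
  then show "\<exists>no. \<forall>k\<ge>no. norm ((\<integral>\<omega>. min 1 (\<Sum>b\<in>c ` {..<n k}. (\<Sum>i\<in>{i\<in>{..<n k}. c i = b}. err t k i \<omega>)\<^sup>2) \<partial>M) - 0) < x"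
    by (simp add: eventually_sequentially)
qed

lemma err_square_tendsto:
  assumes t: "0 \<le> t" "t \<le> T"
  shows "(\<lambda>k. \<integral>\<omega>. min 1 (\<Sum>i<n k. (err t k i \<omega>)\<^sup>2) \<partial>M) \<longlonglongrightarrow> 0"
proof -
  have "(\<Sum>b\<in>id ` {..<n k}. (\<Sum>i\<in>{i\<in>{..<n k}. id i = b}. err t k i \<omega>)\<^sup>2) = (\<Sum>i<n k. (err t k i \<omega>)\<^sup>2)" for k \<omega>
    unfolding image_id id_apply
  proof (rule sum.cong[OF refl])
    fix b assume "b \<in> {..<n k}"
    then have "{i\<in>{..<n k}. i = b} = {b}" by auto
    then show "(\<Sum>i\<in>{i\<in>{..<n k}. i = b}. err t k i \<omega>)\<^sup>2 = (err t k b \<omega>)\<^sup>2" by simp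
  qed
  with block_error_tendsto[OF t, where c=id] show ?thesis by simp
qed

lemma n_pos: "0 < n k"
  using \<tau>_0[of k] \<tau>_n[of k] T by (cases "n k") auto

lemma err_sum_tendsto:
  assumes t: "0 \<le> t" "t \<le> T"
  shows "(\<lambda>k. \<integral>\<omega>. min 1 ((\<Sum>i<n k. err t k i \<omega>)\<^sup>2) \<partial>M) \<longlonglongrightarrow> 0"
proof -
  have "(\<Sum>b\<in>(\<lambda>_. 0::nat) ` {..<n k}. (\<Sum>i\<in>{i\<in>{..<n k}. 0 = b}. err t k i \<omega>)\<^sup>2) = (\<Sum>i<n k. err t k i \<omega>)\<^sup>2" for k \<omega>
  proof -
    have img: "(\<lambda>_. 0::nat) ` {..<n k} = {0}" using n_pos[of k] by auto
    show ?thesis unfolding img by (simp flip: lessThan_def)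
  qed
  with block_error_tendsto[OF t, where c="\<lambda>_. 0"] show ?thesis by simp
qed

end

subsection \<open>The logarithm of the discounted price\<close>

lemma set_integrable_bounded_mult:
  fixes f g :: "real \<Rightarrow> real"
  assumes f: "set_integrable lborel {0<..t} f" and g: "g \<in> borel_measurable borel"
    and bd: "\<And>s. 0 < s \<Longrightarrow> s \<le> t \<Longrightarrow> \<bar>g s\<bar> \<le> K"
  shows "set_integrable lborel {0<..t} (\<lambda>s. f s * g s)"
  unfolding set_integrable_def
proof (rule Bochner_Integration.integrable_bound[where f="\<lambda>s. K * (indicator {0<..t} s *\<^sub>R f s)"])
  have m: "(\<lambda>s. indicator {0<..t} s *\<^sub>R f s) \<in> borel_measurable lborel"
    using f unfolding set_integrable_def by (rule borel_measurable_integrable)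
  show "integrable lborel (\<lambda>s. K * (indicator {0<..t} s *\<^sub>R f s))"
    using f unfolding set_integrable_def by simp
  have "(\<lambda>s. indicator {0<..t} s *\<^sub>R (f s * g s)) = (\<lambda>s. (indicator {0<..t} s *\<^sub>R f s) * g s)" by auto
  then show "(\<lambda>s. indicator {0<..t} s *\<^sub>R (f s * g s)) \<in> borel_measurable lborel"
    using m g by simp
  show "AE s in lborel. norm (indicator {0<..t} s *\<^sub>R (f s * g s)) \<le> norm (K * (indicator {0<..t} s *\<^sub>R f s))"
  proof (rule AE_I2)
    fix s :: real
    show "norm (indicator {0<..t} s *\<^sub>R (f s * g s)) \<le> norm (K * (indicator {0<..t} s *\<^sub>R f s))"
    proof (cases "0 < s \<and> s \<le> t")
      case True
      then have "\<bar>g s\<bar> \<le> \<bar>K\<bar>" using bd[of s] by auto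
      then have "\<bar>f s\<bar> * \<bar>g s\<bar> \<le> \<bar>f s\<bar> * \<bar>K\<bar>" by (intro mult_left_mono) auto
      then show ?thesis using True by (simp add: abs_mult mult.commute)
    qed simp
  qed
qed

lemma set_integral_Ioc_diff:
  fixes f :: "real \<Rightarrow> real"
  assumes f: "set_integrable lborel {0<..T} f" and "0 \<le> u" "u \<le> v" "v \<le> T"
  shows "(LBINT s:{0<..v}. f s) - (LBINT s:{0<..u}. f s) = (LBINT s:{u<..v}. f s)"
proof -
  have 1: "set_integrable lborel {0<..u} f" "set_integrable lborel {u<..v} f"
    using f by (rule set_integrable_subset; use assms in force)+
  have "{0<..v} = {0<..u} \<union> {u<..v}" using assms by auto
  then have "(LBINT s:{0<..v}. f s) = (LBINT s:{0<..u}. f s) + (LBINT s:{u<..v}. f s)"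
    using set_integral_Un[OF _ 1] by auto
  then show ?thesis by simp
qed

context ito_approx
begin

abbreviation "R t \<omega> \<equiv> (LBINT s:{0<..t}. r s \<omega>)"

text \<open>The logarithm of the stochastic exponential of the simple integral of \<open>A\<close>:
  the integral minus half of its compensator. The discounted price, divided by its initial value, is
  the stochastic exponential for the volatility \<open>a\<close>.\<close>

definition approx_log :: "real \<Rightarrow> nat \<Rightarrow> 'a \<Rightarrow> real" where
  "approx_log t k \<omega> = simple_integral (n k) (\<tau> k) (A k) W t \<omega>
     - (\<Sum>i<n k. (A k i \<omega>)\<^sup>2 * (min t (\<tau> k (Suc i)) - min t (\<tau> k i))) / 2"

text \<open>By the equation, \<open>b\<close> is the integral of \<open>r * Y\<close> over the
  stopped cell divided by the price at its left end. There the price ratio is within \<eta> of 1, so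
  \<open>b\<close> differs from the integral of \<open>r\<close> by at most \<eta> times the
  integral of \<open>\<bar>r\<bar>\<close>.\<close>

lemma drift_increment:
  assumes \<omega>: "\<omega> \<in> space M" and r: "set_integrable lborel {0<..T} (\<lambda>s. r s \<omega>)"
    and sde: "\<forall>t. 0 \<le> t \<longrightarrow> t \<le> T \<longrightarrow> Y t \<omega> = s0 + (LBINT s:{0<..t}. r s \<omega> * Y s \<omega>) + I t \<omega>"
    and t: "0 \<le> t" "t \<le> T" and i: "i < n k" and \<eta>: "0 \<le> \<eta>"
    and near: "\<And>s. \<tau> k i < s \<Longrightarrow> s \<le> \<tau> k (Suc i) \<Longrightarrow> \<bar>Y s \<omega> / Y (\<tau> k i) \<omega> - 1\<bar> \<le> \<eta>"
  defines "p \<equiv> \<lambda>i. min t (\<tau> k i)"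
  defines "b \<equiv> w k i \<omega> * (Y (p (Suc i)) \<omega> - Y (p i) \<omega>) - w k i \<omega> * (I (p (Suc i)) \<omega> - I (p i) \<omega>)"
  defines "\<rho> \<equiv> \<lambda>t. LBINT s:{0<..t}. \<bar>r s \<omega>\<bar>"
  shows "\<bar>b - (R (p (Suc i)) \<omega> - R (p i) \<omega>)\<bar> \<le> \<eta> * (\<rho> (p (Suc i)) - \<rho> (p i))"
    and "\<bar>b\<bar> \<le> (1 + \<eta>) * (\<rho> (p (Suc i)) - \<rho> (p i))"
proof -
  obtain K where K: "0 < K" "\<And>t. 0 \<le> t \<Longrightarrow> t \<le> T \<Longrightarrow> Y t \<omega> \<le> K" by (rule Y_bounds[OF \<omega>]) blast
  have pm: "p i \<le> p (Suc i)" using stopped_mono[OF i] by (simp add: p_def)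
  have pb: "0 \<le> p i" "p (Suc i) \<le> T" "0 \<le> p (Suc i)" "p i \<le> T" using stopped_nonneg[OF t(1), of _ k] i t by (auto simp: p_def)
  have rY: "set_integrable lborel {0<..T} (\<lambda>s. r s \<omega> * Y s \<omega>)"
  proof (rule set_integrable_bounded_mult[OF r Y_time[OF \<omega>]])
    fix s assume "0 < s" "s \<le> T"
    then show "\<bar>Y s \<omega>\<bar> \<le> K" using K(2)[of s] Y_pos[of s \<omega>] \<omega> by auto
  qed
  have ra: "set_integrable lborel {0<..T} (\<lambda>s. \<bar>r s \<omega>\<bar>)" using r by (rule set_integrable_abs)
  let ?c = "{p i<..p (Suc i)}"
  have sub: "?c \<subseteq> {0<..T}" using pb by auto
  have ic: "set_integrable lborel ?c (\<lambda>s. r s \<omega> * Y s \<omega>)" "set_integrable lborel ?c (\<lambda>s. r s \<omega>)" "set_integrable lborel ?c (\<lambda>s. \<bar>r s \<omega>\<bar>)"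
    using rY r ra by (auto intro: set_integrable_subset[OF _ _ sub])
  have sdep: "Y (p j) \<omega> = s0 + (LBINT s:{0<..p j}. r s \<omega> * Y s \<omega>) + I (p j) \<omega>" if "j \<le> n k" for j
    using sde stopped_nonneg[OF t(1) that] t by (auto simp: p_def)
  have "b = w k i \<omega> * ((LBINT s:{0<..p (Suc i)}. r s \<omega> * Y s \<omega>) - (LBINT s:{0<..p i}. r s \<omega> * Y s \<omega>))"
    unfolding b_def using sdep[of i] sdep[of "Suc i"] i by (simp add: algebra_simps)
  also have "\<dots> = w k i \<omega> * (LBINT s:?c. r s \<omega> * Y s \<omega>)"
    by (subst set_integral_Ioc_diff[OF rY]) (use pb pm in auto)
  also have "\<dots> = (LBINT s:?c. w k i \<omega> * (r s \<omega> * Y s \<omega>))" by simp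
  finally have b: "b = (LBINT s:?c. w k i \<omega> * (r s \<omega> * Y s \<omega>))" .
  have Rd: "R (p (Suc i)) \<omega> - R (p i) \<omega> = (LBINT s:?c. r s \<omega>)"
    by (rule set_integral_Ioc_diff[OF r]) (use pb pm in auto)
  have \<rho>d: "\<rho> (p (Suc i)) - \<rho> (p i) = (LBINT s:?c. \<bar>r s \<omega>\<bar>)"
    unfolding \<rho>_def by (rule set_integral_Ioc_diff[OF ra]) (use pb pm in auto)
  have wi: "set_integrable lborel ?c (\<lambda>s. w k i \<omega> * (r s \<omega> * Y s \<omega>))" using ic(1) by simp
  have di: "set_integrable lborel ?c (\<lambda>s. w k i \<omega> * (r s \<omega> * Y s \<omega>) - r s \<omega>)"
    by (rule set_integral_diff(1)[OF wi ic(2)])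
  have "b - (R (p (Suc i)) \<omega> - R (p i) \<omega>) = (LBINT s:?c. w k i \<omega> * (r s \<omega> * Y s \<omega>) - r s \<omega>)"
    unfolding b Rd by (rule set_integral_diff(2)[OF wi ic(2), symmetric])
  also have "\<bar>\<dots>\<bar> \<le> (LBINT s:?c. \<bar>w k i \<omega> * (r s \<omega> * Y s \<omega>) - r s \<omega>\<bar>)"
    using set_integral_norm_bound[OF di] by simp
  also have "\<dots> \<le> (LBINT s:?c. \<eta> * \<bar>r s \<omega>\<bar>)"
  proof (rule set_integral_mono)
    show "set_integrable lborel ?c (\<lambda>s. \<bar>w k i \<omega> * (r s \<omega> * Y s \<omega>) - r s \<omega>\<bar>)" using di by (rule set_integrable_abs)
    show "set_integrable lborel ?c (\<lambda>s. \<eta> * \<bar>r s \<omega>\<bar>)" using ic(3) by simp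
    fix s assume s: "s \<in> ?c"
    then have "\<tau> k i < s" "s \<le> \<tau> k (Suc i)" using \<tau>_le[OF i] by (auto simp: p_def min_def split: if_splits)
    then have n: "\<bar>Y s \<omega> / Y (\<tau> k i) \<omega> - 1\<bar> \<le> \<eta>" by (rule near)
    have "w k i \<omega> * (r s \<omega> * Y s \<omega>) - r s \<omega> = (Y s \<omega> / Y (\<tau> k i) \<omega> - 1) * r s \<omega>" by (simp add: w_def field_simps)
    then show "\<bar>w k i \<omega> * (r s \<omega> * Y s \<omega>) - r s \<omega>\<bar> \<le> \<eta> * \<bar>r s \<omega>\<bar>" using n by (simp add: abs_mult mult_right_mono)
  qed
  also have "\<dots> = \<eta> * (\<rho> (p (Suc i)) - \<rho> (p i))" unfolding \<rho>d by simp
  finally show 1: "\<bar>b - (R (p (Suc i)) \<omega> - R (p i) \<omega>)\<bar> \<le> \<eta> * (\<rho> (p (Suc i)) - \<rho> (p i))" .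
  have "\<bar>R (p (Suc i)) \<omega> - R (p i) \<omega>\<bar> \<le> \<rho> (p (Suc i)) - \<rho> (p i)"
    unfolding Rd \<rho>d using set_integral_norm_bound[OF ic(2)] by simp
  with 1 show "\<bar>b\<bar> \<le> (1 + \<eta>) * (\<rho> (p (Suc i)) - \<rho> (p i))" by (simp add: algebra_simps)
qed

text \<open>This is Ito's formula for the logarithm along one path. \<open>log_sum_limit\<close>
  applied to the relative increments of \<open>Y\<close> produces the correction Q / 2, which the
  compensator inside \<open>approx_log\<close> removes. Only the errors of the integral and of the
  quadratic variation need the subsequence \<open>q\<close>; the drift and the compensator converge
  along all grids.\<close>

lemma approx_log_pathwise:
  assumes \<omega>: "\<omega> \<in> space M" and r: "set_integrable lborel {0<..T} (\<lambda>s. r s \<omega>)"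
    and sde: "\<forall>t. 0 \<le> t \<longrightarrow> t \<le> T \<longrightarrow> Y t \<omega> = s0 + (LBINT s:{0<..t}. r s \<omega> * Y s \<omega>) + I t \<omega>"
    and t: "0 \<le> t" "t \<le> T"
    and AA: "(\<lambda>k. LBINT s:{0<..T}. \<bar>(AA k s \<omega>)\<^sup>2 - (a s \<omega>)\<^sup>2\<bar>) \<longlonglongrightarrow> 0"
    and q: "strict_mono (q :: nat \<Rightarrow> nat)"
    and e2: "(\<lambda>k. \<Sum>i<n (q k). (err t (q k) i \<omega>)\<^sup>2) \<longlonglongrightarrow> 0"
    and e1: "(\<lambda>k. \<Sum>i<n (q k). err t (q k) i \<omega>) \<longlonglongrightarrow> 0"
    and V: "(\<lambda>k. V t (q k) \<omega>) \<longlonglongrightarrow> 0"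
  shows "(\<lambda>k. approx_log t (q k) \<omega>) \<longlonglongrightarrow> ln (Y t \<omega>) - R t \<omega> - ln s0"
proof -
  define p where "p k i = min t (\<tau> k i)" for k i
  define \<rho> where "\<rho> t = (LBINT s:{0<..t}. \<bar>r s \<omega>\<bar>)" for t
  define x where "x k i = Y (p k (Suc i)) \<omega> / Y (p k i) \<omega> - 1" for k i
  define b where "b k i = w k i \<omega> * (Y (p k (Suc i)) \<omega> - Y (p k i) \<omega>) - w k i \<omega> * (I (p k (Suc i)) \<omega> - I (p k i) \<omega>)" for k i
  define v where "v k i = A k i \<omega> * (W (p k (Suc i)) \<omega> - W (p k i) \<omega>)" for k i
  define Q where "Q = (LBINT s:{0<..t}. (a s \<omega>)\<^sup>2)"
  define h where "h k = (\<Sum>i<n k. (A k i \<omega>)\<^sup>2 * (p k (Suc i) - p k i))" for k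
  have pm: "p k i \<le> p k (Suc i)" if "i < n k" for k i using stopped_mono[OF that] by (simp add: p_def)
  have pb: "0 \<le> p k i" "p k i \<le> T" if "i \<le> n k" for k i using stopped_nonneg[OF t(1) that] t by (auto simp: p_def)
  \<comment> \<open>The weight \<open>w\<close> belongs to the node, the ratio \<open>x\<close> to
    the stopped node. These differ only for cells beyond t, where both sides are 0.\<close>
  have w_x: "w k i \<omega> * (Y (p k (Suc i)) \<omega> - Y (p k i) \<omega>) = x k i" if i: "i < n k" for k i
  proof (cases "\<tau> k i \<le> t")
    case True
    then have "p k i = \<tau> k i" by (simp add: p_def)
    then show ?thesis using Y_pos[OF pb(1)[of i k] \<omega>] i by (simp add: w_def x_def field_simps)
  next
    case False
    then have "p k i = t" "p k (Suc i) = t" using \<tau>_le[OF i] by (auto simp: p_def)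
    then show ?thesis using Y_pos[OF t(1) \<omega>] by (simp add: x_def)
  qed
  obtain K where K: "0 < K" "\<And>t. 0 \<le> t \<Longrightarrow> t \<le> T \<Longrightarrow> 1 / Y t \<omega> \<le> K" by (rule Y_bounds[OF \<omega>]) blast
  have wK: "0 \<le> w k i \<omega>" "w k i \<omega> \<le> K" if "i < n k" for k i
    using Y_pos[OF \<tau>_nonneg[of i k] \<omega>] K(2)[OF \<tau>_nonneg[of i k] \<tau>_le_T[of i k]] that by (auto simp: w_def)
  have near: "\<forall>\<^sub>F k in sequentially. \<forall>i<n k. \<bar>x k i\<bar> \<le> \<eta> \<and> (\<forall>s. \<tau> k i < s \<longrightarrow> s \<le> \<tau> k (Suc i) \<longrightarrow> \<bar>Y s \<omega> / Y (\<tau> k i) \<omega> - 1\<bar> \<le> \<eta>)"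
    if eta: "0 < \<eta>" for \<eta>
  proof -
    obtain d where d: "0 < d" "\<And>s s'. 0 \<le> s \<Longrightarrow> s \<le> T \<Longrightarrow> 0 \<le> s' \<Longrightarrow> s' \<le> T \<Longrightarrow> \<bar>s - s'\<bar> < d \<Longrightarrow> \<bar>Y s \<omega> / Y s' \<omega> - 1\<bar> \<le> \<eta>"
      using Y_ratio[OF \<omega> eta] by metis
    from mesh_eventually[OF d(1)] show ?thesis
    proof eventually_elim
      case (elim k)
      show ?case
      proof (intro allI impI conjI)
        fix i assume i: "i < n k"
        have dd: "\<tau> k (Suc i) - \<tau> k i < d" using elim i by simp
        have "p k (Suc i) - p k i \<le> \<tau> k (Suc i) - \<tau> k i" using \<tau>_le[OF i] by (auto simp: p_def min_def)
        then show "\<bar>x k i\<bar> \<le> \<eta>" unfolding x_def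
          using pm[OF i] dd pb[of i k] pb[of "Suc i" k] i by (intro d(2)) auto
        fix s assume "\<tau> k i < s" "s \<le> \<tau> k (Suc i)"
        then show "\<bar>Y s \<omega> / Y (\<tau> k i) \<omega> - 1\<bar> \<le> \<eta>"
          using dd \<tau>_nonneg[of i k] \<tau>_le_T[of i k] \<tau>_le_T[of "Suc i" k] i by (intro d(2)) auto
      qed
    qed
  qed
  have Ismall: "\<forall>\<^sub>F k in sequentially. \<forall>i<n k. \<bar>I (p k (Suc i)) \<omega> - I (p k i) \<omega>\<bar> \<le> \<eta>" if eta: "0 < \<eta>" for \<eta>
  proof -
    obtain d where d: "0 < d" "\<And>s s'. 0 \<le> s \<Longrightarrow> s \<le> T \<Longrightarrow> 0 \<le> s' \<Longrightarrow> s' \<le> T \<Longrightarrow> \<bar>s - s'\<bar> < d \<Longrightarrow> \<bar>I s \<omega> - I s' \<omega>\<bar> < \<eta>"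
      using uniform_modulus[OF I_cont[OF \<omega>] eta] by metis
    from mesh_eventually[OF d(1)] show ?thesis
    proof eventually_elim
      case (elim k)
      show ?case
      proof (intro allI impI)
        fix i assume i: "i < n k"
        have dd: "\<tau> k (Suc i) - \<tau> k i < d" using elim i by simp
        have "p k (Suc i) - p k i \<le> \<tau> k (Suc i) - \<tau> k i" using \<tau>_le[OF i] by (auto simp: p_def min_def)
        then show "\<bar>I (p k (Suc i)) \<omega> - I (p k i) \<omega>\<bar> \<le> \<eta>"
          using pm[OF i] dd pb[of i k] pb[of "Suc i" k] i by (intro less_imp_le[OF d(2)]) auto
      qed
    qed
  qed
  note di = drift_increment[OF \<omega> r sde t, folded p_def \<rho>_def, folded b_def]
  have \<rho>m: "0 \<le> \<rho> t" unfolding \<rho>_def set_lebesgue_integral_def by (intro integral_nonneg_AE) auto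
  have \<rho>0: "\<rho> 0 = 0" unfolding \<rho>_def by (simp add: set_lebesgue_integral_def)
  have \<rho>sum: "(\<Sum>i<n k. \<rho> (p k (Suc i)) - \<rho> (p k i)) = \<rho> t" for k
    using stopped_sum[OF t, of \<rho> k] \<rho>0 by (simp add: p_def)
  have Rsum: "(\<Sum>i<n k. R (p k (Suc i)) \<omega> - R (p k i) \<omega>) = R t \<omega>" for k
    using stopped_sum[OF t, of "\<lambda>t. R t \<omega>" k] by (simp add: p_def set_lebesgue_integral_def)
  have b1: "(\<lambda>k. (\<Sum>i<n k. b k i)) \<longlonglongrightarrow> R t \<omega>"
  proof (rule LIMSEQ_I)
    fix z :: real assume z: "0 < z"
    define \<eta> where "\<eta> = z / (\<rho> t + 1)"
    have \<eta>: "0 < \<eta>" "\<eta> * \<rho> t < z" using z \<rho>m by (auto simp: \<eta>_def field_simps add_nonneg_pos)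
    from near[OF \<eta>(1)] have "\<forall>\<^sub>F k in sequentially. norm ((\<Sum>i<n k. b k i) - R t \<omega>) < z"
    proof eventually_elim
      case (elim k)
      have "\<bar>(\<Sum>i<n k. b k i) - R t \<omega>\<bar> = \<bar>\<Sum>i<n k. b k i - (R (p k (Suc i)) \<omega> - R (p k i) \<omega>)\<bar>"
        by (simp only: sum_subtractf Rsum[of k, unfolded sum_subtractf] Rsum[unfolded sum_subtractf, symmetric])
      also have "\<dots> \<le> (\<Sum>i<n k. \<bar>b k i - (R (p k (Suc i)) \<omega> - R (p k i) \<omega>)\<bar>)" by (rule sum_abs)
      also have "\<dots> \<le> (\<Sum>i<n k. \<eta> * (\<rho> (p k (Suc i)) - \<rho> (p k i)))"
        using elim \<eta>(1) by (intro sum_mono di(1)) auto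
      also have "\<dots> = \<eta> * \<rho> t" by (simp only: sum_distrib_left[symmetric] \<rho>sum)
      finally show ?case using \<eta>(2) by simp
    qed
    then show "\<exists>no. \<forall>k\<ge>no. norm ((\<Sum>i<n k. b k i) - R t \<omega>) < z" by (simp add: eventually_sequentially)
  qed
  \<comment> \<open>A sum of squares is at most the largest term times the sum of the absolute
    values. The largest term is small because \<open>b\<close> is a relative price increment minus a
    weighted increment of \<open>I\<close>, each at most \<eta> / 2; the cap at 1 in the first
    tolerance bounds the sum of the absolute values by twice \<rho>(t).\<close>
  have b2: "(\<lambda>k. (\<Sum>i<n k. (b k i)\<^sup>2)) \<longlonglongrightarrow> 0"
  proof (rule LIMSEQ_I)
    fix z :: real assume z: "0 < z"
    define \<eta> where "\<eta> = z / (2 * (\<rho> t + 1))"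
    have \<eta>: "0 < \<eta>" "\<eta> * (2 * \<rho> t) < z" using z \<rho>m by (auto simp: \<eta>_def field_simps add_nonneg_pos)
    have \<eta>': "0 < min 1 (\<eta> / 2)" "0 < \<eta> / (2 * K)" using \<eta>(1) K(1) by auto
    from near[OF \<eta>'(1)] Ismall[OF \<eta>'(2)]
    have "\<forall>\<^sub>F k in sequentially. norm ((\<Sum>i<n k. (b k i)\<^sup>2) - 0) < z"
    proof eventually_elim
      case (elim k)
      have "(\<Sum>i<n k. (b k i)\<^sup>2) \<le> (\<Sum>i<n k. \<eta> * (2 * (\<rho> (p k (Suc i)) - \<rho> (p k i))))"
      proof (rule sum_mono)
        fix i assume "i \<in> {..<n k}"
        then have i: "i < n k" by simp
        have "\<bar>w k i \<omega> * (I (p k (Suc i)) \<omega> - I (p k i) \<omega>)\<bar> \<le> K * (\<eta> / (2 * K))"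
          unfolding abs_mult using elim(2) i wK[OF i] K(1) by (intro mult_mono) auto
        moreover have "\<bar>x k i\<bar> \<le> \<eta> / 2" using elim(1) i by auto
        ultimately have 1: "\<bar>b k i\<bar> \<le> \<eta>" unfolding b_def w_x[OF i] using K(1) by simp
        have "\<bar>b k i\<bar> \<le> (1 + 1) * (\<rho> (p k (Suc i)) - \<rho> (p k i))"
          using elim(1) i by (intro di(2)) auto
        then have "\<bar>b k i\<bar> * \<bar>b k i\<bar> \<le> \<eta> * (2 * (\<rho> (p k (Suc i)) - \<rho> (p k i)))"
          using 1 \<eta>(1) by (intro mult_mono) auto
        then show "(b k i)\<^sup>2 \<le> \<eta> * (2 * (\<rho> (p k (Suc i)) - \<rho> (p k i)))" by (simp add: power2_eq_square)
      qed
      also have "\<dots> = \<eta> * (2 * \<rho> t)" by (simp only: sum_distrib_left[symmetric] \<rho>sum)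
      finally show ?case using \<eta>(2) by (simp add: sum_nonneg)
    qed
    then show "\<exists>no. \<forall>k\<ge>no. norm ((\<Sum>i<n k. (b k i)\<^sup>2) - 0) < z" by (simp add: eventually_sequentially)
  qed
  have hQ: "h \<longlonglongrightarrow> Q"
  proof -
    have "(\<lambda>k. h k - Q) \<longlonglongrightarrow> 0"
    proof (rule Lim_null_comparison[OF _ AA], intro always_eventually allI)
      fix k
      \<comment> \<open>Up to t a stopped cell carries the same coefficient as the original one, and
        beyond t the stopped cells are empty.\<close>
      have hA: "h k = (LBINT s:{0<..t}. (AA k s \<omega>)\<^sup>2)"
      proof -
        have ii: "integrable lborel (\<lambda>s. (A k i \<omega>)\<^sup>2 * indicator {p k i<..p k (Suc i)} s)" if "i < n k" for i
          using pm[OF that] by simp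
        have "h k = (\<Sum>i<n k. \<integral>s. (A k i \<omega>)\<^sup>2 * indicator {p k i<..p k (Suc i)} s \<partial>lborel)"
          unfolding h_def using pm by (intro sum.cong refl) simp
        also have "\<dots> = (\<integral>s. (\<Sum>i<n k. (A k i \<omega>)\<^sup>2 * indicator {p k i<..p k (Suc i)} s) \<partial>lborel)"
          using ii by (subst Bochner_Integration.integral_sum) auto
        also have "\<dots> = (LBINT s:{0<..t}. (AA k s \<omega>)\<^sup>2)"
          unfolding set_lebesgue_integral_def
        proof (rule Bochner_Integration.integral_cong[OF refl])
          fix s :: real
          show "(\<Sum>i<n k. (A k i \<omega>)\<^sup>2 * indicator {p k i<..p k (Suc i)} s) = indicat_real {0<..t} s *\<^sub>R (AA k s \<omega>)\<^sup>2"
          proof (cases "0 < s \<and> s \<le> t")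
            case True
            then obtain j where j: "j < n k" "\<tau> k j < s" "s \<le> \<tau> k (Suc j)" using cell[of s k] t by auto
            then have j': "p k j < s" "s \<le> p k (Suc j)" using True by (auto simp: p_def)
            show ?thesis using sum_cell[of "n k" "p k" j s "\<lambda>i. (A k i \<omega>)\<^sup>2", OF pm j(1) j'] process_cell[OF j, of "A k" \<omega>] True by simp
          next
            case False
            have "\<not> (p k i < s \<and> s \<le> p k (Suc i))" if "i < n k" for i
              using False pb[of i k] that by (auto simp: p_def)
            then have "(\<Sum>i<n k. (A k i \<omega>)\<^sup>2 * indicator {p k i<..p k (Suc i)} s) = 0"
              by (intro sum.neutral) (auto simp: indicator_def)
            then show ?thesis using False by (auto simp: indicator_def)
          qed
        qed
        finally show ?thesis .
      qed
      have AAi: "set_integrable lborel {0<..T} (\<lambda>s. (AA k s \<omega>)\<^sup>2)"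
      proof (rule set_integrable_bounded[where K="C\<^sup>2"])
        show "\<bar>(AA k s \<omega>)\<^sup>2\<bar> \<le> C\<^sup>2" if "0 < s" "s \<le> T" for s
          using power_mono[OF AA_bdd[OF that, of k \<omega>], of 2] by simp
      qed (intro borel_measurable_power simple_process_borel_time)
      have ai: "set_integrable lborel {0<..T} (\<lambda>s. (a s \<omega>)\<^sup>2)"
      proof (rule set_integrable_bounded[where K="C\<^sup>2"])
        show "\<bar>(a s \<omega>)\<^sup>2\<bar> \<le> C\<^sup>2" if "0 < s" "s \<le> T" for s
          using power_mono[OF a_bdd[of s \<omega>], of 2] that \<omega> by simp
      qed (intro borel_measurable_power a_time \<omega>)
      have sub: "{0<..t} \<subseteq> {0<..T}" using t by auto
      have i1: "set_integrable lborel {0<..t} (\<lambda>s. (AA k s \<omega>)\<^sup>2)" "set_integrable lborel {0<..t} (\<lambda>s. (a s \<omega>)\<^sup>2)"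
        using AAi ai by (auto intro: set_integrable_subset[OF _ _ sub])
      note i2 = set_integral_diff[OF AAi ai]
      have "h k - Q = (LBINT s:{0<..t}. (AA k s \<omega>)\<^sup>2 - (a s \<omega>)\<^sup>2)"
        unfolding hA Q_def using set_integral_diff(2)[OF i1] by simp
      then have "norm (h k - Q) \<le> (LBINT s:{0<..t}. \<bar>(AA k s \<omega>)\<^sup>2 - (a s \<omega>)\<^sup>2\<bar>)"
        using set_integral_norm_bound[OF set_integral_diff(1)[OF i1]] by simp
      also have "\<dots> \<le> (LBINT s:{0<..T}. \<bar>(AA k s \<omega>)\<^sup>2 - (a s \<omega>)\<^sup>2\<bar>)"
        unfolding set_lebesgue_integral_def
      proof (rule integral_mono')
        show "integrable lborel (\<lambda>s. indicat_real {0<..T} s *\<^sub>R \<bar>(AA k s \<omega>)\<^sup>2 - (a s \<omega>)\<^sup>2\<bar>)"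
          using set_integrable_abs[OF i2(1)] by (simp add: set_integrable_def)
      qed (use t in \<open>auto simp: indicator_def\<close>)
      finally show "norm (h k - Q) \<le> (LBINT s:{0<..T}. \<bar>(AA k s \<omega>)\<^sup>2 - (a s \<omega>)\<^sup>2\<bar>)" .
    qed
    then show ?thesis by (rule LIM_zero_cancel)
  qed
  have hq: "(\<lambda>k. h (q k)) \<longlonglongrightarrow> Q" using LIMSEQ_subseq_LIMSEQ[OF hQ q] by (simp add: comp_def)
  have s0: "s0 = Y 0 \<omega>" using Y0[OF \<omega>] by simp
  have v_lim: "(\<lambda>k. \<Sum>i<n (q k). v (q k) i) \<longlonglongrightarrow> (ln (Y t \<omega>) - ln s0) - R t \<omega> + Q / 2"
  proof (rule log_sum_limit[where n="\<lambda>k. n (q k)" and x="\<lambda>k. x (q k)" and b="\<lambda>k. b (q k)" and e="\<lambda>k i. err t (q k) i \<omega>" and v="\<lambda>k. v (q k)"])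
    show "x (q k) i = b (q k) i + err t (q k) i \<omega> + v (q k) i" if "i < n (q k)" for k i
      using w_x[OF that] by (simp add: b_def v_def err_def p_def)
    show "\<forall>\<^sub>F k in sequentially. \<forall>i<n (q k). \<bar>x (q k) i\<bar> \<le> \<eta>" if "0 < \<eta>" for \<eta>
    proof -
      from near[OF that] have "\<forall>\<^sub>F k in sequentially. \<forall>i<n k. \<bar>x k i\<bar> \<le> \<eta>" by eventually_elim blast
      then show ?thesis by (rule eventually_subseq[OF q])
    qed
    show "(\<lambda>k. \<Sum>i<n (q k). b (q k) i) \<longlonglongrightarrow> R t \<omega>" using LIMSEQ_subseq_LIMSEQ[OF b1 q] by (simp add: comp_def)
    show "(\<lambda>k. \<Sum>i<n (q k). (b (q k) i)\<^sup>2) \<longlonglongrightarrow> 0" using LIMSEQ_subseq_LIMSEQ[OF b2 q] by (simp add: comp_def)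
    have "(\<Sum>i<n k. (v k i)\<^sup>2) = V t k \<omega> + h k" for k
      unfolding V_def h_def v_def p_def sum.distrib[symmetric] by (intro sum.cong refl) (simp only: power_mult_distrib distrib_left[symmetric] diff_add_cancel)
    then show "(\<lambda>k. \<Sum>i<n (q k). (v (q k) i)\<^sup>2) \<longlonglongrightarrow> Q" using tendsto_add[OF V hq] by simp
    have "(\<Sum>i<n k. ln (1 + x k i)) = ln (Y t \<omega>) - ln s0" for k
    proof -
      have "(\<Sum>i<n k. ln (1 + x k i)) = (\<Sum>i<n k. ln (Y (p k (Suc i)) \<omega>) - ln (Y (p k i) \<omega>))"
      proof (intro sum.cong refl)
        fix i assume "i \<in> {..<n k}"
        then show "ln (1 + x k i) = ln (Y (p k (Suc i)) \<omega>) - ln (Y (p k i) \<omega>)"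
          using Y_pos[OF pb(1)[of i k] \<omega>] Y_pos[OF pb(1)[of "Suc i" k] \<omega>] by (simp add: x_def ln_div)
      qed
      also have "\<dots> = ln (Y t \<omega>) - ln (Y 0 \<omega>)" using stopped_sum[OF t, of "\<lambda>t. ln (Y t \<omega>)" k] by (simp add: p_def)
      finally show ?thesis by (simp add: s0)
    qed
    then show "(\<lambda>k. \<Sum>i<n (q k). ln (1 + x (q k) i)) \<longlonglongrightarrow> ln (Y t \<omega>) - ln s0" by simp
  qed (use e1 e2 in auto)
  have e: "approx_log t k \<omega> = (\<Sum>i<n k. v k i) - h k / 2" for k
    unfolding approx_log_def simple_integral_def v_def h_def p_def by simp
  have "(\<lambda>k. approx_log t (q k) \<omega>) \<longlonglongrightarrow> ln (Y t \<omega>) - ln s0 - R t \<omega> + Q / 2 - Q / 2"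
    unfolding e by (intro tendsto_diff v_lim tendsto_divide hq tendsto_const) simp
  moreover have "ln (Y t \<omega>) - ln s0 - R t \<omega> + Q / 2 - Q / 2 = ln (Y t \<omega>) - R t \<omega> - ln s0" by simp
  ultimately show ?thesis by (simp only:)
qed

lemma V_meas: "0 \<le> t \<Longrightarrow> V t k \<in> borel_measurable M"
  unfolding V_def using stopped_nonneg[of t _ k]
  by (intro borel_measurable_sum borel_measurable_times borel_measurable_power borel_measurable_diff borel_measurable_const A_measM W_measurable) auto

text \<open>The three errors are nonnegative and vanish in probability, so their sum does, and a
  single further subsequence makes all of them vanish almost surely. Starting from an arbitrary
  \<open>q\<close> matches the premise of \<open>LIMSEQ_subseqI\<close>.\<close>

lemma approx_log_subseq:
  assumes t: "0 \<le> t" "t \<le> T" and q: "strict_mono (q :: nat \<Rightarrow> nat)"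
  shows "\<exists>r' :: nat \<Rightarrow> nat. strict_mono r' \<and> (AE \<omega> in M. (\<lambda>k. approx_log t (q (r' k)) \<omega>) \<longlonglongrightarrow> ln (Y t \<omega>) - R t \<omega> - ln s0)"
proof -
  define X1 where "X1 k \<omega> = (\<Sum>i<n k. (err t k i \<omega>)\<^sup>2)" for k \<omega>
  define X2 where "X2 k \<omega> = (\<Sum>i<n k. err t k i \<omega>)\<^sup>2" for k \<omega>
  define X3 where "X3 k \<omega> = (V t k \<omega>)\<^sup>2" for k \<omega>
  have X: "0 \<le> X1 k \<omega>" "0 \<le> X2 k \<omega>" "0 \<le> X3 k \<omega>" for k \<omega>
    by (auto simp: X1_def X2_def X3_def intro!: sum_nonneg)
  have [measurable]: "X1 k \<in> borel_measurable M" "X2 k \<in> borel_measurable M" "X3 k \<in> borel_measurable M" for k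
    unfolding X1_def X2_def X3_def using t by (auto intro!: borel_measurable_sum borel_measurable_power err_meas V_meas)
  have i3: "integrable M (X3 k)" for k unfolding X3_def by (rule V_square(1)[OF t])
  have i12: "integrable M (\<lambda>\<omega>. min 1 (X1 k \<omega>))" "integrable M (\<lambda>\<omega>. min 1 (X2 k \<omega>))" for k
    using X by (auto intro!: integrable_const_bound[where B=1])
  have lim: "(\<lambda>k. \<integral>\<omega>. min 1 \<bar>X1 k \<omega> + X2 k \<omega> + X3 k \<omega>\<bar> \<partial>M) \<longlonglongrightarrow> 0"
  proof (rule Lim_null_comparison)
    show "\<forall>\<^sub>F k in sequentially. norm (\<integral>\<omega>. min 1 \<bar>X1 k \<omega> + X2 k \<omega> + X3 k \<omega>\<bar> \<partial>M)
        \<le> (\<integral>\<omega>. min 1 (X1 k \<omega>) \<partial>M) + (\<integral>\<omega>. min 1 (X2 k \<omega>) \<partial>M) + (\<integral>\<omega>. norm (X3 k \<omega>) \<partial>M)"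
    proof (intro always_eventually allI)
      fix k
      have "(\<integral>\<omega>. min 1 \<bar>X1 k \<omega> + X2 k \<omega> + X3 k \<omega>\<bar> \<partial>M) \<le> (\<integral>\<omega>. min 1 (X1 k \<omega>) + min 1 (X2 k \<omega>) + norm (X3 k \<omega>) \<partial>M)"
      proof (rule integral_mono)
        show "min 1 \<bar>X1 k \<omega> + X2 k \<omega> + X3 k \<omega>\<bar> \<le> min 1 (X1 k \<omega>) + min 1 (X2 k \<omega>) + norm (X3 k \<omega>)" for \<omega>
          using X[of k \<omega>] by (auto simp: min_def)
        show "integrable M (\<lambda>\<omega>. min 1 (X1 k \<omega>) + min 1 (X2 k \<omega>) + norm (X3 k \<omega>))" using i12 i3 by auto
      qed (auto intro!: min1_integrable)
      also have "\<dots> = (\<integral>\<omega>. min 1 (X1 k \<omega>) \<partial>M) + (\<integral>\<omega>. min 1 (X2 k \<omega>) \<partial>M) + (\<integral>\<omega>. norm (X3 k \<omega>) \<partial>M)"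
        using i12[of k] integrable_norm[OF i3[of k]] by simp
      finally show "norm (\<integral>\<omega>. min 1 \<bar>X1 k \<omega> + X2 k \<omega> + X3 k \<omega>\<bar> \<partial>M)
        \<le> (\<integral>\<omega>. min 1 (X1 k \<omega>) \<partial>M) + (\<integral>\<omega>. min 1 (X2 k \<omega>) \<partial>M) + (\<integral>\<omega>. norm (X3 k \<omega>) \<partial>M)"
        by (simp add: integral_nonneg_AE)
    qed
    show "(\<lambda>k. (\<integral>\<omega>. min 1 (X1 k \<omega>) \<partial>M) + (\<integral>\<omega>. min 1 (X2 k \<omega>) \<partial>M) + (\<integral>\<omega>. norm (X3 k \<omega>) \<partial>M)) \<longlonglongrightarrow> 0"
      using tendsto_add[OF tendsto_add[OF err_square_tendsto[OF t] err_sum_tendsto[OF t]] V_tendsto[OF t]]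
      by (simp add: X1_def X2_def X3_def)
  qed
  have limq: "(\<lambda>k. \<integral>\<omega>. min 1 \<bar>X1 (q k) \<omega> + X2 (q k) \<omega> + X3 (q k) \<omega>\<bar> \<partial>M) \<longlonglongrightarrow> 0"
    using LIMSEQ_subseq_LIMSEQ[OF lim q] by (simp add: comp_def)
  obtain r' :: "nat \<Rightarrow> nat" where r': "strict_mono r'"
    "AE \<omega> in M. (\<lambda>k. X1 (q (r' k)) \<omega> + X2 (q (r' k)) \<omega> + X3 (q (r' k)) \<omega>) \<longlonglongrightarrow> 0"
    by (rule min1_subseq[OF _ limq]) auto
  have qr: "strict_mono (\<lambda>k. q (r' k))" using q r'(1) by (auto simp: strict_mono_def)
  from r'(2) AE_space r_int sde AA_tendsto
  have "AE \<omega> in M. (\<lambda>k. approx_log t (q (r' k)) \<omega>) \<longlonglongrightarrow> ln (Y t \<omega>) - R t \<omega> - ln s0"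
  proof eventually_elim
    case (elim \<omega>)
    have sq0: "f \<longlonglongrightarrow> 0" if "(\<lambda>k. (f k)\<^sup>2) \<longlonglongrightarrow> 0" for f :: "nat \<Rightarrow> real"
      using tendsto_real_sqrt[OF that] by (simp add: tendsto_rabs_zero_iff)
    have l: "(\<lambda>k. X1 (q (r' k)) \<omega>) \<longlonglongrightarrow> 0" "(\<lambda>k. X2 (q (r' k)) \<omega>) \<longlonglongrightarrow> 0" "(\<lambda>k. X3 (q (r' k)) \<omega>) \<longlonglongrightarrow> 0"
      using X by (auto intro!: Lim_null_comparison[OF _ elim(1)] always_eventually)
    show ?case
      by (rule approx_log_pathwise[OF elim(2,3,4) t elim(5) qr l(1)[unfolded X1_def] sq0[OF l(2)[unfolded X2_def]] sq0[OF l(3)[unfolded X3_def]]])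
  qed
  with r'(1) show ?thesis by blast
qed

end

subsection \<open>The equation for the characteristic function\<close>

context bm_filtration
begin

lemma W_increment_char:
  assumes "0 \<le> s" "s \<le> t"
  shows "(\<integral>\<omega>. iexp (z * (W t \<omega> - W s \<omega>)) \<partial>M) = exp (complex_of_real (- (z\<^sup>2 * (t - s) / 2)))"
proof (cases "s = t")
  case True then show ?thesis by (simp add: prob_space)
next
  case False
  then have st: "s < t" using assms by simp
  define q where "q = sqrt (t - s)"
  have q: "0 < q" "q\<^sup>2 = t - s" using st by (auto simp: q_def)
  define U where "U \<omega> = (W t \<omega> - W s \<omega> - 0) / q" for \<omega>
  have D: "distributed M lborel U std_normal_density"
    unfolding U_def using W_increment_distr[OF assms(1) st] normal_standard_normal_convert[OF q(1)] by (simp add: q_def)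
  have U: "U \<in> M \<rightarrow>\<^sub>M lborel" using D by (rule distributed_measurable)
  have "(\<integral>\<omega>. iexp (z * (W t \<omega> - W s \<omega>)) \<partial>M) = (\<integral>\<omega>. iexp (z * q * U \<omega>) \<partial>M)"
    using q by (simp add: U_def)
  also have "\<dots> = (\<integral>x. iexp (z * q * x) \<partial>distr M lborel U)"
    by (subst integral_distr[OF U]) auto
  also have "distr M lborel U = std_normal_distribution"
    using D by (rule distributed_distr_eq_density)
  also have "(\<integral>x. iexp (z * q * x) \<partial>std_normal_distribution) = char std_normal_distribution (z * q)"
    by (simp add: char_def)
  also have "\<dots> = exp (complex_of_real (- (z\<^sup>2 * (t - s) / 2)))"
  proof -
    have "- (z * q)\<^sup>2 / 2 = - (z\<^sup>2 * (t - s) / 2)" using q(2) by (simp add: power_mult_distrib)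
    then show ?thesis unfolding char_std_normal_distribution by (simp only: exp_of_real)
  qed
  finally show ?thesis .
qed

text \<open>The pair of \<Phi> and \<zeta> is known at time s and independent of the increment, so
  their joint law is a product. By Fubini \<zeta> is held constant while the Gaussian increment is
  integrated out.\<close>

lemma W_increment_freeze:
  fixes \<Phi> :: "'a \<Rightarrow> complex" and \<zeta> :: "'a \<Rightarrow> real"
  assumes st: "0 \<le> s" "s \<le> t" and \<Phi>: "\<Phi> \<in> borel_measurable (F s)" "\<And>\<omega>. norm (\<Phi> \<omega>) \<le> B"
    and \<zeta>: "\<zeta> \<in> borel_measurable (F s)"
  shows "(\<integral>\<omega>. \<Phi> \<omega> * iexp (\<zeta> \<omega> * (W t \<omega> - W s \<omega>)) \<partial>M) = (\<integral>\<omega>. \<Phi> \<omega> * exp (complex_of_real (- ((\<zeta> \<omega>)\<^sup>2 * (t - s) / 2))) \<partial>M)"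
proof (cases "s = t")
  case True then show ?thesis by simp
next
  case False
  then have s: "s < t" using st by simp
  define X where "X \<omega> = (\<Phi> \<omega>, \<zeta> \<omega>)" for \<omega>
  define U where "U \<omega> = W t \<omega> - W s \<omega>" for \<omega>
  have XF: "X \<in> F s \<rightarrow>\<^sub>M borel \<Otimes>\<^sub>M borel" unfolding X_def using \<Phi> \<zeta> by simp
  have [measurable]: "X \<in> M \<rightarrow>\<^sub>M borel \<Otimes>\<^sub>M borel" using XF by (rule measurable_F_M)
  have [measurable]: "U \<in> borel_measurable M" unfolding U_def using W_measurable[of t] W_measurable[of s] st by simp
  have [measurable]: "\<Phi> \<in> borel_measurable M" "\<zeta> \<in> borel_measurable M" using \<Phi>(1) \<zeta> by (auto intro: measurable_F_M)
  \<comment> \<open>\<open>indep_var\<close> requires both variables to take values in the same type.\<close>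
  define U' where "U' \<omega> = (0 :: complex, U \<omega>)" for \<omega>
  have [measurable]: "U' \<in> M \<rightarrow>\<^sub>M borel \<Otimes>\<^sub>M borel" unfolding U'_def by measurable
  let ?D1 = "distr M (borel \<Otimes>\<^sub>M borel) X" and ?D2 = "distr M (borel \<Otimes>\<^sub>M borel) U'"
  have "indep_var (borel \<Otimes>\<^sub>M borel) X (borel \<Otimes>\<^sub>M borel) U'"
    using W_increment_indep[OF st(1) s XF, of "\<lambda>x. (0, x)" "borel \<Otimes>\<^sub>M borel"] by (simp add: U'_def[abs_def] U_def)
  then have eq: "?D1 \<Otimes>\<^sub>M ?D2 = distr M ((borel \<Otimes>\<^sub>M borel) \<Otimes>\<^sub>M (borel \<Otimes>\<^sub>M borel)) (\<lambda>\<omega>. (X \<omega>, U' \<omega>))"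
    unfolding indep_var_distribution_eq by simp
  interpret D1: prob_space ?D1 by (rule prob_space_distr) simp
  interpret D2: prob_space ?D2 by (rule prob_space_distr) simp
  interpret D: pair_sigma_finite ?D1 ?D2 ..
  define g where "g p = fst (fst p) * iexp (snd (fst p) * snd (snd p))" for p :: "(complex \<times> real) \<times> (complex \<times> real)"
  have g[measurable]: "g \<in> borel_measurable ((borel \<Otimes>\<^sub>M borel) \<Otimes>\<^sub>M (borel \<Otimes>\<^sub>M borel))" unfolding g_def by measurable
  have "integrable M (\<lambda>\<omega>. g (X \<omega>, U' \<omega>))"
    using \<Phi>(2) by (intro integrable_const_bound[where B=B]) (auto simp: g_def X_def U'_def norm_mult)
  then have gi: "integrable (?D1 \<Otimes>\<^sub>M ?D2) g" unfolding eq by (subst integrable_distr_eq) auto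
  have "(\<integral>\<omega>. \<Phi> \<omega> * iexp (\<zeta> \<omega> * (W t \<omega> - W s \<omega>)) \<partial>M) = (\<integral>\<omega>. g (X \<omega>, U' \<omega>) \<partial>M)"
    by (simp add: g_def X_def U_def U'_def)
  also have "\<dots> = integral\<^sup>L (?D1 \<Otimes>\<^sub>M ?D2) g" unfolding eq by (subst integral_distr) auto
  also have "\<dots> = (\<integral>x. (\<integral>y. g (x, y) \<partial>?D2) \<partial>?D1)" by (rule D.integral_fst'[OF gi, symmetric])
  also have "\<dots> = (\<integral>x. fst x * exp (complex_of_real (- ((snd x)\<^sup>2 * (t - s) / 2))) \<partial>?D1)"
  proof (intro Bochner_Integration.integral_cong refl)
    fix x :: "complex \<times> real"
    have "(\<integral>y. g (x, y) \<partial>?D2) = fst x * (\<integral>y. iexp (snd x * snd y) \<partial>?D2)" by (simp add: g_def)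
    also have "(\<integral>y. iexp (snd x * snd y) \<partial>?D2) = (\<integral>\<omega>. iexp (snd x * (W t \<omega> - W s \<omega>)) \<partial>M)"
      by (subst integral_distr) (auto simp: U_def U'_def)
    finally show "(\<integral>y. g (x, y) \<partial>?D2) = fst x * exp (complex_of_real (- ((snd x)\<^sup>2 * (t - s) / 2)))"
      using W_increment_char[OF st] by simp
  qed
  also have "\<dots> = (\<integral>\<omega>. \<Phi> \<omega> * exp (complex_of_real (- ((\<zeta> \<omega>)\<^sup>2 * (t - s) / 2))) \<partial>M)"
    by (subst integral_distr) (auto simp: X_def)
  finally show ?thesis .
qed

end

text \<open>For a constant volatility \<alpha> the logarithm is \<alpha> W - \<alpha>^2 t / 2; the
  Gaussian part contributes - u^2 / 2 and the drift - i u / 2 per unit of \<alpha>^2 t.\<close>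

definition char_exponent :: "real \<Rightarrow> complex" where "char_exponent u = - (complex_of_real (u\<^sup>2) + \<i> * complex_of_real u) / 2"

lemma norm_exp_char_exponent: "0 \<le> x \<Longrightarrow> norm (exp (char_exponent u * complex_of_real x)) \<le> 1"
  by (simp add: char_exponent_def norm_exp_eq_Re)

context ito_approx
begin

abbreviation "\<nu> \<equiv> restrict_space lborel {0<..T}"

lemma approx_log_alt: "approx_log t k \<omega> = (\<Sum>i<n k. A k i \<omega> * (W (min t (\<tau> k (Suc i))) \<omega> - W (min t (\<tau> k i)) \<omega>)
    - (A k i \<omega>)\<^sup>2 * (min t (\<tau> k (Suc i)) - min t (\<tau> k i)) / 2)"
  unfolding approx_log_def simple_integral_def by (simp add: sum_subtractf sum_divide_distrib)

lemma approx_log_0: "approx_log 0 k \<omega> = 0"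
  unfolding approx_log_alt using \<tau>_nonneg[of _ k] by (intro sum.neutral) (auto simp: min_absorb1)

lemma approx_log_cell:
  assumes i: "i < n k" and s: "\<tau> k i \<le> s" "s \<le> \<tau> k (Suc i)"
  shows "approx_log s k \<omega> = approx_log (\<tau> k i) k \<omega> + A k i \<omega> * (W s \<omega> - W (\<tau> k i) \<omega>) - (A k i \<omega>)\<^sup>2 * (s - \<tau> k i) / 2"
proof -
  let ?f = "\<lambda>t j. A k j \<omega> * (W (min t (\<tau> k (Suc j))) \<omega> - W (min t (\<tau> k j)) \<omega>)
    - (A k j \<omega>)\<^sup>2 * (min t (\<tau> k (Suc j)) - min t (\<tau> k j)) / 2"
  have "approx_log s k \<omega> - approx_log (\<tau> k i) k \<omega> = (\<Sum>j<n k. ?f s j - ?f (\<tau> k i) j)"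
    unfolding approx_log_alt by (rule sum_subtractf[symmetric])
  also have "\<dots> = (\<Sum>j\<in>{i}. ?f s j - ?f (\<tau> k i) j)"
  proof (rule sum.mono_neutral_right)
    show "\<forall>j\<in>{..<n k} - {i}. ?f s j - ?f (\<tau> k i) j = 0"
    proof
      fix j assume j: "j \<in> {..<n k} - {i}"
      show "?f s j - ?f (\<tau> k i) j = 0"
      proof (cases "j < i")
        case True
        then have "\<tau> k (Suc j) \<le> \<tau> k i" "\<tau> k j \<le> \<tau> k i" using \<tau>_mono[of "Suc j" i k] \<tau>_mono[of j i k] i by auto
        then show ?thesis using s by (simp add: min_absorb2)
      next
        case False
        then have "\<tau> k (Suc i) \<le> \<tau> k (Suc j)" "\<tau> k (Suc i) \<le> \<tau> k j"
          using \<tau>_mono[of "Suc i" "Suc j" k] \<tau>_mono[of "Suc i" j k] j by auto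
        then show ?thesis using s by (simp add: min_absorb1)
      qed
    qed
  qed (use i in auto)
  also have "\<dots> = A k i \<omega> * (W s \<omega> - W (\<tau> k i) \<omega>) - (A k i \<omega>)\<^sup>2 * (s - \<tau> k i) / 2"
    using s by (simp add: min_absorb1 min_absorb2)
  finally show ?thesis by simp
qed

lemma approx_log_meas_F:
  assumes i: "i < n k" shows "approx_log (\<tau> k i) k \<in> borel_measurable (F (\<tau> k i))"
  unfolding approx_log_alt
proof (rule borel_measurable_sum)
  fix j assume "j \<in> {..<n k}"
  then have j: "j < n k" by simp
  show "(\<lambda>\<omega>. A k j \<omega> * (W (min (\<tau> k i) (\<tau> k (Suc j))) \<omega> - W (min (\<tau> k i) (\<tau> k j)) \<omega>)
    - (A k j \<omega>)\<^sup>2 * (min (\<tau> k i) (\<tau> k (Suc j)) - min (\<tau> k i) (\<tau> k j)) / 2) \<in> borel_measurable (F (\<tau> k i))"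
  proof (cases "j < i")
    case True
    then have "\<tau> k (Suc j) \<le> \<tau> k i" "\<tau> k j \<le> \<tau> k i" using \<tau>_mono[of "Suc j" i k] \<tau>_mono[of j i k] i by auto
    then show ?thesis
      using measurable_F_mono[OF A_meas[OF j], of "\<tau> k i"] W_measurable_F'[of "\<tau> k (Suc j)" "\<tau> k i"] W_measurable_F'[of "\<tau> k j" "\<tau> k i"]
        \<tau>_nonneg[of j k] \<tau>_nonneg[of "Suc j" k] j by (simp add: min_absorb2)
  next
    case False
    then have "\<tau> k i \<le> \<tau> k (Suc j)" "\<tau> k i \<le> \<tau> k j"
      using \<tau>_mono[of i "Suc j" k] \<tau>_mono[of i j k] j by auto
    then show ?thesis by (simp add: min_absorb1)
  qed
qed

text \<open>Given the past at the left end, the logarithm moves on the cell like a Brownian motion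
  with constant volatility and drift, so its increment can be integrated out exactly. The factor
  \<Psi> is 1 for the step across a whole cell and \<open>A\<^sup>2\<close> for the integrand inside
  it.\<close>

lemma cell_char:
  fixes \<Psi> :: "'a \<Rightarrow> complex"
  assumes i: "i < n k" and s: "\<tau> k i \<le> s" "s \<le> \<tau> k (Suc i)"
    and \<Psi>: "\<Psi> \<in> borel_measurable (F (\<tau> k i))" "\<And>\<omega>. norm (\<Psi> \<omega>) \<le> B"
  shows "(\<integral>\<omega>. \<Psi> \<omega> * iexp (u * approx_log s k \<omega>) \<partial>M) =
    (\<integral>\<omega>. \<Psi> \<omega> * iexp (u * approx_log (\<tau> k i) k \<omega>) * exp (char_exponent u * complex_of_real ((A k i \<omega>)\<^sup>2 * (s - \<tau> k i))) \<partial>M)"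
proof -
  \<comment> \<open>The drift of the cell depends only on the coefficient known at the left end;
    moving it into the known factor leaves a pure Brownian increment for
    \<open>W_increment_freeze\<close>.\<close>
  define \<Phi> where "\<Phi> \<omega> = \<Psi> \<omega> * iexp (u * approx_log (\<tau> k i) k \<omega>) * iexp (- (u * ((A k i \<omega>)\<^sup>2 * (s - \<tau> k i) / 2)))" for \<omega>
  have "\<Phi> \<in> borel_measurable (F (\<tau> k i))"
    unfolding \<Phi>_def using \<Psi>(1) approx_log_meas_F[OF i] A_meas[OF i] by measurable
  moreover have "norm (\<Phi> \<omega>) \<le> B" for \<omega> using \<Psi>(2)[of \<omega>] by (simp add: \<Phi>_def norm_mult)
  moreover have "(\<lambda>\<omega>. u * A k i \<omega>) \<in> borel_measurable (F (\<tau> k i))" using A_meas[OF i] by simp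
  ultimately have fr: "(\<integral>\<omega>. \<Phi> \<omega> * iexp (u * A k i \<omega> * (W s \<omega> - W (\<tau> k i) \<omega>)) \<partial>M) =
      (\<integral>\<omega>. \<Phi> \<omega> * exp (complex_of_real (- ((u * A k i \<omega>)\<^sup>2 * (s - \<tau> k i) / 2))) \<partial>M)"
    using \<tau>_nonneg[of i k] i s by (intro W_increment_freeze) auto
  have "\<Psi> \<omega> * iexp (u * approx_log s k \<omega>) = \<Phi> \<omega> * iexp (u * A k i \<omega> * (W s \<omega> - W (\<tau> k i) \<omega>))" for \<omega>
    unfolding approx_log_cell[OF i s] \<Phi>_def by (simp add: mult.assoc exp_add[symmetric] algebra_simps)
  moreover have "\<Phi> \<omega> * exp (complex_of_real (- ((u * A k i \<omega>)\<^sup>2 * (s - \<tau> k i) / 2))) =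
      \<Psi> \<omega> * iexp (u * approx_log (\<tau> k i) k \<omega>) * exp (char_exponent u * complex_of_real ((A k i \<omega>)\<^sup>2 * (s - \<tau> k i)))" for \<omega>
  proof -
    have e: "iexp (- (u * (x / 2))) * exp (complex_of_real (- (u\<^sup>2 * x / 2))) = exp (char_exponent u * complex_of_real x)" for x
      unfolding char_exponent_def exp_add[symmetric] by (rule arg_cong[where f=exp]) (simp add: field_simps)
    have "(u * A k i \<omega>)\<^sup>2 * (s - \<tau> k i) / 2 = u\<^sup>2 * ((A k i \<omega>)\<^sup>2 * (s - \<tau> k i)) / 2" by (simp add: power_mult_distrib)
    then show ?thesis unfolding \<Phi>_def e[symmetric] by (simp only: mult.assoc)
  qed
  ultimately show ?thesis using fr by simp
qed

lemma finite_nu: "finite_measure \<nu>"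
  by (rule finite_measureI) (use T in \<open>simp add: emeasure_restrict_space space_restrict_space\<close>)

lemma space_nu: "space \<nu> = {0<..T}" by (simp add: space_restrict_space)

lemma nu_meas:
  assumes "f \<in> borel_measurable (borel \<Otimes>\<^sub>M M)" shows "f \<in> borel_measurable (\<nu> \<Otimes>\<^sub>M M)"
proof -
  have "(\<lambda>p. (fst p, snd p)) \<in> \<nu> \<Otimes>\<^sub>M M \<rightarrow>\<^sub>M borel \<Otimes>\<^sub>M M"
  proof (rule measurable_Pair)
    have "(\<lambda>x. x) \<in> \<nu> \<rightarrow>\<^sub>M borel" by (rule measurable_restrict_space1) simp
    then show "fst \<in> \<nu> \<Otimes>\<^sub>M M \<rightarrow>\<^sub>M borel" by (rule measurable_compose[OF measurable_fst])
  qed simp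
  from measurable_compose[OF this assms] show ?thesis by simp
qed

lemma W_pair: "(\<lambda>p. W (max 0 (fst p)) (snd p)) \<in> borel_measurable (borel \<Otimes>\<^sub>M M)"
  using continuous_process_measurable[of M W] bm W_measurable by (simp add: brownian_motion_def split_beta')

lemma approx_log_pair: "(\<lambda>p. approx_log (fst p) k (snd p)) \<in> borel_measurable (\<nu> \<Otimes>\<^sub>M M)"
proof -
  have W': "(\<lambda>p. W (max 0 (min (max 0 (fst p)) c)) (snd p)) \<in> borel_measurable (borel \<Otimes>\<^sub>M M)" for c
  proof -
    have "(\<lambda>p. (min (max 0 (fst p)) c, snd p)) \<in> borel \<Otimes>\<^sub>M M \<rightarrow>\<^sub>M borel \<Otimes>\<^sub>M M" by measurable
    from measurable_compose[OF this W_pair] show ?thesis by simp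
  qed
  have Am: "(\<lambda>p. A k i (snd p)) \<in> borel_measurable (borel \<Otimes>\<^sub>M M)" if "i < n k" for i
    by (rule measurable_compose[OF measurable_snd A_measM[OF that]])
  have "(\<lambda>p. \<Sum>i<n k. A k i (snd p) * (W (max 0 (min (max 0 (fst p)) (\<tau> k (Suc i)))) (snd p) - W (max 0 (min (max 0 (fst p)) (\<tau> k i))) (snd p))
    - (A k i (snd p))\<^sup>2 * (min (max 0 (fst p)) (\<tau> k (Suc i)) - min (max 0 (fst p)) (\<tau> k i)) / 2) \<in> borel_measurable (borel \<Otimes>\<^sub>M M)"
    using Am W' by (intro borel_measurable_sum) (auto intro!: borel_measurable_diff borel_measurable_times borel_measurable_divide)
  from nu_meas[OF this] show ?thesis
  proof (rule measurable_cong[THEN iffD1, rotated])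
    fix p assume "p \<in> space (\<nu> \<Otimes>\<^sub>M M)"
    then have "0 < fst p" by (auto simp: space_pair_measure space_restrict_space)
    then show "(\<Sum>i<n k. A k i (snd p) * (W (max 0 (min (max 0 (fst p)) (\<tau> k (Suc i)))) (snd p) - W (max 0 (min (max 0 (fst p)) (\<tau> k i))) (snd p))
    - (A k i (snd p))\<^sup>2 * (min (max 0 (fst p)) (\<tau> k (Suc i)) - min (max 0 (fst p)) (\<tau> k i)) / 2) = approx_log (fst p) k (snd p)"
      unfolding approx_log_alt using \<tau>_nonneg[of _ k] by (intro sum.cong refl) (simp add: max_absorb2)
  qed
qed

lemma AA_pair': "(\<lambda>p. AA k (fst p) (snd p)) \<in> borel_measurable (\<nu> \<Otimes>\<^sub>M M)"
proof (rule nu_meas)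
  have "(\<lambda>p. (snd p, fst p)) \<in> borel \<Otimes>\<^sub>M M \<rightarrow>\<^sub>M M \<Otimes>\<^sub>M borel" by measurable
  from measurable_compose[OF this AA_pair] show "(\<lambda>p. AA k (fst p) (snd p)) \<in> borel_measurable (borel \<Otimes>\<^sub>M M)" by simp
qed

lemma nu_integrable:
  fixes f :: "real \<times> 'a \<Rightarrow> 'b :: {banach, second_countable_topology}"
  assumes "f \<in> borel_measurable (\<nu> \<Otimes>\<^sub>M M)" "\<And>s \<omega>. 0 < s \<Longrightarrow> s \<le> T \<Longrightarrow> \<omega> \<in> space M \<Longrightarrow> norm (f (s, \<omega>)) \<le> B"
  shows "integrable (\<nu> \<Otimes>\<^sub>M M) f"
proof -
  interpret P: finite_measure "\<nu> \<Otimes>\<^sub>M M" by (rule finite_measure_pair_measure[OF finite_measure_axioms finite_nu])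
  show ?thesis
    using assms by (intro P.integrable_const_bound[where B=B]) (auto simp: space_pair_measure space_restrict_space)
qed

lemma pair_nu: "pair_sigma_finite \<nu> M"
proof -
  interpret N: finite_measure \<nu> by (rule finite_nu)
  show ?thesis ..
qed

lemma g_integrable: "integrable (\<nu> \<Otimes>\<^sub>M M) (\<lambda>p. iexp (u * approx_log (fst p) k (snd p)) * complex_of_real ((AA k (fst p) (snd p))\<^sup>2))"
proof (rule nu_integrable[where B="C\<^sup>2"])
  note [measurable] = approx_log_pair[of k] AA_pair'[of k]
  show "(\<lambda>p. iexp (u * approx_log (fst p) k (snd p)) * complex_of_real ((AA k (fst p) (snd p))\<^sup>2)) \<in> borel_measurable (\<nu> \<Otimes>\<^sub>M M)"
    by measurable
  fix s \<omega> assume s: "0 < s" "s \<le> T"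
  show "norm (iexp (u * approx_log (fst (s, \<omega>)) k (snd (s, \<omega>))) * complex_of_real ((AA k (fst (s, \<omega>)) (snd (s, \<omega>)))\<^sup>2)) \<le> C\<^sup>2"
    using power_mono[OF AA_bdd[OF s, of k \<omega>], of 2] by (simp add: norm_mult norm_power)
qed

text \<open>This is the fundamental theorem of calculus for the exponential. Keeping
  \<open>char_exponent u\<close> as a factor on the left, instead of dividing by it, covers u = 0 as
  well.\<close>

lemma exp_cell_integral:
  fixes \<alpha> lo hi :: real
  assumes "0 \<le> lo" "lo \<le> hi" "hi \<le> T"
  shows "char_exponent u * (\<integral>s. indicator {lo<..hi} s *\<^sub>R (complex_of_real \<alpha> * exp (char_exponent u * complex_of_real (\<alpha> * (s - lo)))) \<partial>\<nu>)
     = exp (char_exponent u * complex_of_real (\<alpha> * (hi - lo))) - 1"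
proof -
  let ?f = "\<lambda>s. char_exponent u * (complex_of_real \<alpha> * exp (char_exponent u * complex_of_real (\<alpha> * (s - lo))))"
  have "char_exponent u * (\<integral>s. indicator {lo<..hi} s *\<^sub>R (complex_of_real \<alpha> * exp (char_exponent u * complex_of_real (\<alpha> * (s - lo)))) \<partial>\<nu>)
     = (\<integral>s. indicator {lo<..hi} s *\<^sub>R ?f s \<partial>\<nu>)"
    by (subst Bochner_Integration.integral_mult_right_zero[symmetric]) (simp add: mult_scaleR_right)
  also have "\<dots> = (\<integral>s. indicator {0<..T} s *\<^sub>R (indicator {lo<..hi} s *\<^sub>R ?f s) \<partial>lborel)"
    by (subst integral_restrict_space) auto
  also have "\<dots> = (\<integral>s. indicator {lo..hi} s *\<^sub>R ?f s \<partial>lborel)"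
  proof (rule integral_cong_AE)
    show "AE s in lborel. indicator {0<..T} s *\<^sub>R (indicator {lo<..hi} s *\<^sub>R ?f s) = indicator {lo..hi} s *\<^sub>R ?f s"
      using AE_lborel_singleton[of lo] by eventually_elim (use assms in \<open>auto simp: indicator_def\<close>)
  qed measurable
  also have "\<dots> = exp (char_exponent u * complex_of_real (\<alpha> * (hi - lo))) - exp (char_exponent u * complex_of_real (\<alpha> * (lo - lo)))"
  proof (rule integral_FTC_atLeastAtMost[OF assms(2)])
    fix x :: real
    show "((\<lambda>x. exp (char_exponent u * complex_of_real (\<alpha> * (x - lo)))) has_vector_derivative ?f x) (at x within {lo..hi})"
      by (auto intro!: derivative_eq_intros has_vector_derivative_real_field simp: algebra_simps)
  next
    show "continuous_on {lo..hi} ?f" by (intro continuous_intros)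
  qed
  finally show ?thesis by simp
qed

text \<open>On each cell \<open>cell_char\<close> integrates out the Brownian increment, and
  \<open>exp_cell_integral\<close> writes the resulting exponential minus 1 as a time integral.
  After Fubini, \<open>cell_char\<close> at an intermediate time, read from right to left, restores
  \<open>approx_log s\<close>. The steps then telescope over the cells.\<close>

lemma approx_char_formula:
  "(\<integral>\<omega>. iexp (u * approx_log T k \<omega>) \<partial>M) = 1 + char_exponent u * (\<integral>s. (\<integral>\<omega>. iexp (u * approx_log s k \<omega>) * complex_of_real ((AA k s \<omega>)\<^sup>2) \<partial>M) \<partial>\<nu>)"
proof -
  interpret P: pair_sigma_finite \<nu> M by (rule pair_nu)
  define g where "g = (\<lambda>s. \<integral>\<omega>. iexp (u * approx_log s k \<omega>) * complex_of_real ((AA k s \<omega>)\<^sup>2) \<partial>M)"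
  define E where "E i = (\<integral>\<omega>. iexp (u * approx_log (\<tau> k i) k \<omega>) \<partial>M)" for i
  have gi: "integrable \<nu> g" using P.integrable_fst'[OF g_integrable[of u k]] unfolding g_def fst_conv snd_conv .
  have step: "E (Suc i) - E i = char_exponent u * (\<integral>s. indicator {\<tau> k i<..\<tau> k (Suc i)} s *\<^sub>R g s \<partial>\<nu>)" if i: "i < n k" for i
  proof -
    note [measurable] = measurable_F_M[OF approx_log_meas_F[OF i]] A_measM[OF i]
    define x where "x \<omega> = iexp (u * approx_log (\<tau> k i) k \<omega>)" for \<omega>
    have [measurable]: "x \<in> borel_measurable M" unfolding x_def by measurable
    have nx: "norm (x \<omega>) = 1" for \<omega> by (simp add: x_def)
    have bnd: "0 \<le> \<tau> k i" "\<tau> k i \<le> \<tau> k (Suc i)" "\<tau> k (Suc i) \<le> T" using \<tau>_nonneg[of i k] \<tau>_le[OF i] \<tau>_le_T[of "Suc i" k] i by auto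
    let ?h = "\<lambda>s \<omega>. indicator {\<tau> k i<..\<tau> k (Suc i)} s *\<^sub>R (complex_of_real ((A k i \<omega>)\<^sup>2) * x \<omega> * exp (char_exponent u * complex_of_real ((A k i \<omega>)\<^sup>2 * (s - \<tau> k i))))"
    have hi: "integrable (\<nu> \<Otimes>\<^sub>M M) (case_prod ?h)"
    proof (rule nu_integrable[where B="C\<^sup>2"])
      show "case_prod ?h \<in> borel_measurable (\<nu> \<Otimes>\<^sub>M M)" unfolding split_beta' by (rule nu_meas) measurable
      fix s \<omega>
      show "norm (case_prod ?h (s, \<omega>)) \<le> C\<^sup>2"
      proof (cases "s \<in> {\<tau> k i<..\<tau> k (Suc i)}")
        case True
        then have "norm (exp (char_exponent u * complex_of_real ((A k i \<omega>)\<^sup>2 * (s - \<tau> k i)))) \<le> 1" by (intro norm_exp_char_exponent) auto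
        moreover have "(A k i \<omega>)\<^sup>2 \<le> C\<^sup>2" using power_mono[OF A_bdd[of k i \<omega>], of 2] by simp
        ultimately have "norm (complex_of_real ((A k i \<omega>)\<^sup>2)) * norm (exp (char_exponent u * complex_of_real ((A k i \<omega>)\<^sup>2 * (s - \<tau> k i)))) \<le> C\<^sup>2 * 1"
          by (intro mult_mono) (auto simp: norm_power)
        then show ?thesis using True by (simp add: norm_mult nx del: of_real_power of_real_mult)
      qed simp
    qed
    have "E (Suc i) = (\<integral>\<omega>. x \<omega> * exp (char_exponent u * complex_of_real ((A k i \<omega>)\<^sup>2 * (\<tau> k (Suc i) - \<tau> k i))) \<partial>M)"
      using cell_char[OF i bnd(2) order_refl, of "\<lambda>_. 1" 1 u] by (simp add: E_def x_def)
    then have "E (Suc i) - E i = (\<integral>\<omega>. x \<omega> * exp (char_exponent u * complex_of_real ((A k i \<omega>)\<^sup>2 * (\<tau> k (Suc i) - \<tau> k i))) - x \<omega> \<partial>M)"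
      unfolding E_def x_def[symmetric]
    proof (subst Bochner_Integration.integral_diff)
      show "integrable M (\<lambda>\<omega>. x \<omega> * exp (char_exponent u * complex_of_real ((A k i \<omega>)\<^sup>2 * (\<tau> k (Suc i) - \<tau> k i))))"
      proof (rule integrable_const_bound[where B=1])
        have "norm (exp (char_exponent u * complex_of_real ((A k i \<omega>)\<^sup>2 * (\<tau> k (Suc i) - \<tau> k i)))) \<le> 1" for \<omega> using bnd by (intro norm_exp_char_exponent) auto
        then show "AE \<omega> in M. norm (x \<omega> * exp (char_exponent u * complex_of_real ((A k i \<omega>)\<^sup>2 * (\<tau> k (Suc i) - \<tau> k i)))) \<le> 1"
          by (simp add: norm_mult nx)
      qed measurable
      show "integrable M x" by (rule integrable_const_bound[where B=1]) (auto simp: nx)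
    qed simp
    also have "\<dots> = (\<integral>\<omega>. char_exponent u * (\<integral>s. ?h s \<omega> \<partial>\<nu>) \<partial>M)"
    proof (intro Bochner_Integration.integral_cong refl)
      fix \<omega>
      have "(\<integral>s. ?h s \<omega> \<partial>\<nu>) = x \<omega> * (\<integral>s. indicator {\<tau> k i<..\<tau> k (Suc i)} s *\<^sub>R (complex_of_real ((A k i \<omega>)\<^sup>2) * exp (char_exponent u * complex_of_real ((A k i \<omega>)\<^sup>2 * (s - \<tau> k i)))) \<partial>\<nu>)"
        by (subst Bochner_Integration.integral_mult_right_zero[symmetric]) (simp add: mult_ac mult_scaleR_right)
      then have "char_exponent u * (\<integral>s. ?h s \<omega> \<partial>\<nu>) = x \<omega> * (exp (char_exponent u * complex_of_real ((A k i \<omega>)\<^sup>2 * (\<tau> k (Suc i) - \<tau> k i))) - 1)"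
        by (simp only: mult.left_commute[of "char_exponent u" "x \<omega>"] exp_cell_integral[OF bnd])
      also have "\<dots> = x \<omega> * exp (char_exponent u * complex_of_real ((A k i \<omega>)\<^sup>2 * (\<tau> k (Suc i) - \<tau> k i))) - x \<omega>"
        by (rule trans[OF right_diff_distrib]) simp
      finally show "x \<omega> * exp (char_exponent u * complex_of_real ((A k i \<omega>)\<^sup>2 * (\<tau> k (Suc i) - \<tau> k i))) - x \<omega> = char_exponent u * (\<integral>s. ?h s \<omega> \<partial>\<nu>)"
        by (rule sym)
    qed
    also have "\<dots> = char_exponent u * (\<integral>\<omega>. (\<integral>s. ?h s \<omega> \<partial>\<nu>) \<partial>M)" by simp
    also have "(\<integral>\<omega>. (\<integral>s. ?h s \<omega> \<partial>\<nu>) \<partial>M) = (\<integral>s. (\<integral>\<omega>. ?h s \<omega> \<partial>M) \<partial>\<nu>)" by (rule P.Fubini_integral[OF hi])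
    also have "\<dots> = (\<integral>s. indicator {\<tau> k i<..\<tau> k (Suc i)} s *\<^sub>R g s \<partial>\<nu>)"
    proof (intro Bochner_Integration.integral_cong refl)
      fix s
      show "(\<integral>\<omega>. ?h s \<omega> \<partial>M) = indicator {\<tau> k i<..\<tau> k (Suc i)} s *\<^sub>R g s"
      proof (cases "s \<in> {\<tau> k i<..\<tau> k (Suc i)}")
        case True
        have "(\<integral>\<omega>. complex_of_real ((A k i \<omega>)\<^sup>2) * iexp (u * approx_log s k \<omega>) \<partial>M) =
           (\<integral>\<omega>. complex_of_real ((A k i \<omega>)\<^sup>2) * iexp (u * approx_log (\<tau> k i) k \<omega>) * exp (char_exponent u * complex_of_real ((A k i \<omega>)\<^sup>2 * (s - \<tau> k i))) \<partial>M)"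
        proof (rule cell_char[OF i])
          show "(\<lambda>\<omega>. complex_of_real ((A k i \<omega>)\<^sup>2)) \<in> borel_measurable (F (\<tau> k i))" using A_meas[OF i] by measurable
          show "norm (complex_of_real ((A k i \<omega>)\<^sup>2)) \<le> C\<^sup>2" for \<omega> using power_mono[OF A_bdd[of k i \<omega>], of 2] by (simp add: norm_power)
        qed (use True in auto)
        moreover have "g s = (\<integral>\<omega>. complex_of_real ((A k i \<omega>)\<^sup>2) * iexp (u * approx_log s k \<omega>) \<partial>M)"
          unfolding g_def using process_cell[OF i, of s "A k"] True by (simp add: mult.commute)
        ultimately show ?thesis using True by (simp add: x_def)
      qed simp
    qed
    finally show ?thesis .
  qed
  have "E (n k) - E 0 = (\<Sum>i<n k. E (Suc i) - E i)" by (rule sum_lessThan_telescope[symmetric])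
  also have "\<dots> = (\<Sum>i<n k. char_exponent u * (\<integral>s. indicator {\<tau> k i<..\<tau> k (Suc i)} s *\<^sub>R g s \<partial>\<nu>))" using step by simp
  also have "\<dots> = char_exponent u * (\<Sum>i<n k. (\<integral>s. indicator {\<tau> k i<..\<tau> k (Suc i)} s *\<^sub>R g s \<partial>\<nu>))" by (simp add: sum_distrib_left)
  also have "(\<Sum>i<n k. (\<integral>s. indicator {\<tau> k i<..\<tau> k (Suc i)} s *\<^sub>R g s \<partial>\<nu>)) = (\<integral>s. (\<Sum>i<n k. indicator {\<tau> k i<..\<tau> k (Suc i)} s *\<^sub>R g s) \<partial>\<nu>)"
  proof (rule Bochner_Integration.integral_sum[symmetric])
    fix i
    have "{\<tau> k i<..\<tau> k (Suc i)} \<inter> {0<..T} \<in> sets \<nu>" by (auto simp: sets_restrict_space)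
    have "integrable \<nu> (\<lambda>s. indicator ({\<tau> k i<..\<tau> k (Suc i)} \<inter> {0<..T}) s *\<^sub>R g s)"
      by (rule integrable_mult_indicator[OF \<open>_ \<in> sets \<nu>\<close> gi])
    then show "integrable \<nu> (\<lambda>s. indicator {\<tau> k i<..\<tau> k (Suc i)} s *\<^sub>R g s)"
      by (rule Bochner_Integration.integrable_cong[THEN iffD1, rotated -1]) (auto simp: space_nu indicator_def)
  qed
  also have "\<dots> = (\<integral>s. g s \<partial>\<nu>)"
  proof (intro Bochner_Integration.integral_cong refl)
    fix s assume "s \<in> space \<nu>"
    then have s: "0 < s" "s \<le> T" by (auto simp: space_nu)
    obtain j where j: "j < n k" "\<tau> k j < s" "s \<le> \<tau> k (Suc j)" by (rule cell[OF s])
    have "(\<Sum>i<n k. indicator {\<tau> k i<..\<tau> k (Suc i)} s *\<^sub>R g s) = (\<Sum>i<n k. 1 * indicator {\<tau> k i<..\<tau> k (Suc i)} s) *\<^sub>R g s"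
      by (simp add: scaleR_sum_left)
    also have "(\<Sum>i<n k. 1 * indicator {\<tau> k i<..\<tau> k (Suc i)} s) = (1::real)"
      using sum_cell[of "n k" "\<tau> k" j s "\<lambda>_. 1", OF \<tau>_le j] by simp
    finally show "(\<Sum>i<n k. indicator {\<tau> k i<..\<tau> k (Suc i)} s *\<^sub>R g s) = g s" by simp
  qed
  finally have "E (n k) = E 0 + char_exponent u * (\<integral>s. g s \<partial>\<nu>)" by (simp add: algebra_simps)
  then show ?thesis by (simp add: E_def g_def \<tau>_0 \<tau>_n approx_log_0 prob_space)
qed

end

lemma norm_integral_le:
  fixes f :: "'a \<Rightarrow> 'b::{banach,second_countable_topology}"
  assumes "integrable M f" "integrable M g" "\<And>x. x \<in> space M \<Longrightarrow> norm (f x) \<le> g x"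
  shows "norm (\<integral>x. f x \<partial>M) \<le> (\<integral>x. g x \<partial>M)"
  by (rule order_trans[OF integral_norm_bound integral_mono]) (use assms in auto)

lemma norm_scaled_diff_le:
  fixes x y :: complex
  assumes "norm y = 1" "0 \<le> p" "p \<le> K"
  shows "norm (x * complex_of_real p - y * complex_of_real q) \<le> K * norm (x - y) + \<bar>p - q\<bar>"
proof -
  have "x * complex_of_real p - y * complex_of_real q = (x - y) * complex_of_real p + y * complex_of_real (p - q)"
    by (simp add: algebra_simps)
  then have "norm (x * complex_of_real p - y * complex_of_real q) \<le> norm ((x - y) * complex_of_real p) + norm (y * complex_of_real (p - q))"
    by (simp only: norm_triangle_ineq)
  also have "norm ((x - y) * complex_of_real p) = p * norm (x - y)"
    unfolding norm_mult norm_of_real using assms by simp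
  also have "norm (y * complex_of_real (p - q)) = \<bar>p - q\<bar>"
    unfolding norm_mult norm_of_real using assms by simp
  also have "p * norm (x - y) \<le> K * norm (x - y)" using assms by (intro mult_right_mono) auto
  finally show ?thesis by simp
qed

section \<open>Passage to the limit in the equation for the characteristic function\<close>

context ito_approx
begin

definition log_ratio :: "real \<Rightarrow> 'a \<Rightarrow> real" where "log_ratio t \<omega> = ln (Y t \<omega>) - R t \<omega> - ln s0"

lemma log_ratio_meas: "0 \<le> t \<Longrightarrow> log_ratio t \<in> borel_measurable M"
  unfolding log_ratio_def using Y_measM[of t] time_integral_meas[OF r_pair, of t] by measurable

lemma approx_log_meas: "0 \<le> t \<Longrightarrow> approx_log t k \<in> borel_measurable M"
  unfolding approx_log_alt using stopped_nonneg[of t _ k]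
  by (intro borel_measurable_sum borel_measurable_diff borel_measurable_divide borel_measurable_times borel_measurable_power
      borel_measurable_const A_measM W_measurable) auto

lemma log_ratio_pair: "(\<lambda>p. log_ratio (fst p) (snd p)) \<in> borel_measurable (\<nu> \<Otimes>\<^sub>M M)"
proof (rule nu_meas)
  note [measurable] = Y_meas
  have "(\<lambda>p. LBINT s. (if 0 < s \<and> s \<le> fst p then r s (snd p) else 0)) \<in> borel_measurable ((borel :: real measure) \<Otimes>\<^sub>M M)"
  proof (rule lborel.borel_measurable_lebesgue_integral)
    have "(\<lambda>q. (snd q, snd (fst q))) \<in> (borel \<Otimes>\<^sub>M M) \<Otimes>\<^sub>M lborel \<rightarrow>\<^sub>M borel \<Otimes>\<^sub>M M" by measurable
    from measurable_compose[OF this r_meas]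
    have [measurable]: "(\<lambda>q. r (snd q) (snd (fst q))) \<in> borel_measurable (((borel :: real measure) \<Otimes>\<^sub>M M) \<Otimes>\<^sub>M lborel)" by simp
    show "(\<lambda>(p, s). if 0 < s \<and> s \<le> fst p then r s (snd p) else 0) \<in> borel_measurable (((borel :: real measure) \<Otimes>\<^sub>M M) \<Otimes>\<^sub>M lborel)"
      unfolding split_beta' by measurable
  qed
  moreover have "(LBINT s. (if 0 < s \<and> s \<le> t then r s \<omega> else 0)) = R t \<omega>" for t \<omega>
    unfolding set_lebesgue_integral_def by (intro Bochner_Integration.integral_cong) (auto simp: indicator_def)
  ultimately have [measurable]: "(\<lambda>p. R (fst p) (snd p)) \<in> borel_measurable (borel \<Otimes>\<^sub>M M)" by simp
  show "(\<lambda>p. log_ratio (fst p) (snd p)) \<in> borel_measurable (borel \<Otimes>\<^sub>M M)" unfolding log_ratio_def by measurable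
qed

lemma a_pair_nu: "(\<lambda>p. a (fst p) (snd p)) \<in> borel_measurable (\<nu> \<Otimes>\<^sub>M M)"
  by (rule nu_meas) (rule a_meas)

text \<open>A distance of bounded exponentials rather than of the logarithms: it is at most 2, so
  convergence at each fixed time carries over to the time integral by dominated convergence.\<close>

definition dist_log :: "real \<Rightarrow> nat \<Rightarrow> real \<Rightarrow> real" where
  "dist_log u k s = (\<integral>\<omega>. norm (iexp (u * approx_log s k \<omega>) - iexp (u * log_ratio s \<omega>)) \<partial>M)"

lemma norm_iexp_diff: "norm (iexp x - iexp y) \<le> 2"
  using norm_triangle_ineq4[of "iexp x" "iexp y"] by simp

lemma norm_iexp_diff':
  "norm (exp (\<i> * (complex_of_real x * complex_of_real y)) - exp (\<i> * (complex_of_real z * complex_of_real v))) \<le> 2"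
  using norm_iexp_diff[of "x * y" "z * v"] by simp

lemma dist_log_tendsto:
  assumes t: "0 \<le> t" "t \<le> T"
  shows "(\<lambda>k. dist_log u k t) \<longlonglongrightarrow> 0"
proof (rule LIMSEQ_subseqI)
  fix q :: "nat \<Rightarrow> nat" assume "strict_mono q"
  from approx_log_subseq[OF t this] obtain r' :: "nat \<Rightarrow> nat" where r': "strict_mono r'"
    "AE \<omega> in M. (\<lambda>k. approx_log t (q (r' k)) \<omega>) \<longlonglongrightarrow> log_ratio t \<omega>" unfolding log_ratio_def by blast
  note [measurable] = approx_log_meas[OF t(1)] log_ratio_meas[OF t(1)]
  have "(\<lambda>k. dist_log u (q (r' k)) t) \<longlonglongrightarrow> (\<integral>\<omega>. 0 \<partial>M)"
    unfolding dist_log_def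
  proof (rule integral_dominated_convergence[where w="\<lambda>_. 2"])
    show "AE \<omega> in M. (\<lambda>k. norm (iexp (u * approx_log t (q (r' k)) \<omega>) - iexp (u * log_ratio t \<omega>))) \<longlonglongrightarrow> 0"
      using r'(2)
    proof eventually_elim
      case (elim \<omega>)
      have "(\<lambda>k. norm (iexp (u * approx_log t (q (r' k)) \<omega>) - iexp (u * log_ratio t \<omega>))) \<longlonglongrightarrow> norm (iexp (u * log_ratio t \<omega>) - iexp (u * log_ratio t \<omega>))"
        by (intro tendsto_intros elim)
      then show ?case by simp
    qed
  qed (use norm_iexp_diff norm_iexp_diff' in auto)
  with r'(1) show "\<exists>q'. strict_mono q' \<and> (\<lambda>k. dist_log u (q (q' k)) t) \<longlonglongrightarrow> 0" by auto
qed

text \<open>The exponentials converge at every fixed time, the squared coefficients only after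
  integration over time. \<open>norm_scaled_diff_le\<close> separates these two errors, and the
  limit is then taken in \<open>approx_char_formula\<close>. Integrability is recorded so that the
  formulas of two prices can be subtracted.\<close>

lemma char_formula:
  shows "(\<integral>\<omega>. iexp (u * log_ratio T \<omega>) \<partial>M) = 1 + char_exponent u * (\<integral>s. (\<integral>\<omega>. iexp (u * log_ratio s \<omega>) * complex_of_real ((a s \<omega>)\<^sup>2) \<partial>M) \<partial>\<nu>)"
    and "integrable \<nu> (\<lambda>s. \<integral>\<omega>. iexp (u * log_ratio s \<omega>) * complex_of_real ((a s \<omega>)\<^sup>2) \<partial>M)"
proof -
  interpret P: pair_sigma_finite \<nu> M by (rule pair_nu)
  interpret N: finite_measure \<nu> by (rule finite_nu)
  define g where "g = (\<lambda>k s. \<integral>\<omega>. iexp (u * approx_log s k \<omega>) * complex_of_real ((AA k s \<omega>)\<^sup>2) \<partial>M)"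
  define g' where "g' = (\<lambda>s. \<integral>\<omega>. iexp (u * log_ratio s \<omega>) * complex_of_real ((a s \<omega>)\<^sup>2) \<partial>M)"
  define e where "e = (\<lambda>k s. \<integral>\<omega>. \<bar>(AA k s \<omega>)\<^sup>2 - (a s \<omega>)\<^sup>2\<bar> \<partial>M)"
  note [measurable] = approx_log_pair AA_pair' log_ratio_pair a_pair_nu
  have a2: "(a s \<omega>)\<^sup>2 \<le> C\<^sup>2" if "0 < s" "\<omega> \<in> space M" for s \<omega> using power_mono[OF a_bdd[of s \<omega>], of 2] that by simp
  have A2: "(AA k s \<omega>)\<^sup>2 \<le> C\<^sup>2" if "0 < s" "s \<le> T" for k s \<omega> using power_mono[OF AA_bdd[OF that, of k \<omega>], of 2] by simp
  have diff2: "\<bar>(AA k s \<omega>)\<^sup>2 - (a s \<omega>)\<^sup>2\<bar> \<le> C\<^sup>2" if "0 < s" "s \<le> T" "\<omega> \<in> space M" for k s \<omega>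
    using a2[OF that(1,3)] A2[OF that(1,2), of k \<omega>] zero_le_power2[of "AA k s \<omega>"] zero_le_power2[of "a s \<omega>"] by linarith
  have gi: "integrable \<nu> (g k)" for k
    using P.integrable_fst'[OF g_integrable[of u k]] unfolding g_def fst_conv snd_conv .
  have "integrable (\<nu> \<Otimes>\<^sub>M M) (\<lambda>p. iexp (u * log_ratio (fst p) (snd p)) * complex_of_real ((a (fst p) (snd p))\<^sup>2))"
    by (rule nu_integrable[where B="C\<^sup>2"]) (use a2 in \<open>auto simp: norm_mult norm_power\<close>)
  from P.integrable_fst'[OF this] show g'i: "integrable \<nu> (\<lambda>s. \<integral>\<omega>. iexp (u * log_ratio s \<omega>) * complex_of_real ((a s \<omega>)\<^sup>2) \<partial>M)"
    unfolding fst_conv snd_conv .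
  have d_int: "integrable (\<nu> \<Otimes>\<^sub>M M) (\<lambda>p. norm (iexp (u * approx_log (fst p) k (snd p)) - iexp (u * log_ratio (fst p) (snd p))))" for k
    by (rule nu_integrable[where B=2]) (use norm_iexp_diff norm_iexp_diff' in auto)
  from P.integrable_fst'[OF this] have di: "integrable \<nu> (dist_log u k)" for k
    unfolding dist_log_def[abs_def] fst_conv snd_conv .
  have e_int: "integrable (\<nu> \<Otimes>\<^sub>M M) (\<lambda>(s, \<omega>). \<bar>(AA k s \<omega>)\<^sup>2 - (a s \<omega>)\<^sup>2\<bar>)" for k
    unfolding split_beta' by (rule nu_integrable[where B="C\<^sup>2"]) (use diff2 in auto)
  from P.integrable_fst'[OF this] have ei: "integrable \<nu> (e k)" for k unfolding e_def by simp
  have dbd: "dist_log u k s \<le> 2" if "0 < s" for k s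
  proof -
    note [measurable] = approx_log_meas[OF less_imp_le[OF that]] log_ratio_meas[OF less_imp_le[OF that]]
    have "dist_log u k s \<le> (\<integral>\<omega>. 2 \<partial>M)"
      unfolding dist_log_def by (intro integral_mono integrable_const_bound[where B=2]) (use norm_iexp_diff norm_iexp_diff' in auto)
    then show ?thesis by (simp add: prob_space)
  qed
  have dnn: "0 \<le> dist_log u k s" for k s unfolding dist_log_def by (intro integral_nonneg_AE) auto
  have "(\<lambda>k. \<integral>s. dist_log u k s \<partial>\<nu>) \<longlonglongrightarrow> (\<integral>s. 0 \<partial>\<nu>)"
  proof (rule integral_dominated_convergence[where w="\<lambda>_. 2"])
    show "AE s in \<nu>. (\<lambda>k. dist_log u k s) \<longlonglongrightarrow> 0"
      by (rule AE_I2) (auto simp: space_nu intro!: dist_log_tendsto)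
    show "AE s in \<nu>. norm (dist_log u k s) \<le> 2" for k
      by (rule AE_I2) (use dbd dnn in \<open>auto simp: space_nu\<close>)
  qed (use di in auto)
  then have dlim: "(\<lambda>k. \<integral>s. dist_log u k s \<partial>\<nu>) \<longlonglongrightarrow> 0" by simp
  \<comment> \<open>\<open>AA_tendsto\<close> integrates over time for a fixed path, so Fubini
    exchanges the integrals first; the bound \<open>C\<^sup>2\<close> on a finite time interval then
    gives a dominating constant.\<close>
  have elim': "(\<lambda>k. \<integral>s. e k s \<partial>\<nu>) \<longlonglongrightarrow> 0"
  proof -
    have sw: "(\<integral>s. e k s \<partial>\<nu>) = (\<integral>\<omega>. (\<integral>s. \<bar>(AA k s \<omega>)\<^sup>2 - (a s \<omega>)\<^sup>2\<bar> \<partial>\<nu>) \<partial>M)" for k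
      unfolding e_def by (rule P.Fubini_integral[OF e_int, symmetric])
    have "(\<lambda>k. \<integral>\<omega>. (\<integral>s. \<bar>(AA k s \<omega>)\<^sup>2 - (a s \<omega>)\<^sup>2\<bar> \<partial>\<nu>) \<partial>M) \<longlonglongrightarrow> (\<integral>\<omega>. 0 \<partial>M)"
    proof (rule integral_dominated_convergence[where w="\<lambda>_. C\<^sup>2 * measure \<nu> (space \<nu>)"])
      show "(\<lambda>\<omega>. \<integral>s. \<bar>(AA k s \<omega>)\<^sup>2 - (a s \<omega>)\<^sup>2\<bar> \<partial>\<nu>) \<in> borel_measurable M" for k
        using P.integrable_snd[OF e_int[of k]] by (rule borel_measurable_integrable)
      show "AE \<omega> in M. (\<lambda>k. \<integral>s. \<bar>(AA k s \<omega>)\<^sup>2 - (a s \<omega>)\<^sup>2\<bar> \<partial>\<nu>) \<longlonglongrightarrow> 0"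
        using AA_tendsto by eventually_elim (simp add: integral_restrict_space set_lebesgue_integral_def)
      show "AE \<omega> in M. norm (\<integral>s. \<bar>(AA k s \<omega>)\<^sup>2 - (a s \<omega>)\<^sup>2\<bar> \<partial>\<nu>) \<le> C\<^sup>2 * measure \<nu> (space \<nu>)" for k
      proof (rule AE_I2)
        fix \<omega> assume \<omega>: "\<omega> \<in> space M"
        have "(\<integral>s. \<bar>(AA k s \<omega>)\<^sup>2 - (a s \<omega>)\<^sup>2\<bar> \<partial>\<nu>) \<le> (\<integral>s. C\<^sup>2 \<partial>\<nu>)"
          by (rule integral_mono') (use diff2 \<omega> in \<open>auto simp: space_nu\<close>)
        then show "norm (\<integral>s. \<bar>(AA k s \<omega>)\<^sup>2 - (a s \<omega>)\<^sup>2\<bar> \<partial>\<nu>) \<le> C\<^sup>2 * measure \<nu> (space \<nu>)"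
          by (simp add: integral_nonneg_AE mult.commute)
      qed
    qed auto
    then show ?thesis unfolding sw by simp
  qed
  have glim: "(\<lambda>k. \<integral>s. g k s \<partial>\<nu>) \<longlonglongrightarrow> (\<integral>s. g' s \<partial>\<nu>)"
  proof (rule LIM_zero_cancel, rule Lim_null_comparison)
    show "(\<lambda>k. C\<^sup>2 * (\<integral>s. dist_log u k s \<partial>\<nu>) + (\<integral>s. e k s \<partial>\<nu>)) \<longlonglongrightarrow> 0"
      using tendsto_add[OF tendsto_mult[OF tendsto_const[of "C\<^sup>2"] dlim] elim'] by simp
    show "\<forall>\<^sub>F k in sequentially. norm ((\<integral>s. g k s \<partial>\<nu>) - (\<integral>s. g' s \<partial>\<nu>)) \<le> C\<^sup>2 * (\<integral>s. dist_log u k s \<partial>\<nu>) + (\<integral>s. e k s \<partial>\<nu>)"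
    proof (intro always_eventually allI)
      fix k
      have "norm ((\<integral>s. g k s \<partial>\<nu>) - (\<integral>s. g' s \<partial>\<nu>)) = norm (\<integral>s. g k s - g' s \<partial>\<nu>)"
        using gi[of k] g'i unfolding g'_def by simp
      also have "\<dots> \<le> (\<integral>s. C\<^sup>2 * dist_log u k s + e k s \<partial>\<nu>)"
      proof (rule norm_integral_le)
        show "integrable \<nu> (\<lambda>s. g k s - g' s)" using gi[of k] g'i unfolding g'_def by simp
        show "integrable \<nu> (\<lambda>s. C\<^sup>2 * dist_log u k s + e k s)" using di ei by simp
        fix s assume "s \<in> space \<nu>"
        then have s: "0 < s" "s \<le> T" by (auto simp: space_nu)
        note [measurable] = approx_log_meas[OF less_imp_le[OF s(1)]] log_ratio_meas[OF less_imp_le[OF s(1)]]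
        have AAm[measurable]: "AA k s \<in> borel_measurable M" unfolding simple_process_def by (intro borel_measurable_sum) auto
        have am[measurable]: "a s \<in> borel_measurable M"
          using measurable_compose[OF measurable_Pair1'[of s borel M] a_meas] by simp
        have i1: "integrable M (\<lambda>\<omega>. iexp (u * approx_log s k \<omega>) * complex_of_real ((AA k s \<omega>)\<^sup>2))"
          by (rule integrable_const_bound[where B="C\<^sup>2"]) (use A2[OF s] in \<open>auto simp: norm_mult norm_power\<close>)
        have i2: "integrable M (\<lambda>\<omega>. iexp (u * log_ratio s \<omega>) * complex_of_real ((a s \<omega>)\<^sup>2))"
          by (rule integrable_const_bound[where B="C\<^sup>2"]) (use a2[OF s(1)] in \<open>auto simp: norm_mult norm_power\<close>)
        have i3: "integrable M (\<lambda>\<omega>. norm (iexp (u * approx_log s k \<omega>) - iexp (u * log_ratio s \<omega>)))"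
          by (rule integrable_const_bound[where B=2]) (use norm_iexp_diff norm_iexp_diff' in auto)
        have i4: "integrable M (\<lambda>\<omega>. \<bar>(AA k s \<omega>)\<^sup>2 - (a s \<omega>)\<^sup>2\<bar>)"
          by (rule integrable_const_bound[where B="C\<^sup>2"]) (use diff2[OF s] in auto)
        have "norm (g k s - g' s) = norm (\<integral>\<omega>. iexp (u * approx_log s k \<omega>) * complex_of_real ((AA k s \<omega>)\<^sup>2) - iexp (u * log_ratio s \<omega>) * complex_of_real ((a s \<omega>)\<^sup>2) \<partial>M)"
          unfolding g_def g'_def using i1 i2 by simp
        also have "\<dots> \<le> (\<integral>\<omega>. C\<^sup>2 * norm (iexp (u * approx_log s k \<omega>) - iexp (u * log_ratio s \<omega>)) + \<bar>(AA k s \<omega>)\<^sup>2 - (a s \<omega>)\<^sup>2\<bar> \<partial>M)"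
        proof (rule norm_integral_le)
          fix \<omega> assume "\<omega> \<in> space M"
          show "norm (iexp (u * approx_log s k \<omega>) * complex_of_real ((AA k s \<omega>)\<^sup>2) - iexp (u * log_ratio s \<omega>) * complex_of_real ((a s \<omega>)\<^sup>2))
              \<le> C\<^sup>2 * norm (iexp (u * approx_log s k \<omega>) - iexp (u * log_ratio s \<omega>)) + \<bar>(AA k s \<omega>)\<^sup>2 - (a s \<omega>)\<^sup>2\<bar>"
            by (rule norm_scaled_diff_le) (use A2[OF s, of k \<omega>] in auto)
        qed (use i1 i2 i3 i4 in auto)
        also have "\<dots> = C\<^sup>2 * dist_log u k s + e k s" unfolding dist_log_def e_def using i3 i4 by simp
        finally show "norm (g k s - g' s) \<le> C\<^sup>2 * dist_log u k s + e k s" .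
      qed
      also have "\<dots> = C\<^sup>2 * (\<integral>s. dist_log u k s \<partial>\<nu>) + (\<integral>s. e k s \<partial>\<nu>)" using di ei by simp
      finally show "norm ((\<integral>s. g k s \<partial>\<nu>) - (\<integral>s. g' s \<partial>\<nu>)) \<le> C\<^sup>2 * (\<integral>s. dist_log u k s \<partial>\<nu>) + (\<integral>s. e k s \<partial>\<nu>)" .
    qed
  qed
  have T0: "0 \<le> T" using T by simp
  note [measurable] = approx_log_meas[OF T0] log_ratio_meas[OF T0]
  have l: "(\<lambda>k. \<integral>\<omega>. iexp (u * approx_log T k \<omega>) \<partial>M) \<longlonglongrightarrow> (\<integral>\<omega>. iexp (u * log_ratio T \<omega>) \<partial>M)"
  proof (rule LIM_zero_cancel, rule Lim_null_comparison[OF _ dist_log_tendsto[OF T0 order_refl]], intro always_eventually allI)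
    fix k
    have i: "integrable M (\<lambda>\<omega>. iexp (u * approx_log T k \<omega>))" "integrable M (\<lambda>\<omega>. iexp (u * log_ratio T \<omega>))"
      by (rule integrable_const_bound[where B=1]; simp)+
    then have "(\<integral>\<omega>. iexp (u * approx_log T k \<omega>) \<partial>M) - (\<integral>\<omega>. iexp (u * log_ratio T \<omega>) \<partial>M) = (\<integral>\<omega>. iexp (u * approx_log T k \<omega>) - iexp (u * log_ratio T \<omega>) \<partial>M)" by simp
    then show "norm ((\<integral>\<omega>. iexp (u * approx_log T k \<omega>) \<partial>M) - (\<integral>\<omega>. iexp (u * log_ratio T \<omega>) \<partial>M)) \<le> dist_log u k T"
      unfolding dist_log_def by (simp only: integral_norm_bound)
  qed
  have "(\<lambda>k. 1 + char_exponent u * (\<integral>s. g k s \<partial>\<nu>)) \<longlonglongrightarrow> 1 + char_exponent u * (\<integral>s. g' s \<partial>\<nu>)"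
    by (intro tendsto_add tendsto_mult tendsto_const glim)
  then have "(\<lambda>k. \<integral>\<omega>. iexp (u * approx_log T k \<omega>) \<partial>M) \<longlonglongrightarrow> 1 + char_exponent u * (\<integral>s. g' s \<partial>\<nu>)"
    unfolding approx_char_formula g_def .
  from LIMSEQ_unique[OF l this] show "(\<integral>\<omega>. iexp (u * log_ratio T \<omega>) \<partial>M) = 1 + char_exponent u * (\<integral>s. (\<integral>\<omega>. iexp (u * log_ratio s \<omega>) * complex_of_real ((a s \<omega>)\<^sup>2) \<partial>M) \<partial>\<nu>)"
    unfolding g'_def .
qed

end

section \<open>From the stochastic differential equation to the approximation scheme\<close>

lemma set_integral_Icc_Ioc:
  fixes f f' :: "real \<Rightarrow> real"
  assumes [measurable]: "f' \<in> borel_measurable borel" and "\<And>s. 0 \<le> s \<Longrightarrow> f s = f' s"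
  shows "(LBINT s:{0..t}. f s) = (LBINT s:{0<..t}. f' s)"
proof -
  have "(LBINT s:{0..t}. f s) = (LBINT s:{0..t}. f' s)"
    unfolding set_lebesgue_integral_def using assms(2) by (intro Bochner_Integration.integral_cong) (auto simp: indicator_def)
  also have "\<dots> = (LBINT s:{0<..t}. f' s)"
    unfolding set_lebesgue_integral_def
  proof (rule integral_cong_AE)
    show "AE s in lborel. indicat_real {0..t} s *\<^sub>R f' s = indicat_real {0<..t} s *\<^sub>R f' s"
      using AE_lborel_singleton[of 0] by eventually_elim (auto simp: indicator_def)
  qed measurable
  finally show ?thesis .
qed

text \<open>The definition of the stochastic integral supplies the data of
  \<open>ito_approx\<close>. Its approximating sequence is first thinned so that the energy error
  vanishes almost surely and only then refined, so that the mesh bound refers to the thinned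
  index.\<close>

lemma proportional_sde_char:
  fixes M :: "'a measure"
  assumes fps: "filtered_prob_space M F" and bm: "brownian_motion M F W"
    and r_mp: "measurable_process M r" and r_int: "AE \<omega> in M. \<forall>t\<ge>0. set_integrable lborel {0..t} (\<lambda>s. r s \<omega>)"
    and a_bdd': "\<forall>t\<ge>0. \<forall>\<omega>\<in>space M. (a t \<omega>)\<^sup>2 \<le> K"
    and Y_ad: "adapted F Y" and Y_cont: "continuous_process M Y" and Y_pos': "\<forall>t\<ge>0. \<forall>\<omega>\<in>space M. Y t \<omega> > 0"
    and Y0': "\<forall>\<omega>\<in>space M. Y 0 \<omega> = s0" and sde: "proportional_sde M F W r a Y" and T: "0 < T"
  defines "L \<equiv> \<lambda>t \<omega>. ln (discounted r Y t \<omega>) - ln s0"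
  shows "(\<integral>\<omega>. iexp (u * L T \<omega>) \<partial>M) = 1 + char_exponent u * (\<integral>s. (\<integral>\<omega>. iexp (u * L s \<omega>) * complex_of_real ((a s \<omega>)\<^sup>2) \<partial>M) \<partial>restrict_space lborel {0<..T})" (is "?lhs = 1 + char_exponent u * ?rhs")
    and "integrable (restrict_space lborel {0<..T}) (\<lambda>s. \<integral>\<omega>. iexp (u * L s \<omega>) * complex_of_real ((a s \<omega>)\<^sup>2) \<partial>M)"
    and "\<And>t. 0 \<le> t \<Longrightarrow> a t \<in> borel_measurable M"
    and "\<And>t. 0 \<le> t \<Longrightarrow> discounted r Y t \<in> borel_measurable M"
proof -
  note a_bdd = a_bdd'[rule_format] and Y_pos = Y_pos'[rule_format] and Y0 = Y0'[rule_format]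
  interpret prob_space M using fps by (simp add: filtered_prob_space_def)
  interpret bm_filtration M F W
  proof (rule bm_filtration.intro[OF prob_space_axioms], rule bm_filtration_axioms.intro)
    show "filtration (space M) F" "sets (F t) \<subseteq> sets M" for t
      using fps unfolding filtered_prob_space_def by blast+
    show "brownian_motion M F W" by (rule bm)
  qed
  define H where "H s \<omega> = a s \<omega> * Y s \<omega>" for s \<omega>
  have H_eq: "(\<lambda>s \<omega>. a s \<omega> * Y s \<omega>) = H" by (simp add: H_def fun_eq_iff)
  from sde obtain I where ito: "ito_integral M F W H I"
    and sdeY: "AE \<omega> in M. \<forall>t\<ge>0. Y t \<omega> = Y 0 \<omega> + (LBINT s:{0..t}. r s \<omega> * Y s \<omega>) + I t \<omega>"
    unfolding proportional_sde_def H_eq by (elim exE conjE)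
  have H_ad: "adapted F H" and H_mp: "measurable_process M H" and I_meas: "\<And>t. 0 \<le> t \<Longrightarrow> I t \<in> borel_measurable M"
    and I_cont: "continuous_process M I"
    using ito unfolding ito_integral_def by auto
  from ito[unfolded ito_integral_def] obtain n0 \<tau>0 \<xi>0 where si': "\<forall>k. simple_integrand M F (n0 k) (\<tau>0 k) (\<xi>0 k)"
    and conv: "\<forall>t\<ge>0. converges_in_prob M (\<lambda>k \<omega>. LBINT s:{0..t}. (simple_process (n0 k) (\<tau>0 k) (\<xi>0 k) s \<omega> - H s \<omega>)\<^sup>2) (\<lambda>_. 0) \<and>
        converges_in_prob M (\<lambda>k. simple_integral (n0 k) (\<tau>0 k) (\<xi>0 k) W t) (I t)"
    by (elim exE conjE)
  note si = si'[rule_format]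
  note Hc = conv[rule_format, THEN conjunct1] and Ic = conv[rule_format, THEN conjunct2]
  \<comment> \<open>Joint measurability is given for the product \<open>a * Y\<close>. Dividing by
    the positive continuous \<open>Y\<close> yields a jointly measurable process that agrees with
    \<open>a\<close> on \<open>space M\<close> at all times t \<ge> 0.\<close>
  define a' where "a' t \<omega> = H (max 0 t) \<omega> / Y (max 0 t) \<omega>" for t \<omega>
  define Y' where "Y' t \<omega> = Y (max 0 t) \<omega>" for t \<omega>
  define r' where "r' t \<omega> = r (max 0 t) \<omega>" for t \<omega>
  have Yne: "Y t \<omega> \<noteq> 0" if "0 \<le> t" "\<omega> \<in> space M" for t \<omega> using Y_pos[OF that] by simp
  have a': "a' t \<omega> = a t \<omega>" if "0 \<le> t" "\<omega> \<in> space M" for t \<omega>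
    using Yne[OF that] that(1) by (simp add: a'_def H_def max_absorb2)
  have Y': "Y' t \<omega> = Y t \<omega>" and r': "r' t \<omega> = r t \<omega>" if "0 \<le> t" for t \<omega> using that by (auto simp: Y'_def r'_def max_absorb2)
  have aY': "a' s \<omega> * Y' s \<omega> = H (max 0 s) \<omega>" if "\<omega> \<in> space M" for s \<omega>
    using Yne[of "max 0 s" \<omega>] that by (simp add: a'_def Y'_def)
  have YM: "Y t \<in> borel_measurable (F t)" "Y t \<in> borel_measurable M" if "0 \<le> t" for t
    using Y_ad that measurable_F_M unfolding adapted_def by blast+
  have HM: "H t \<in> borel_measurable M" if "0 \<le> t" for t
    using H_ad that measurable_F_M unfolding adapted_def by blast
  have Hp[measurable]: "(\<lambda>p. H (max 0 (fst p)) (snd p)) \<in> borel_measurable (borel \<Otimes>\<^sub>M M)"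
    using measurable_process_max[OF H_mp] by (simp add: split_beta')
  have Yp[measurable]: "(\<lambda>p. Y' (fst p) (snd p)) \<in> borel_measurable (borel \<Otimes>\<^sub>M M)"
    using continuous_process_measurable[OF Y_cont YM(2)] by (simp add: split_beta' Y'_def)
  have rp[measurable]: "(\<lambda>p. r' (fst p) (snd p)) \<in> borel_measurable (borel \<Otimes>\<^sub>M M)"
    using measurable_process_max[OF r_mp] by (simp add: split_beta' r'_def)
  have ap: "(\<lambda>p. a' (fst p) (snd p)) \<in> borel_measurable (borel \<Otimes>\<^sub>M M)"
    unfolding a'_def using Yp unfolding Y'_def by measurable
  have Hs: "(\<lambda>s. H (max 0 s) \<omega>) \<in> borel_measurable borel" if "\<omega> \<in> space M" for \<omega>
    using measurable_compose[OF measurable_Pair2'[OF that, of borel] Hp] by simp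
  have Ys: "(\<lambda>s. Y' s \<omega>) \<in> borel_measurable borel" if "\<omega> \<in> space M" for \<omega>
    using measurable_compose[OF measurable_Pair2'[OF that, of borel] Yp] by simp
  have rs: "(\<lambda>s. r' s \<omega>) \<in> borel_measurable borel" if "\<omega> \<in> space M" for \<omega>
    using measurable_compose[OF measurable_Pair2'[OF that, of borel] rp] by simp
  have rate: "integrated_rate r t \<omega> = (LBINT s:{0<..t}. r' s \<omega>)" if "\<omega> \<in> space M" for t \<omega>
    unfolding integrated_rate_def by (rule set_integral_Icc_Ioc[OF rs[OF that]]) (simp add: r')
  have rate_meas: "integrated_rate r t \<in> borel_measurable M" for t
    using time_integral_meas[OF swap_meas[OF rp], of t] by (rule measurable_cong[THEN iffD1, rotated]) (simp add: rate)
  show "\<And>t. 0 \<le> t \<Longrightarrow> discounted r Y t \<in> borel_measurable M"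
    unfolding discounted_def using YM(2) rate_meas by measurable
  show "\<And>t. 0 \<le> t \<Longrightarrow> a t \<in> borel_measurable M"
  proof -
    fix t :: real assume t: "0 \<le> t"
    have "(\<lambda>\<omega>. H t \<omega> / Y t \<omega>) \<in> borel_measurable M" using HM[OF t] YM(2)[OF t] by simp
    then show "a t \<in> borel_measurable M"
      by (rule measurable_cong[THEN iffD1, rotated]) (use Yne[OF t] in \<open>simp add: H_def\<close>)
  qed
  \<comment> \<open>The error up to the single time \<open>T\<close> decides the subsequence
    \<open>q\<close>. The integrals themselves keep converging in probability along it at every time
    up to \<open>T\<close>.\<close>
  define sq where "sq k \<omega> = (LBINT s:{0<..T}. (simple_process (n0 k) (\<tau>0 k) (\<xi>0 k) s \<omega> - H (max 0 s) \<omega>)\<^sup>2)" for k \<omega>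
  have \<xi>0M: "\<xi>0 k i \<in> borel_measurable M" if "i < n0 k" for k i
    using si[of k] that measurable_F_M unfolding simple_integrand_def by blast
  have sq_meas[measurable]: "sq k \<in> borel_measurable M" for k
    unfolding sq_def
  proof (rule time_integral_meas)
    have [measurable]: "(\<lambda>p. simple_process (n0 k) (\<tau>0 k) (\<xi>0 k) (snd p) (fst p)) \<in> borel_measurable (M \<Otimes>\<^sub>M borel)"
      by (rule simple_process_meas_pair) (rule \<xi>0M)
    have [measurable]: "(\<lambda>p. H (max 0 (snd p)) (fst p)) \<in> borel_measurable (M \<Otimes>\<^sub>M borel)"
      using swap_meas[OF Hp] .
    show "(\<lambda>p. (simple_process (n0 k) (\<tau>0 k) (\<xi>0 k) (snd p) (fst p) - H (max 0 (snd p)) (fst p))\<^sup>2) \<in> borel_measurable (M \<Otimes>\<^sub>M borel)"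
      by measurable
  qed
  have sq_eq: "(LBINT s:{0..T}. (simple_process (n0 k) (\<tau>0 k) (\<xi>0 k) s \<omega> - H s \<omega>)\<^sup>2) = sq k \<omega>" if "\<omega> \<in> space M" for k \<omega>
    unfolding sq_def
  proof (rule set_integral_Icc_Ioc)
    show "(\<lambda>s. (simple_process (n0 k) (\<tau>0 k) (\<xi>0 k) s \<omega> - H (max 0 s) \<omega>)\<^sup>2) \<in> borel_measurable borel"
      by (intro borel_measurable_power borel_measurable_diff simple_process_borel_time Hs that)
  qed (simp add: max_absorb2)
  have "converges_in_prob M sq (\<lambda>_. 0)"
    using Hc[of T] T sq_eq unfolding converges_in_prob_def by (simp cong: conj_cong)
  from min1_of_converges_in_prob[OF sq_meas _ this] have "(\<lambda>k. \<integral>\<omega>. min 1 \<bar>sq k \<omega>\<bar> \<partial>M) \<longlonglongrightarrow> 0" by simp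
  from min1_subseq[OF sq_meas this] obtain q :: "nat \<Rightarrow> nat"
    where q: "strict_mono q" "AE \<omega> in M. (\<lambda>k. sq (q k) \<omega>) \<longlonglongrightarrow> 0" by blast
  have "\<forall>k. \<exists>n \<tau> \<xi>. simple_integrand M F n \<tau> \<xi> \<and> \<tau> 0 = 0 \<and> \<tau> n = T \<and> (\<forall>i<n. \<tau> i < \<tau> (Suc i) \<and> \<tau> (Suc i) - \<tau> i \<le> T / real (Suc k))
     \<and> (\<forall>s \<omega>. 0 < s \<longrightarrow> s \<le> T \<longrightarrow> simple_process n \<tau> \<xi> s \<omega> = simple_process (n0 (q k)) (\<tau>0 (q k)) (\<xi>0 (q k)) s \<omega>)
     \<and> (\<forall>t \<omega>. 0 \<le> t \<longrightarrow> t \<le> T \<longrightarrow> simple_integral n \<tau> \<xi> W t \<omega> = simple_integral (n0 (q k)) (\<tau>0 (q k)) (\<xi>0 (q k)) W t \<omega>)"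
  proof
    fix k
    show "\<exists>n \<tau> \<xi>. simple_integrand M F n \<tau> \<xi> \<and> \<tau> 0 = 0 \<and> \<tau> n = T \<and> (\<forall>i<n. \<tau> i < \<tau> (Suc i) \<and> \<tau> (Suc i) - \<tau> i \<le> T / real (Suc k))
     \<and> (\<forall>s \<omega>. 0 < s \<longrightarrow> s \<le> T \<longrightarrow> simple_process n \<tau> \<xi> s \<omega> = simple_process (n0 (q k)) (\<tau>0 (q k)) (\<xi>0 (q k)) s \<omega>)
     \<and> (\<forall>t \<omega>. 0 \<le> t \<longrightarrow> t \<le> T \<longrightarrow> simple_integral n \<tau> \<xi> W t \<omega> = simple_integral (n0 (q k)) (\<tau>0 (q k)) (\<xi>0 (q k)) W t \<omega>)"
      by (rule simple_integrand_refine[OF si[of "q k"] filtration T, of "Suc k"]) (simp, blast)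
  qed
  then obtain n \<tau> \<xi> where g: "\<And>k. simple_integrand M F (n k) (\<tau> k) (\<xi> k)" "\<And>k. \<tau> k 0 = 0" "\<And>k. \<tau> k (n k) = T"
    "\<And>k i. i < n k \<Longrightarrow> \<tau> k i < \<tau> k (Suc i) \<and> \<tau> k (Suc i) - \<tau> k i \<le> T / real (Suc k)"
    "\<And>k s \<omega>. 0 < s \<Longrightarrow> s \<le> T \<Longrightarrow> simple_process (n k) (\<tau> k) (\<xi> k) s \<omega> = simple_process (n0 (q k)) (\<tau>0 (q k)) (\<xi>0 (q k)) s \<omega>"
    "\<And>k t \<omega>. 0 \<le> t \<Longrightarrow> t \<le> T \<Longrightarrow> simple_integral (n k) (\<tau> k) (\<xi> k) W t \<omega> = simple_integral (n0 (q k)) (\<tau>0 (q k)) (\<xi>0 (q k)) W t \<omega>"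
    by metis
  \<comment> \<open>\<open>sqrt (max 0 K)\<close> turns the bound on the square into one on the
    absolute value and is nonnegative whatever the sign of \<open>K\<close>.\<close>
  interpret A: ito_approx M F W r' a' Y' I s0 "sqrt (max 0 K)" T n \<tau> \<xi>
  proof
    show "0 < T" by (rule T)
    show "0 \<le> sqrt (max 0 K)" by simp
    show "(\<lambda>p. a' (fst p) (snd p)) \<in> borel_measurable (borel \<Otimes>\<^sub>M M)" by (rule ap)
    show "(\<lambda>p. r' (fst p) (snd p)) \<in> borel_measurable (borel \<Otimes>\<^sub>M M)" by (rule rp)
    show "(\<lambda>p. Y' (fst p) (snd p)) \<in> borel_measurable (borel \<Otimes>\<^sub>M M)" by (rule Yp)
    show "\<bar>a' t \<omega>\<bar> \<le> sqrt (max 0 K)" if "0 \<le> t" "\<omega> \<in> space M" for t \<omega>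
      using a_bdd[OF that] a'[OF that] by (intro real_le_rsqrt) (simp add: power2_abs)
    show "Y' t \<in> borel_measurable (F t)" if "0 \<le> t" for t
      unfolding Y'_def using YM(1)[OF that] that by (simp add: max_absorb2)
    show "continuous_on {0..} (\<lambda>t. Y' t \<omega>)" if "\<omega> \<in> space M" for \<omega>
      by (rule continuous_on_eq[of "{0..}" "\<lambda>t. Y t \<omega>"]) (use Y_cont that in \<open>auto simp: continuous_process_def Y'\<close>)
    show "0 < Y' t \<omega>" if "0 \<le> t" "\<omega> \<in> space M" for t \<omega> using Y_pos[OF that] that by (simp add: Y')
    show "Y' 0 \<omega> = s0" if "\<omega> \<in> space M" for \<omega> using Y0[OF that] by (simp add: Y')
    show "I t \<in> borel_measurable M" if "0 \<le> t" for t by (rule I_meas[OF that])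
    show "continuous_on {0..} (\<lambda>t. I t \<omega>)" if "\<omega> \<in> space M" for \<omega> using I_cont that by (auto simp: continuous_process_def)
    show "AE \<omega> in M. set_integrable lborel {0<..T} (\<lambda>s. r' s \<omega>)"
      using r_int
    proof eventually_elim
      case (elim \<omega>)
      then have "set_integrable lborel {0..T} (\<lambda>s. r s \<omega>)" using T by simp
      then have "set_integrable lborel {0<..T} (\<lambda>s. r s \<omega>)" by (rule set_integrable_subset) auto
      then show ?case unfolding set_integrable_def
        by (rule Bochner_Integration.integrable_cong[THEN iffD1, rotated -1]) (auto simp: indicator_def r')
    qed
    show "AE \<omega> in M. \<forall>t. 0 \<le> t \<longrightarrow> t \<le> T \<longrightarrow> Y' t \<omega> = s0 + (LBINT s:{0<..t}. r' s \<omega> * Y' s \<omega>) + I t \<omega>"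
      using sdeY AE_space
    proof eventually_elim
      case (elim \<omega>)
      have "(LBINT s:{0..t}. r s \<omega> * Y s \<omega>) = (LBINT s:{0<..t}. r' s \<omega> * Y' s \<omega>)" for t
        by (rule set_integral_Icc_Ioc) (use rs[OF elim(2)] Ys[OF elim(2)] in \<open>auto simp: r' Y'\<close>)
      then show ?case using elim Y0[OF elim(2)] by (simp add: Y')
    qed
    show "\<tau> k 0 = 0" "\<tau> k (n k) = T" for k by (rule g)+
    show "\<tau> k i < \<tau> k (Suc i)" "\<tau> k (Suc i) - \<tau> k i \<le> T / real (Suc k)" if "i < n k" for k i using g(4)[OF that] by auto
    show "\<xi> k i \<in> borel_measurable (F (\<tau> k i))" if "i < n k" for k i using g(1)[of k] that by (auto simp: simple_integrand_def)
    show "AE \<omega> in M. (\<lambda>k. LBINT s:{0<..T}. (simple_process (n k) (\<tau> k) (\<xi> k) s \<omega> - a' s \<omega> * Y' s \<omega>)\<^sup>2) \<longlonglongrightarrow> 0"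
      using q(2) AE_space
    proof eventually_elim
      case (elim \<omega>)
      have "(LBINT s:{0<..T}. (simple_process (n k) (\<tau> k) (\<xi> k) s \<omega> - a' s \<omega> * Y' s \<omega>)\<^sup>2) = sq (q k) \<omega>" for k
        unfolding sq_def set_lebesgue_integral_def aY'[OF elim(2)]
        by (rule Bochner_Integration.integral_cong) (auto simp: indicator_def g(5))
      with elim(1) show ?case by simp
    qed
    show "(\<lambda>k. \<integral>\<omega>. min 1 \<bar>simple_integral (n k) (\<tau> k) (\<xi> k) W t \<omega> - I t \<omega>\<bar> \<partial>M) \<longlonglongrightarrow> 0" if t: "0 \<le> t" "t \<le> T" for t
    proof -
      have "simple_integral (n0 k) (\<tau>0 k) (\<xi>0 k) W t \<in> borel_measurable M" for k
      proof (rule simple_integral_meas[OF \<xi>0M _ t(1)])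
        show "0 \<le> \<tau>0 k i" if "i \<le> n0 k" for i
          using si[of k] grid_mono[of "n0 k" "\<tau>0 k" 0 i] that by (auto simp: simple_integrand_def)
      qed
      from min1_of_converges_in_prob[OF this I_meas[OF t(1)] Ic[OF t(1)]]
      have "(\<lambda>k. \<integral>\<omega>. min 1 \<bar>simple_integral (n0 k) (\<tau>0 k) (\<xi>0 k) W t \<omega> - I t \<omega>\<bar> \<partial>M) \<longlonglongrightarrow> 0" .
      from LIMSEQ_subseq_LIMSEQ[OF this q(1)] show ?thesis by (simp add: comp_def g(6)[OF t])
    qed
  qed
  have log_ratio: "A.log_ratio t \<omega> = L t \<omega>" if "0 \<le> t" "\<omega> \<in> space M" for t \<omega>
    unfolding A.log_ratio_def L_def discounted_def using Y_pos[OF that] that by (simp add: rate Y' ln_mult)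
  have inner: "(\<integral>\<omega>. iexp (u * A.log_ratio s \<omega>) * complex_of_real ((a' s \<omega>)\<^sup>2) \<partial>M) = (\<integral>\<omega>. iexp (u * L s \<omega>) * complex_of_real ((a s \<omega>)\<^sup>2) \<partial>M)"
    if "0 < s" for s
    using that by (intro Bochner_Integration.integral_cong) (auto simp: log_ratio a')
  have "?lhs = (\<integral>\<omega>. iexp (u * A.log_ratio T \<omega>) \<partial>M)" using T by (intro Bochner_Integration.integral_cong) (auto simp: log_ratio)
  also have "\<dots> = 1 + char_exponent u * (\<integral>s. (\<integral>\<omega>. iexp (u * A.log_ratio s \<omega>) * complex_of_real ((a' s \<omega>)\<^sup>2) \<partial>M) \<partial>restrict_space lborel {0<..T})"
    by (rule A.char_formula(1))
  also have "(\<integral>s. (\<integral>\<omega>. iexp (u * A.log_ratio s \<omega>) * complex_of_real ((a' s \<omega>)\<^sup>2) \<partial>M) \<partial>restrict_space lborel {0<..T}) = ?rhs"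
    by (rule Bochner_Integration.integral_cong[OF refl]) (rule inner, simp add: space_restrict_space)
  finally show "?lhs = 1 + char_exponent u * ?rhs" .
  show "integrable (restrict_space lborel {0<..T}) (\<lambda>s. \<integral>\<omega>. iexp (u * L s \<omega>) * complex_of_real ((a s \<omega>)\<^sup>2) \<partial>M)"
    using A.char_formula(2)[of u]
    by (rule Bochner_Integration.integrable_cong[OF refl, THEN iffD1, rotated]) (rule inner, simp add: space_restrict_space)
qed

subsection \<open>Uniqueness of the weighted laws\<close>

lemma AE_zero_of_integrals_zero:
  fixes f :: "real \<Rightarrow> real"
  assumes int: "\<And>T. 0 < T \<Longrightarrow> set_integrable lborel {0<..T} f" and zero: "\<And>T. 0 < T \<Longrightarrow> (LBINT s:{0<..T}. f s) = 0"
    and bdd: "\<And>s. 0 < s \<Longrightarrow> \<bar>f s\<bar> \<le> B"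
  shows "AE s in lborel. 0 < s \<longrightarrow> f s = 0"
proof -
  have *: "AE s in lborel. 0 < s \<longrightarrow> s \<le> N \<longrightarrow> f s = 0" if N: "0 < N" for N :: real
  proof -
    \<comment> \<open>Adding \<open>B\<close> makes \<open>f\<close> the density of a measure, which is determined by its tails.\<close>
    define p where "p s = indicator {0<..N} s *\<^sub>R f s + B * indicator {0<..N} s" for s
    define p0 where "p0 s = B * indicator {0<..N} s" for s :: real
    have fi: "integrable lborel (\<lambda>s. indicator {0<..N} s *\<^sub>R f s)" using int[OF N] by (simp add: set_integrable_def)
    have pi: "integrable lborel p" unfolding p_def using fi N by simp
    have p0i: "integrable lborel p0" unfolding p0_def using N by simp
    note [measurable] = borel_measurable_integrable[OF pi] borel_measurable_integrable[OF p0i]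
    have pnn: "0 \<le> p s" "0 \<le> p0 s" for s using bdd[of s] by (auto simp: p_def p0_def indicator_def)
    have eqm: "density lborel (\<lambda>s. ennreal (p s)) = density lborel (\<lambda>s. ennreal (p0 s))"
    proof (rule measure_eqI_lessThan)
      fix x :: real
      have em: "emeasure (density lborel (\<lambda>s. ennreal (h s))) {x<..} = ennreal (\<integral>s. h s * indicator {x<..} s \<partial>lborel)"
        if "integrable lborel h" "\<And>s. 0 \<le> h s" for h :: "real \<Rightarrow> real"
      proof -
        note [measurable] = borel_measurable_integrable[OF that(1)]
        have "integrable lborel (\<lambda>s. h s * indicator {x<..} s)"
          using integrable_mult_indicator[OF _ that(1), of "{x<..}"] by (simp add: mult.commute)
        then have "ennreal (\<integral>s. h s * indicator {x<..} s \<partial>lborel) = (\<integral>\<^sup>+s. ennreal (h s * indicator {x<..} s) \<partial>lborel)"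
          using that(2) by (intro nn_integral_eq_integral[symmetric]) auto
        also have "\<dots> = (\<integral>\<^sup>+s. ennreal (h s) * indicator {x<..} s \<partial>lborel)"
          by (intro nn_integral_cong) (auto simp: indicator_def)
        finally show ?thesis by (subst emeasure_density) auto
      qed
      show "emeasure (density lborel (\<lambda>s. ennreal (p s))) {x<..} < \<infinity>"
        by (subst em[OF pi pnn(1)]) simp
      \<comment> \<open>Every tail of \<open>f\<close> inside (0, N] is one of the vanishing
        integrals or a difference of two of them, so adding \<open>f\<close> to the constant
        \<open>B\<close> leaves all tails unchanged.\<close>
      have tail: "(\<integral>s. indicator {x<..} s * (indicator {0<..N} s *\<^sub>R f s) \<partial>lborel) = 0"
      proof (cases "N \<le> x")
        case True
        then have "(\<lambda>s. indicator {x<..} s * (indicator {0<..N} s *\<^sub>R f s)) = (\<lambda>_. 0)" by (auto simp: indicator_def)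
        then show ?thesis by simp
      next
        case False
        show ?thesis
        proof (cases "0 < x")
          case True
          have "(\<integral>s. indicator {x<..} s * (indicator {0<..N} s *\<^sub>R f s) \<partial>lborel) = (LBINT s:{x<..N}. f s)"
            unfolding set_lebesgue_integral_def using True by (intro Bochner_Integration.integral_cong) (auto simp: indicator_def)
          also have "\<dots> = (LBINT s:{0<..N}. f s) - (LBINT s:{0<..x}. f s)"
            by (rule set_integral_Ioc_diff[OF int[OF N], symmetric]) (use True \<open>\<not> N \<le> x\<close> in auto)
          finally show ?thesis using zero[OF N] zero[OF True] by simp
        next
          case False
          then have "(\<integral>s. indicator {x<..} s * (indicator {0<..N} s *\<^sub>R f s) \<partial>lborel) = (LBINT s:{0<..N}. f s)"
            unfolding set_lebesgue_integral_def by (intro Bochner_Integration.integral_cong) (auto simp: indicator_def)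
          then show ?thesis using zero[OF N] by simp
        qed
      qed
      have "(\<integral>s. p s * indicator {x<..} s \<partial>lborel) = (\<integral>s. indicator {x<..} s * (indicator {0<..N} s *\<^sub>R f s) + p0 s * indicator {x<..} s \<partial>lborel)"
        by (intro Bochner_Integration.integral_cong) (auto simp: p_def p0_def algebra_simps)
      also have "\<dots> = (\<integral>s. indicator {x<..} s * (indicator {0<..N} s *\<^sub>R f s) \<partial>lborel) + (\<integral>s. p0 s * indicator {x<..} s \<partial>lborel)"
        using integrable_mult_indicator[OF _ fi, of "{x<..}"] integrable_mult_indicator[OF _ p0i, of "{x<..}"]
        by (intro Bochner_Integration.integral_add) (auto simp: mult.commute)
      finally show "emeasure (density lborel (\<lambda>s. ennreal (p s))) {x<..} = emeasure (density lborel (\<lambda>s. ennreal (p0 s))) {x<..}"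
        unfolding em[OF pi pnn(1)] em[OF p0i pnn(2)] tail by simp
    qed simp_all
    have "AE s in lborel. ennreal (p s) = ennreal (p0 s)"
      using eqm by (intro sigma_finite_measure.density_unique[OF sigma_finite_lborel]) auto
    then show ?thesis
    proof eventually_elim
      case (elim s)
      then have "p s = p0 s" using pnn by (simp add: ennreal_inj)
      then show ?case by (auto simp: p_def p0_def)
    qed
  qed
  have "AE s in lborel. \<forall>N. 0 < s \<longrightarrow> s \<le> real (Suc N) \<longrightarrow> f s = 0"
    unfolding AE_all_countable using * by auto
  then show ?thesis
  proof eventually_elim
    case (elim s)
    show ?case
    proof
      assume "0 < s"
      moreover obtain N where "s \<le> real N" using real_arch_simple by blast
      then have "s \<le> real (Suc N)" by simp
      ultimately show "f s = 0" using elim by blast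
    qed
  qed
qed

text \<open>Equality at u = 0 gives both weighted laws the same mass \<open>c\<close>, which is
  positive because of the lower bound \<open>lo\<close>. Divided by \<open>c\<close> they are
  probability laws with equal characteristic functions, and Levy's theorem identifies them.\<close>

lemma weighted_law_eq:
  fixes Z1 Z2 v1 v2 :: "'a \<Rightarrow> real"
  assumes "prob_space M" and [measurable]: "Z1 \<in> borel_measurable M" "Z2 \<in> borel_measurable M" "v1 \<in> borel_measurable M" "v2 \<in> borel_measurable M"
    and lo: "0 < lo" "\<And>\<omega>. \<omega> \<in> space M \<Longrightarrow> lo \<le> v1 \<omega>" "\<And>\<omega>. \<omega> \<in> space M \<Longrightarrow> lo \<le> v2 \<omega>"
    and hi: "\<And>\<omega>. \<omega> \<in> space M \<Longrightarrow> v1 \<omega> \<le> hi" "\<And>\<omega>. \<omega> \<in> space M \<Longrightarrow> v2 \<omega> \<le> hi"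
    and eq: "\<And>u. (\<integral>\<omega>. iexp (u * Z1 \<omega>) * complex_of_real (v1 \<omega>) \<partial>M) = (\<integral>\<omega>. iexp (u * Z2 \<omega>) * complex_of_real (v2 \<omega>) \<partial>M)"
    and B[measurable]: "B \<in> sets borel"
  shows "(\<integral>\<omega>. indicator B (Z1 \<omega>) * v1 \<omega> \<partial>M) = (\<integral>\<omega>. indicator B (Z2 \<omega>) * v2 \<omega> \<partial>M)"
proof -
  interpret prob_space M by fact
  define c where "c = (\<integral>\<omega>. v1 \<omega> \<partial>M)"
  have vi: "integrable M v1" "integrable M v2"
    using lo hi by (auto intro!: integrable_const_bound[where B=hi] AE_I2 simp: abs_le_iff) (fastforce intro: order_trans)+
  have c2: "(\<integral>\<omega>. v2 \<omega> \<partial>M) = c" using eq[of 0] by (simp add: c_def)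
  have "(\<integral>\<omega>. lo \<partial>M) \<le> c" unfolding c_def using lo vi by (intro integral_mono) auto
  then have c: "0 < c" using lo(1) by (simp add: prob_space)
  have main: "real_distribution (distr (density M (\<lambda>\<omega>. ennreal (v \<omega> / c))) borel Z) \<and>
      (\<forall>u. char (distr (density M (\<lambda>\<omega>. ennreal (v \<omega> / c))) borel Z) u = (\<integral>\<omega>. iexp (u * Z \<omega>) * complex_of_real (v \<omega>) \<partial>M) / complex_of_real c) \<and>
      measure (distr (density M (\<lambda>\<omega>. ennreal (v \<omega> / c))) borel Z) B = (\<integral>\<omega>. indicator B (Z \<omega>) * v \<omega> \<partial>M) / c"
    if [measurable]: "v \<in> borel_measurable M" "Z \<in> borel_measurable M" and v: "integrable M v" "\<And>\<omega>. \<omega> \<in> space M \<Longrightarrow> lo \<le> v \<omega>" "(\<integral>\<omega>. v \<omega> \<partial>M) = c"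
    for v Z :: "'a \<Rightarrow> real"
  proof -
    have vnn: "0 \<le> v \<omega>" if "\<omega> \<in> space M" for \<omega> using v(2)[OF that] lo(1) by simp
    let ?D = "density M (\<lambda>\<omega>. ennreal (v \<omega> / c))"
    have "emeasure ?D (space M) = (\<integral>\<^sup>+\<omega>. ennreal (v \<omega> / c) \<partial>M)" by (subst emeasure_density) (auto intro!: nn_integral_cong)
    also have "\<dots> = ennreal (\<integral>\<omega>. v \<omega> / c \<partial>M)" using v(1) vnn c by (intro nn_integral_eq_integral) auto
    also have "(\<integral>\<omega>. v \<omega> / c \<partial>M) = 1" using v(3) c by simp
    finally interpret D: prob_space ?D by (intro prob_spaceI) simp
    have "real_distribution (distr ?D borel Z)" by (rule D.real_distribution_distr) simp
    moreover have "char (distr ?D borel Z) u = (\<integral>\<omega>. iexp (u * Z \<omega>) * complex_of_real (v \<omega>) \<partial>M) / complex_of_real c" for u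
    proof -
      have "char (distr ?D borel Z) u = (\<integral>\<omega>. iexp (u * Z \<omega>) \<partial>?D)" unfolding char_def by (subst integral_distr) auto
      also have "\<dots> = (\<integral>\<omega>. (v \<omega> / c) *\<^sub>R iexp (u * Z \<omega>) \<partial>M)" using vnn c by (subst integral_density) auto
      also have "\<dots> = (\<integral>\<omega>. (iexp (u * Z \<omega>) * complex_of_real (v \<omega>)) / complex_of_real c \<partial>M)"
        by (intro Bochner_Integration.integral_cong refl) (simp add: scaleR_conv_of_real mult.commute)
      finally show ?thesis by simp
    qed
    moreover have "measure (distr ?D borel Z) B = (\<integral>\<omega>. indicator B (Z \<omega>) * v \<omega> \<partial>M) / c"
    proof -
      have "measure (distr ?D borel Z) B = (\<integral>x. indicator B x \<partial>distr ?D borel Z)" by simp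
      also have "\<dots> = (\<integral>\<omega>. indicator B (Z \<omega>) \<partial>?D)" by (subst integral_distr) auto
      also have "\<dots> = (\<integral>\<omega>. (v \<omega> / c) *\<^sub>R indicator B (Z \<omega>) \<partial>M)" using vnn c by (subst integral_density) auto
      also have "\<dots> = (\<integral>\<omega>. (indicator B (Z \<omega>) * v \<omega>) / c \<partial>M)"
        by (intro Bochner_Integration.integral_cong refl) simp
      finally show ?thesis by simp
    qed
    ultimately show ?thesis by blast
  qed
  note m1 = main[OF \<open>v1 \<in> borel_measurable M\<close> \<open>Z1 \<in> borel_measurable M\<close> vi(1) lo(2) c_def[symmetric]]
  note m2 = main[OF \<open>v2 \<in> borel_measurable M\<close> \<open>Z2 \<in> borel_measurable M\<close> vi(2) lo(3) c2]
  have "distr (density M (\<lambda>\<omega>. ennreal (v1 \<omega> / c))) borel Z1 = distr (density M (\<lambda>\<omega>. ennreal (v2 \<omega> / c))) borel Z2"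
    using m1 m2 eq by (intro Levy_uniqueness) auto
  then show ?thesis using m1 m2 c by simp
qed

text \<open>Makes the regression function the density, with respect to the law of \<open>Z\<close>,
  of the law of \<open>Z\<close> weighted by the conditioned quantity. In this form the regression
  functions of two different variables with a common law can be compared.\<close>

lemma cond_exp_at_integral:
  assumes "prob_space M" and [measurable]: "Z \<in> borel_measurable M" and \<phi>: "integrable M (\<lambda>\<omega>. \<phi> (Z \<omega>) \<omega>)"
  shows "integrable (distr M borel Z) (cond_exp_at M Z \<phi>)"
    and "A \<in> sets borel \<Longrightarrow> (LINT x:A|distr M borel Z. cond_exp_at M Z \<phi> x) = (\<integral>\<omega>. indicator A (Z \<omega>) * \<phi> (Z \<omega>) \<omega> \<partial>M)"
proof -
  interpret prob_space M by fact
  let ?S = "vimage_algebra (space M) Z borel"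
  interpret S: finite_measure_subalgebra M ?S
    by unfold_locales (auto simp: subalgebra_def sets_vimage_algebra2)
  define g where "g = cond_exp_at M Z \<phi>"
  have [measurable]: "g \<in> borel_measurable borel"
    and ae: "AE \<omega> in M. real_cond_exp M ?S (\<lambda>\<omega>. \<phi> (Z \<omega>) \<omega>) \<omega> = g (Z \<omega>)"
    using cond_exp_version_cond_exp_at[of M Z \<phi>] by (auto simp: cond_exp_version_def g_def)
  have ri: "integrable M (real_cond_exp M ?S (\<lambda>\<omega>. \<phi> (Z \<omega>) \<omega>))" by (rule S.real_cond_exp_int(1)[OF \<phi>])
  have gi: "integrable M (\<lambda>\<omega>. g (Z \<omega>))"
    by (rule integrable_cong_AE_imp[OF ri]) (use ae in auto)
  then have "integrable (distr M borel Z) g" by (subst integrable_distr_eq) auto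
  then show "integrable (distr M borel Z) (cond_exp_at M Z \<phi>)" by (simp add: g_def)
  show "(LINT x:A|distr M borel Z. cond_exp_at M Z \<phi> x) = (\<integral>\<omega>. indicator A (Z \<omega>) * \<phi> (Z \<omega>) \<omega> \<partial>M)"
    if [measurable]: "A \<in> sets borel"
  proof -
    let ?X = "Z -` A \<inter> space M"
    have X: "?X \<in> sets ?S" by (auto simp: sets_vimage_algebra2)
    have "(LINT x:A|distr M borel Z. g x) = (\<integral>\<omega>. indicator A (Z \<omega>) *\<^sub>R g (Z \<omega>) \<partial>M)"
      unfolding set_lebesgue_integral_def by (subst integral_distr) auto
    also have "\<dots> = (LINT \<omega>:?X|M. real_cond_exp M ?S (\<lambda>\<omega>. \<phi> (Z \<omega>) \<omega>) \<omega>)"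
      unfolding set_lebesgue_integral_def
    proof (rule integral_cong_AE)
      show "AE \<omega> in M. indicator A (Z \<omega>) *\<^sub>R g (Z \<omega>) = indicat_real ?X \<omega> *\<^sub>R real_cond_exp M ?S (\<lambda>\<omega>. \<phi> (Z \<omega>) \<omega>) \<omega>"
        using ae AE_space by eventually_elim (auto simp: indicator_def)
    qed (use ri in \<open>auto dest: borel_measurable_integrable\<close>)
    also have "\<dots> = (LINT \<omega>:?X|M. \<phi> (Z \<omega>) \<omega>)" by (rule S.real_cond_exp_intA[OF \<phi> X, symmetric])
    also have "\<dots> = (\<integral>\<omega>. indicator A (Z \<omega>) * \<phi> (Z \<omega>) \<omega> \<partial>M)"
      unfolding set_lebesgue_integral_def by (intro Bochner_Integration.integral_cong) (auto simp: indicator_def)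
    finally show ?thesis by (simp add: g_def)
  qed
qed

text \<open>Approaching u from the side away from 0, and from above if u = 0, keeps the
  approximating rationals nonzero.\<close>

lemma rational_nonzero_approx:
  fixes u :: real
  obtains q :: "nat \<Rightarrow> real" where "\<And>k. q k \<in> \<rat> - {0}" "q \<longlonglongrightarrow> u"
proof -
  have "\<exists>q. q \<in> \<rat> - {0} \<and> \<bar>q - u\<bar> \<le> 1 / real (Suc k)" for k
  proof (cases "u < 0")
    case True
    obtain q where "q \<in> \<rat>" "u - 1 / real (Suc k) < q" "q < u"
      using Rats_dense_in_real[of "u - 1 / real (Suc k)" u] by auto
    then show ?thesis using True by (intro exI[of _ q]) auto
  next
    case False
    obtain q where "q \<in> \<rat>" "u < q" "q < u + 1 / real (Suc k)"
      using Rats_dense_in_real[of u "u + 1 / real (Suc k)"] by auto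
    then show ?thesis using False by (intro exI[of _ q]) auto
  qed
  then obtain q where q: "\<And>k. q k \<in> \<rat> - {0}" "\<And>k. \<bar>q k - u\<bar> \<le> 1 / real (Suc k)" by metis
  have "(\<lambda>k. q k - u) \<longlonglongrightarrow> 0"
    by (rule Lim_null_comparison[OF _ LIMSEQ_Suc[OF lim_1_over_n]]) (use q(2) in auto)
  then have "q \<longlonglongrightarrow> u" by (rule LIM_zero_cancel)
  with q(1) show ?thesis by (rule that)
qed

theorem mainTheorem4:
  fixes M :: "'a measure" and F :: "real \<Rightarrow> 'a measure"
    and W r V S X :: "real \<Rightarrow> 'a \<Rightarrow> real"
    and \<sigma> :: "real \<Rightarrow> real \<Rightarrow> real"
    and s0 v_lo v_hi \<sigma>_lo \<sigma>_hi :: real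
  assumes "filtered_prob_space M F"
    and "brownian_motion M F W"
    and "adapted F r" and "measurable_process M r"
    and "AE \<omega> in M. \<forall>t\<ge>0. set_integrable lborel {0..t} (\<lambda>s. r s \<omega>)"
    and "adapted F V" and "measurable_process M V"
    and "0 < v_lo" and "\<forall>t\<ge>0. \<forall>\<omega>\<in>space M. v_lo \<le> V t \<omega> \<and> V t \<omega> \<le> v_hi"
    and "(\<lambda>(t, x). \<sigma> t x) \<in> borel_measurable (restrict_space borel ({0..} \<times> {0<..}))"
    and "0 < \<sigma>_lo" and "\<forall>t\<ge>0. \<forall>x>0. \<sigma>_lo \<le> (\<sigma> t x)\<^sup>2 \<and> (\<sigma> t x)\<^sup>2 \<le> \<sigma>_hi"
    and "adapted F S" and "continuous_process M S" and "\<forall>t\<ge>0. \<forall>\<omega>\<in>space M. S t \<omega> > 0"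
    and "adapted F X" and "continuous_process M X" and "\<forall>t\<ge>0. \<forall>\<omega>\<in>space M. X t \<omega> > 0"
    and "s0 > 0" and "\<forall>\<omega>\<in>space M. S 0 \<omega> = s0 \<and> X 0 \<omega> = s0"
    and "proportional_sde M F W r (\<lambda>t \<omega>. sqrt (V t \<omega>)) S"
    and "proportional_sde M F W r (\<lambda>t \<omega>. \<sigma> t (X t \<omega>)) X"
    and "\<forall>t\<ge>0. distr M borel (discounted r S t) = distr M borel (discounted r X t)"
  shows "AE t in lborel. t \<ge> 0 \<longrightarrow>
    (AE x in distr M borel (discounted r S t).
      cond_exp_at M (discounted r S t) (\<lambda>_ \<omega>. V t \<omega>) x =
      cond_exp_at M (discounted r X t) (\<lambda>x' \<omega>. (\<sigma> t (x' * exp (integrated_rate r t \<omega>)))\<^sup>2) x)"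
proof -
  interpret prob_space M using assms(1) by (simp add: filtered_prob_space_def)
  define a1 where "a1 = (\<lambda>t \<omega>. sqrt (V t \<omega>))"
  define a2 where "a2 = (\<lambda>t \<omega>. \<sigma> t (X t \<omega>))"
  define D1 where "D1 = discounted r S"
  define D2 where "D2 = discounted r X"
  define L1 where "L1 t \<omega> = ln (D1 t \<omega>) - ln s0" for t \<omega>
  define L2 where "L2 t \<omega> = ln (D2 t \<omega>) - ln s0" for t \<omega>
  define lo where "lo = min v_lo \<sigma>_lo"
  define hi where "hi = max v_hi \<sigma>_hi"
  have V: "v_lo \<le> V t \<omega>" "V t \<omega> \<le> v_hi" if "0 \<le> t" "\<omega> \<in> space M" for t \<omega> using assms(9) that by auto
  have Xpos: "0 < X t \<omega>" and Spos: "0 < S t \<omega>" if "0 \<le> t" "\<omega> \<in> space M" for t \<omega> using assms(15,18) that by auto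
  have a1V: "(a1 t \<omega>)\<^sup>2 = V t \<omega>" if "0 \<le> t" "\<omega> \<in> space M" for t \<omega>
    using V(1)[OF that] assms(8) by (simp add: a1_def)
  have b1: "lo \<le> (a1 t \<omega>)\<^sup>2" "(a1 t \<omega>)\<^sup>2 \<le> hi" if "0 \<le> t" "\<omega> \<in> space M" for t \<omega>
    using V[OF that] a1V[OF that] by (auto simp: lo_def hi_def)
  have b2: "lo \<le> (a2 t \<omega>)\<^sup>2" "(a2 t \<omega>)\<^sup>2 \<le> hi" if "0 \<le> t" "\<omega> \<in> space M" for t \<omega>
    using assms(12) Xpos[OF that] that(1) by (auto simp: lo_def hi_def a2_def min_le_iff_disj le_max_iff_disj)
  have lo: "0 < lo" using assms(8,11) by (simp add: lo_def)
  have D1pos: "0 < D1 t \<omega>" and D2pos: "0 < D2 t \<omega>" if "0 \<le> t" "\<omega> \<in> space M" for t \<omega>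
    using Xpos[OF that] Spos[OF that] by (auto simp: D1_def D2_def discounted_def)
  have S0: "\<forall>\<omega>\<in>space M. S 0 \<omega> = s0" and X0: "\<forall>\<omega>\<in>space M. X 0 \<omega> = s0" using assms(20) by auto
  have b1': "\<forall>t\<ge>0. \<forall>\<omega>\<in>space M. (a1 t \<omega>)\<^sup>2 \<le> hi" and b2': "\<forall>t\<ge>0. \<forall>\<omega>\<in>space M. (a2 t \<omega>)\<^sup>2 \<le> hi" using b1(2) b2(2) by auto
  note C1 = proportional_sde_char[OF assms(1,2,4,5) b1' assms(13,14,15) S0 assms(21)[folded a1_def], folded D1_def, folded L1_def]
  note C2 = proportional_sde_char[OF assms(1,2,4,5) b2' assms(16,17,18) X0 assms(22)[folded a2_def], folded D2_def, folded L2_def]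
  have a1M: "a1 t \<in> borel_measurable M" and D1M: "D1 t \<in> borel_measurable M" if "0 \<le> t" for t
    using C1(3,4)[OF zero_less_one that] by auto
  have a2M: "a2 t \<in> borel_measurable M" and D2M: "D2 t \<in> borel_measurable M" if "0 \<le> t" for t
    using C2(3,4)[OF zero_less_one that] by auto
  define h1 where "h1 u s = (\<integral>\<omega>. iexp (u * L1 s \<omega>) * complex_of_real ((a1 s \<omega>)\<^sup>2) \<partial>M)" for u s
  define h2 where "h2 u s = (\<integral>\<omega>. iexp (u * L2 s \<omega>) * complex_of_real ((a2 s \<omega>)\<^sup>2) \<partial>M)" for u s
  have L1M: "L1 t \<in> borel_measurable M" and L2M: "L2 t \<in> borel_measurable M" if "0 \<le> t" for t
    unfolding L1_def L2_def using D1M[OF that] D2M[OF that] by measurable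
  have laws: "(\<integral>\<omega>. iexp (u * L1 t \<omega>) \<partial>M) = (\<integral>\<omega>. iexp (u * L2 t \<omega>) \<partial>M)" if t: "0 \<le> t" for u t
  proof -
    note [measurable] = D1M[OF t] D2M[OF t]
    have "(\<integral>\<omega>. iexp (u * L1 t \<omega>) \<partial>M) = (\<integral>x. iexp (u * (ln x - ln s0)) \<partial>distr M borel (D1 t))"
      unfolding L1_def by (subst integral_distr) auto
    also have "distr M borel (D1 t) = distr M borel (D2 t)" using assms(23) t by (simp add: D1_def D2_def)
    also have "(\<integral>x. iexp (u * (ln x - ln s0)) \<partial>distr M borel (D2 t)) = (\<integral>\<omega>. iexp (u * L2 t \<omega>) \<partial>M)"
      unfolding L2_def by (subst integral_distr) auto
    finally show ?thesis .
  qed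
  have hb: "norm (h1 u s) \<le> hi" "norm (h2 u s) \<le> hi" if s: "0 \<le> s" for u s
  proof -
    have *: "norm (\<integral>\<omega>. iexp (u * L \<omega>) * complex_of_real ((v \<omega>)\<^sup>2) \<partial>M) \<le> hi"
      if [measurable]: "L \<in> borel_measurable M" "v \<in> borel_measurable M" and "\<And>\<omega>. \<omega> \<in> space M \<Longrightarrow> (v \<omega>)\<^sup>2 \<le> hi" for L v :: "'a \<Rightarrow> real"
    proof -
      have "norm (\<integral>\<omega>. iexp (u * L \<omega>) * complex_of_real ((v \<omega>)\<^sup>2) \<partial>M) \<le> (\<integral>\<omega>. hi \<partial>M)"
        by (rule norm_integral_le)
          (use that(3) in \<open>auto simp: norm_mult norm_power intro!: integrable_const_bound[where B=hi]\<close>)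
      then show ?thesis by (simp add: prob_space)
    qed
    show "norm (h1 u s) \<le> hi" unfolding h1_def by (rule *[OF L1M[OF s] a1M[OF s] b1(2)[OF s]])
    show "norm (h2 u s) \<le> hi" unfolding h2_def by (rule *[OF L2M[OF s] a2M[OF s] b2(2)[OF s]])
  qed
  \<comment> \<open>The laws agree at every time, so cancelling the nonzero factor in the two
    formulas leaves equal integrals of \<open>h1 u\<close> and \<open>h2 u\<close> over (0, T] for
    all T.\<close>
  have ae: "AE s in lborel. 0 < s \<longrightarrow> h1 u s = h2 u s" if u: "u \<noteq> 0" for u
  proof -
    let ?d = "\<lambda>s. h1 u s - h2 u s"
    have exponent_nonzero: "char_exponent u \<noteq> 0" using u by (auto simp: char_exponent_def complex_eq_iff)
    have di: "integrable (restrict_space lborel {0<..T}) ?d" and dz: "(\<integral>s. ?d s \<partial>restrict_space lborel {0<..T}) = 0" if T: "0 < T" for T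
    proof -
      have i: "integrable (restrict_space lborel {0<..T}) (h1 u)" "integrable (restrict_space lborel {0<..T}) (h2 u)"
        unfolding h1_def[abs_def] h2_def[abs_def] by (rule C1(2)[OF T], rule C2(2)[OF T])
      then show "integrable (restrict_space lborel {0<..T}) ?d" by simp
      have "char_exponent u * (\<integral>s. h1 u s \<partial>restrict_space lborel {0<..T}) = char_exponent u * (\<integral>s. h2 u s \<partial>restrict_space lborel {0<..T})"
        using C1(1)[OF T, of u] C2(1)[OF T, of u] laws[of T u] T unfolding h1_def h2_def by simp
      then show "(\<integral>s. ?d s \<partial>restrict_space lborel {0<..T}) = 0" using exponent_nonzero i by simp
    qed
    have nb: "norm (?d s) \<le> 2 * hi" if "0 < s" for s
      using norm_triangle_ineq4[of "h1 u s" "h2 u s"] hb[of s u] that by linarith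
    have Re0: "AE s in lborel. 0 < s \<longrightarrow> Re (?d s) = 0"
    proof (rule AE_zero_of_integrals_zero[where B="2 * hi"])
      fix T :: real assume T: "0 < T"
      show "set_integrable lborel {0<..T} (\<lambda>s. Re (?d s))"
        using integrable_Re[OF di[OF T]] by (simp add: integrable_restrict_space set_integrable_def)
      show "(LBINT s:{0<..T}. Re (?d s)) = 0"
        using integral_Re[OF di[OF T]] dz[OF T] by (simp add: integral_restrict_space set_lebesgue_integral_def)
    next
      fix s :: real assume "0 < s"
      then show "\<bar>Re (?d s)\<bar> \<le> 2 * hi" using nb[of s] abs_Re_le_cmod[of "?d s"] by linarith
    qed
    have Im0: "AE s in lborel. 0 < s \<longrightarrow> Im (?d s) = 0"
    proof (rule AE_zero_of_integrals_zero[where B="2 * hi"])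
      fix T :: real assume T: "0 < T"
      show "set_integrable lborel {0<..T} (\<lambda>s. Im (?d s))"
        using integrable_Im[OF di[OF T]] by (simp add: integrable_restrict_space set_integrable_def)
      show "(LBINT s:{0<..T}. Im (?d s)) = 0"
        using integral_Im[OF di[OF T]] dz[OF T] by (simp add: integral_restrict_space set_lebesgue_integral_def)
    next
      fix s :: real assume "0 < s"
      then show "\<bar>Im (?d s)\<bar> \<le> 2 * hi" using nb[of s] abs_Im_le_cmod[of "?d s"] by linarith
    qed
    from Re0 Im0 show ?thesis by eventually_elim (auto simp: complex_eq_iff)
  qed
  \<comment> \<open>The exceptional set of times depends on u, so a common one is available only for
    countably many frequencies.\<close>
  have "AE s in lborel. \<forall>u\<in>\<rat> - {0}. 0 < s \<longrightarrow> h1 u s = h2 u s"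
    by (subst AE_ball_countable) (auto simp: countable_rat intro: ae)
  \<comment> \<open>The formulas concern times s > 0; time 0 is absorbed into the null set.\<close>
  then show ?thesis
    using AE_lborel_singleton[of 0]
  proof eventually_elim
    case (elim t)
    show ?case
    proof
      assume "0 \<le> t"
      then have t: "0 < t" "0 \<le> t" using elim(2) by auto
      note [measurable] = L1M[OF t(2)] L2M[OF t(2)] a1M[OF t(2)] a2M[OF t(2)] D1M[OF t(2)] D2M[OF t(2)]
      have cont: "(\<lambda>k. \<integral>\<omega>. iexp (q k * L \<omega>) * complex_of_real ((v \<omega>)\<^sup>2) \<partial>M) \<longlonglongrightarrow> (\<integral>\<omega>. iexp (u * L \<omega>) * complex_of_real ((v \<omega>)\<^sup>2) \<partial>M)"
        if q: "q \<longlonglongrightarrow> u" and [measurable]: "L \<in> borel_measurable M" "v \<in> borel_measurable M" and bv: "\<And>\<omega>. \<omega> \<in> space M \<Longrightarrow> (v \<omega>)\<^sup>2 \<le> hi"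
        for L v :: "'a \<Rightarrow> real" and q u
      proof (rule integral_dominated_convergence[where w="\<lambda>_. hi"])
        show "AE \<omega> in M. (\<lambda>k. iexp (q k * L \<omega>) * complex_of_real ((v \<omega>)\<^sup>2)) \<longlonglongrightarrow> iexp (u * L \<omega>) * complex_of_real ((v \<omega>)\<^sup>2)"
          by (intro AE_I2 tendsto_intros q)
        show "AE \<omega> in M. norm (iexp (q k * L \<omega>) * complex_of_real ((v \<omega>)\<^sup>2)) \<le> hi" for k
          by (rule AE_I2) (use bv in \<open>simp add: norm_mult norm_power\<close>)
      qed auto
      \<comment> \<open>At a fixed time both transforms are continuous in u by dominated
        convergence, which supplies the irrational frequencies and u = 0.\<close>
      have eq: "h1 u t = h2 u t" for u
      proof -
        obtain q where q: "\<And>k. q k \<in> \<rat> - {0}" "q \<longlonglongrightarrow> u" by (rule rational_nonzero_approx[of u]) blast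
        have "(\<lambda>k. h1 (q k) t) \<longlonglongrightarrow> h1 u t" unfolding h1_def by (rule cont[OF q(2)]) (use b1(2) t in auto)
        moreover have "(\<lambda>k. h2 (q k) t) \<longlonglongrightarrow> h2 u t" unfolding h2_def by (rule cont[OF q(2)]) (use b2(2) t in auto)
        moreover have "h1 (q k) t = h2 (q k) t" for k using elim(1) q(1)[of k] t by blast
        ultimately show ?thesis by (simp add: LIMSEQ_unique)
      qed
      have weighted: "(\<integral>\<omega>. indicator B (L1 t \<omega>) * (a1 t \<omega>)\<^sup>2 \<partial>M) = (\<integral>\<omega>. indicator B (L2 t \<omega>) * (a2 t \<omega>)\<^sup>2 \<partial>M)"
        if "B \<in> sets borel" for B
        by (rule weighted_law_eq[OF prob_space_axioms, where lo=lo and hi=hi])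
          (use lo b1 b2 t that eq in \<open>auto simp: h1_def h2_def\<close>)
      have \<phi>1: "integrable M (\<lambda>\<omega>. V t \<omega>)"
      proof -
        have "integrable M (\<lambda>\<omega>. (a1 t \<omega>)\<^sup>2)" by (rule integrable_const_bound[where B=hi]) (use b1(2) t in auto)
        then show ?thesis by (rule Bochner_Integration.integrable_cong[OF refl, THEN iffD1, rotated]) (use a1V t in auto)
      qed
      have X_eq: "D2 t \<omega> * exp (integrated_rate r t \<omega>) = X t \<omega>" for \<omega>
        by (simp add: D2_def discounted_def mult.assoc exp_add[symmetric])
      have \<phi>2: "integrable M (\<lambda>\<omega>. (\<sigma> t (D2 t \<omega> * exp (integrated_rate r t \<omega>)))\<^sup>2)"
        unfolding X_eq using b2(2) t a2M[OF t(2)] unfolding a2_def by (intro integrable_const_bound[where B=hi]) auto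
      note E1 = cond_exp_at_integral[OF prob_space_axioms D1M[OF t(2)], where \<phi>="\<lambda>_ \<omega>. V t \<omega>", OF \<phi>1]
      note E2 = cond_exp_at_integral[OF prob_space_axioms D2M[OF t(2)], where \<phi>="\<lambda>x' \<omega>. (\<sigma> t (x' * exp (integrated_rate r t \<omega>)))\<^sup>2", OF \<phi>2]
      have law: "distr M borel (D1 t) = distr M borel (D2 t)" using assms(23) t by (simp add: D1_def D2_def)
      have "AE x in distr M borel (D1 t). cond_exp_at M (D1 t) (\<lambda>_ \<omega>. V t \<omega>) x =
          cond_exp_at M (D2 t) (\<lambda>x' \<omega>. (\<sigma> t (x' * exp (integrated_rate r t \<omega>)))\<^sup>2) x"
      \<comment> \<open>By the equality of the laws both functions are densities with respect to one
        measure, so it is enough that their integrals over every Borel set agree.\<close>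
      proof (rule density_unique_real[OF E1(1) E2(1)[folded law]])
        fix A assume "A \<in> sets (distr M borel (D1 t))"
        then have A[measurable]: "A \<in> sets borel" by simp
        \<comment> \<open>\<open>B\<close> is the image of the positive part of \<open>A\<close>
          under d \<mapsto> ln d - ln s0. It translates the events of the prices into events of the
          logarithms, for which the weighted laws are known to agree.\<close>
        define B where "B = {z. s0 * exp z \<in> A}"
        have "(\<lambda>z. s0 * exp z) -` A \<inter> space borel \<in> sets borel"
          by (rule measurable_sets[OF _ A]) measurable
        then have B: "B \<in> sets borel" by (simp add: B_def vimage_def)
        have BA: "indicat_real B (ln d - ln s0) = indicator A d" if "0 < d" for d
          using that assms(19) by (simp add: B_def indicator_def exp_diff)
        have "(LINT x:A|distr M borel (D1 t). cond_exp_at M (D1 t) (\<lambda>_ \<omega>. V t \<omega>) x) = (\<integral>\<omega>. indicator A (D1 t \<omega>) * V t \<omega> \<partial>M)"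
          by (rule E1(2)[OF A])
        also have "\<dots> = (\<integral>\<omega>. indicator B (L1 t \<omega>) * (a1 t \<omega>)\<^sup>2 \<partial>M)"
          by (intro Bochner_Integration.integral_cong) (use t D1pos in \<open>auto simp: L1_def BA a1V\<close>)
        also have "\<dots> = (\<integral>\<omega>. indicator B (L2 t \<omega>) * (a2 t \<omega>)\<^sup>2 \<partial>M)" by (rule weighted[OF B])
        also have "\<dots> = (\<integral>\<omega>. indicator A (D2 t \<omega>) * (\<sigma> t (D2 t \<omega> * exp (integrated_rate r t \<omega>)))\<^sup>2 \<partial>M)"
          unfolding X_eq by (intro Bochner_Integration.integral_cong) (use t D2pos in \<open>auto simp: L2_def BA a2_def\<close>)
        also have "\<dots> = (LINT x:A|distr M borel (D2 t). cond_exp_at M (D2 t) (\<lambda>x' \<omega>. (\<sigma> t (x' * exp (integrated_rate r t \<omega>)))\<^sup>2) x)"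
          by (rule E2(2)[OF A, symmetric])
        finally show "(LINT x:A|distr M borel (D1 t). cond_exp_at M (D1 t) (\<lambda>_ \<omega>. V t \<omega>) x) =
            (LINT x:A|distr M borel (D1 t). cond_exp_at M (D2 t) (\<lambda>x' \<omega>. (\<sigma> t (x' * exp (integrated_rate r t \<omega>)))\<^sup>2) x)"
          unfolding law .
      qed
      then show "AE x in distr M borel (discounted r S t).
        cond_exp_at M (discounted r S t) (\<lambda>_ \<omega>. V t \<omega>) x =
        cond_exp_at M (discounted r X t) (\<lambda>x' \<omega>. (\<sigma> t (x' * exp (integrated_rate r t \<omega>)))\<^sup>2) x"
        unfolding D1_def D2_def .
    qed
  qed
qed

end
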